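(* Let $f\in\mathscr{M}[\underline x]$. Then $\varphi(f)\ge0$ for every pseudo-moment evaluation $\varphi:\mathscr{M}[\underline x]\to\mathbb{R}$ if and only if there exist $g,h\in\widehat\Omega$ with $h\neq0$ and $f=g/h$ (i.e. $hf=g$).
   Context: Let $\mathbb{R}[\underline x]=\mathbb{R}[x_1,\dots,x_n]$. Let $\mathscr{M}=\mathbb{R}[\mathtt{m}_{i_1,\dots,i_n}\colon (i_1,\dots,i_n)\in\mathbb{N}_0^n]$ be the polynomial ring in countably many indeterminates, with $\mathtt{m}_{0,\dots,0}:=1$, and $\mathscr{M}[\underline x]=\mathscr{M}\otimes_{\mathbb{R}}\mathbb{R}[\underline x]$. Let $\mathtt{m}:\mathscr{M}[\underline x]\to\mathscr{M}$ be the unique $\mathscr{M}$-linear map with $\mathtt{m}(x_1^{i_1}\cdots x_n^{i_n})=\mathtt{m}_{i_1,\dots,i_n}$. A pseudo-moment evaluation is a homomorphism of $\mathbb{R}$-algebras $\varphi:\mathscr{M}[\underline x]\to\mathbb{R}$ with $\varphi(\mathtt{m}(p^2))\ge0$ for all $p\in\mathbb{R}[\underline x]$. Let $\widehat\Omega=\{\sum_i f_{i0}^2\,\mathtt{m}(f_{i1}^2)\cdots\mathtt{m}(f_{ik_i}^2)\colon k_i\in\mathbb{N}_0,\ f_{ij}\in\mathscr{M}[\underline x]\}$ (finite sums), i.e. the preordering of $\mathscr{M}[\underline x]$ generated by the elements $\mathtt{m}(g^2)$, $g\in\mathscr{M}[\underline x]$. *)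

theory Defs
  imports Complex_Main "HOL-Library.Poly_Mapping"
begin

text \<open>Multi-indices in N_0^n with n = CARD('n) (index type 'n :: finite).
  Nonzero multi-indices index the indeterminates m_alpha (m_0 := 1).\<close>

typedef 'n nzidx = "{\<alpha> :: 'n \<Rightarrow> nat. \<alpha> \<noteq> (\<lambda>_. 0)}"
  by (rule exI[of _ "\<lambda>_. 1"]) (simp add: fun_eq_iff)

text \<open>Indeterminates of M[x]: x_i (i :: 'n) and m_alpha (alpha nonzero).\<close>
datatype 'n mvar = XV 'n | MV "'n nzidx"

type_synonym 'n Mpoly = "('n mvar \<Rightarrow>\<^sub>0 nat) \<Rightarrow>\<^sub>0 real"

definition pvar :: "'n mvar \<Rightarrow> 'n Mpoly" where
  "pvar v = Poly_Mapping.single (Poly_Mapping.single v 1) 1"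

definition pconst :: "real \<Rightarrow> 'n Mpoly" where
  "pconst c = Poly_Mapping.single 0 c"

definition xvar :: "'n \<Rightarrow> 'n Mpoly" where
  "xvar i = pvar (XV i)"

definition mgen :: "('n \<Rightarrow> nat) \<Rightarrow> 'n Mpoly" where
  "mgen \<alpha> = (if \<alpha> = (\<lambda>_. 0) then 1 else pvar (MV (Abs_nzidx \<alpha>)))"

definition is_M_var :: "'n mvar \<Rightarrow> bool" where
  "is_M_var v = (case v of MV _ \<Rightarrow> True | XV _ \<Rightarrow> False)"

definition in_M :: "'n Mpoly \<Rightarrow> bool" where
  "in_M p = (\<forall>mon\<in> Poly_Mapping.keys p. \<forall>v \<in> Poly_Mapping.keys mon. is_M_var v)"

definition in_Rx :: "'n Mpoly \<Rightarrow> bool" where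
  "in_Rx p = (\<forall>mon\<in> Poly_Mapping.keys p. \<forall>v \<in> Poly_Mapping.keys mon. \<not> is_M_var v)"

definition mpart :: "('n mvar \<Rightarrow>\<^sub>0 nat) \<Rightarrow> 'n Mpoly" where
  "mpart mon = (\<Prod>v\<in>{v\<in>Poly_Mapping.keys mon. is_M_var v}. pvar v ^ Poly_Mapping.lookup mon v)"

text \<open>The unique M-linear map m : M[x] \<rightarrow> M with m(x^alpha) = m_alpha.\<close>
definition mlin :: "'n::finite Mpoly \<Rightarrow> 'n Mpoly" where
  "mlin p = (\<Sum>mon\<in>Poly_Mapping.keys p. pconst (Poly_Mapping.lookup p mon) * mpart mon * mgen (\<lambda>i. Poly_Mapping.lookup mon (XV i)))"

definition pme :: "('n::finite Mpoly \<Rightarrow> real) \<Rightarrow> bool" where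
  "pme \<phi> \<longleftrightarrow>
     (\<forall>p q. \<phi> (p + q) = \<phi> p + \<phi> q) \<and>
     (\<forall>p q. \<phi> (p * q) = \<phi> p * \<phi> q) \<and>
     (\<forall>c. \<phi> (pconst c) = c) \<and>
     (\<forall>p. in_Rx p \<longrightarrow> \<phi> (mlin (p ^ 2)) \<ge> 0)"

definition Omega_hat :: "'n::finite Mpoly set" where
  "Omega_hat = {p. \<exists>(N::nat) (k::nat \<Rightarrow> nat) (f::nat \<Rightarrow> nat \<Rightarrow> 'n Mpoly).
                 p = (\<Sum>i<N. (f i 0) ^ 2 * (\<Prod>j\<in>{1..k i}. mlin ((f i j) ^ 2)))}"

end

theory Submission
  imports Defs "HOL-Algebra.Algebraic_Closure_Type" "HOL-Library.Countable"
begin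

text \<open>
  Order the multi-indices by a monomial order of type \<open>\<omega>\<close> and run the Gram--Schmidt process for the form
  \<open>(p, q) \<mapsto> m(p q)\<close> on the monomials; this gives \<open>G\<^sub>w \<in> \<M>[x]\<close> with norms \<open>N\<^sub>w = m(G\<^sub>w\<^sup>2)\<close>.
  A real point at which all \<open>N\<^sub>w\<close> are positive is a pseudo-moment evaluation, and since \<open>N\<^sub>w\<close> is affine in \<open>m\<^bsub>2w\<^esub>\<close>
  with positive leading coefficient, a point at which finitely many \<open>N\<^sub>w\<close> are positive can be moved
  into such an evaluation by enlarging the \<open>m\<^bsub>2w\<^esub>\<close> of high order.

  If \<open>f\<close> is not a quotient of elements of the preordering, then the preordering generated by
  \<open>-f\<close> is still pointed and extends to an ordering of the quotient field. In a real closure of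
  this field \<open>-f\<close> and the \<open>N\<^sub>w\<close> are positive, so by the Artin--Lang theorem there is a real point at which \<open>-f\<close>
  and the finitely many relevant \<open>N\<^sub>w\<close> are positive, hence a pseudo-moment evaluation at which \<open>f\<close> is negative.
  Artin--Lang is obtained from Cohen--Hoermander elimination carried out simultaneously over the real closure and over the reals.

  Conversely, pseudo-moment evaluations form a convex set of points on which no nonzero polynomial
  vanishes identically; so if \<open>h f = g\<close> and \<open>f\<close> is negative somewhere, then also at a point with \<open>h \<noteq> 0\<close>.
\<close>

section \<open>Real closed fields\<close>

text \<open>The real closure is not built by adjoining roots. It is found inside the algebraic
  closure of the fraction field: Zorn's lemma gives a maximal cone M closed under inverses, and
  since a cone is tied only to the subfield that it generates, maximality enlarges the field and its
  ordering together. M is total on its differences, so M and -M together form an ordered field,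
  whose intermediate value property follows from maximality by induction on the degree. This
  property is the whole axiom of \<open>rcf\<close>, because Rolle, the mean value theorem and the
  elimination rest on nothing else.

  The elimination produces no formula. It keeps a finite order isomorphism between breakpoints in
  two fields and records finitely many sign conditions on the coefficients under which this
  isomorphism exists.

  Pointedness of the preordering generated by -f has two sources: a failure would either write f as
  a quotient or violate pointedness of \<open>Omega_hat\<close> itself. The latter holds because no
  nonzero polynomial vanishes at all positive definite points, a density statement that serves both
  directions.\<close>

class rcf = linordered_field +
  assumes ivt_sum: "a < b \<Longrightarrow> (\<Sum>k\<le>n. f k * a ^ k) * (\<Sum>k\<le>n. f k * b ^ k) < 0
    \<Longrightarrow> \<exists>x>a. x < b \<and> (\<Sum>k\<le>(n::nat). f k * x ^ k) = 0"

lemma poly_ivt: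
  fixes p :: "'a::rcf poly"
  assumes "a < b" "poly p a * poly p b < 0"
  obtains x where "a < x" "x < b" "poly p x = 0"
  using ivt_sum[of a b "coeff p" "degree p"] assms by (auto simp: poly_altdef)

instance real :: rcf
proof
  fix a b :: real and f :: "nat \<Rightarrow> real" and n :: nat
  let ?p = "\<lambda>x. \<Sum>k\<le>n. f k * x ^ k"
  assume ab: "a < b" and s: "?p a * ?p b < 0"
  have c: "continuous_on {a..b} ?p" by (intro continuous_intros)
  have "\<exists>x. a \<le> x \<and> x \<le> b \<and> ?p x = 0"
    using IVT'[of ?p a 0 b] IVT2'[of ?p b 0 a] ab s c by (auto simp: mult_less_0_iff)
  then obtain x where x: "a \<le> x" "x \<le> b" "?p x = 0" by blast
  moreover have "x \<noteq> a" "x \<noteq> b" using s x(3) by auto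
  ultimately show "\<exists>x>a. x < b \<and> ?p x = 0" by (intro exI[of _ x]) auto
qed

text \<open>An extremum argument would need compactness. Instead let d be the next root after a and
  write p = (X-a)^(m+1) (X-d)^(n+1) q. Then q has the same sign at a and d, and p' = (X-a)^m (X-d)^n
  g where g has opposite signs at a and d.\<close>

lemma poly_rolle:
  fixes p :: "'a::rcf poly"
  assumes ab: "a < b" and pa: "poly p a = 0" and pb: "poly p b = 0" and p0: "p \<noteq> 0"
  obtains c where "a < c" "c < b" "poly (pderiv p) c = 0"
proof -
  define S where "S = {x. a < x \<and> x \<le> b \<and> poly p x = 0}"
  have fS: "finite S" using poly_roots_finite[OF p0] by (rule rev_finite_subset) (auto simp: S_def)
  have bS: "b \<in> S" using ab pb by (auto simp: S_def)
  define d where "d = Min S"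
  have dS: "d \<in> S" using fS bS by (auto simp: d_def intro: Min_in)
  have nor: "poly p x \<noteq> 0" if "a < x" "x < d" for x
  proof
    assume "poly p x = 0"
    then have "x \<in> S" using that dS by (auto simp: S_def)
    then have "d \<le> x" using fS by (simp add: d_def)
    then show False using that by simp
  qed
  have ad: "a < d" "d \<le> b" "poly p d = 0" using dS by (auto simp: S_def)
  obtain r where r: "p = [:-a, 1:] ^ order a p * r" "\<not> [:-a, 1:] dvd r"
    using order_decomp[OF p0] by blast
  have r0: "r \<noteq> 0" using r(2) by auto
  obtain q where q: "r = [:-d, 1:] ^ order d r * q" "\<not> [:-d, 1:] dvd q"
    using order_decomp[OF r0] by blast
  have "order a p \<noteq> 0" using pa p0 order_root by blast
  then obtain m where m: "order a p = Suc m" using not0_implies_Suc by blast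
  have "poly r d = 0" using ad arg_cong[OF r(1), of "\<lambda>p. poly p d"] by auto
  then have "order d r \<noteq> 0" using r0 order_root by blast
  then obtain n where n: "order d r = Suc n" using not0_implies_Suc by blast
  define A where "A = [:-a, 1:]"
  define D where "D = [:-d, 1:]"
  have pe: "p = A ^ Suc m * (D ^ Suc n * q)" using r(1) q(1) m n by (simp add: A_def D_def)
  have qa: "poly q a \<noteq> 0" using r(2) q(1) by (metis dvd_mult poly_eq_0_iff_dvd)
  have qd: "poly q d \<noteq> 0" using q(2) by (metis poly_eq_0_iff_dvd)
  have qn: "poly q x \<noteq> 0" if "a < x" "x < d" for x using nor[OF that] pe by auto
  have qs: "poly q a * poly q d > 0"
  proof (rule ccontr)
    assume "\<not> ?thesis"
    then have "poly q a * poly q d < 0" using qa qd by (simp add: not_less order_less_le)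
    then show False using poly_ivt[OF ad(1), of q] qn by metis
  qed
  define g where "g = smult (of_nat (Suc m)) (D * q) + smult (of_nat (Suc n)) (A * q) + A * D * pderiv q"
  have dA: "pderiv A = 1" "pderiv D = 1" by (simp_all add: A_def D_def pderiv_pCons)
  have dpow: "pderiv (A ^ Suc m) = smult (of_nat (Suc m)) (A ^ m)"
    "pderiv (D ^ Suc n) = smult (of_nat (Suc n)) (D ^ n)"
    by (simp_all only: pderiv_power_Suc dA mult_1_right)
  have dp: "pderiv p = A ^ m * D ^ n * g"
    unfolding pe g_def pderiv_mult dpow by (simp add: algebra_simps)
  have ga: "poly g a = of_nat (Suc m) * (a - d) * poly q a"
    by (simp add: g_def A_def D_def algebra_simps)
  have gd: "poly g d = of_nat (Suc n) * (d - a) * poly q d"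
    by (simp add: g_def A_def D_def algebra_simps)
  have "poly g a * poly g d = - (of_nat (Suc m) * of_nat (Suc n) * (d - a)^2 * (poly q a * poly q d))"
    by (simp only: ga gd) (simp add: algebra_simps power2_eq_square)
  moreover have "of_nat (Suc m) * of_nat (Suc n) * (d - a)^2 * (poly q a * poly q d) > 0"
    using ad(1) by (intro mult_pos_pos[OF _ qs] mult_pos_pos) (simp_all del: of_nat_Suc)
  ultimately have "poly g a * poly g d < 0" by simp
  then obtain c where "a < c" "c < d" "poly g c = 0" using poly_ivt[OF ad(1), of g] by metis
  then show ?thesis using ad(2) that[of c] dp by auto
qed

lemma poly_mvt:
  fixes p :: "'a::rcf poly"
  assumes xy: "x < y"
  obtains c where "x < c" "c < y" "poly p y - poly p x = (y - x) * poly (pderiv p) c"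
proof -
  define r where "r = smult (y - x) (p - [:poly p x:]) - smult (poly p y - poly p x) [:-x, 1:]"
  have d: "poly (pderiv r) c = (y - x) * poly (pderiv p) c - (poly p y - poly p x)" for c
    by (simp add: r_def pderiv_diff pderiv_smult pderiv_pCons)
  show ?thesis
  \<comment> \<open>\<open>poly_rolle\<close> demands a nonzero polynomial; if r vanishes
    identically, any intermediate point serves.\<close>
  proof (cases "r = 0")
    case True
    obtain c where "x < c" "c < y" using xy dense by blast
    then show ?thesis using d[of c] True that[of c] by auto
  next
    case False
    have "poly r x = 0" "poly r y = 0" by (auto simp: r_def algebra_simps)
    then obtain c where "x < c" "c < y" "poly (pderiv r) c = 0" using poly_rolle[OF xy] False by metis
    then show ?thesis using d[of c] that[of c] by auto
  qed
qed

section \<open>Comparing signs across two ordered fields; signs near infinity\<close>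

definition ssame :: "'a::linordered_field \<Rightarrow> 'b::linordered_field \<Rightarrow> bool" where
  "ssame a b \<longleftrightarrow> (0 < a \<longleftrightarrow> 0 < b) \<and> (a < 0 \<longleftrightarrow> b < 0)"

lemma ssame_refl [simp]: "ssame a a"
  and ssame_zero [simp]: "ssame 0 b \<longleftrightarrow> b = 0" "ssame a 0 \<longleftrightarrow> a = 0"
  by (auto simp: ssame_def)

lemma ssame_sym: "ssame a b \<Longrightarrow> ssame b a"
  by (simp add: ssame_def)

lemma ssame_trans: "ssame a b \<Longrightarrow> ssame b c \<Longrightarrow> ssame a c"
  by (simp add: ssame_def)

lemma ssame_eq_0_iff: "ssame a b \<Longrightarrow> a = 0 \<longleftrightarrow> b = 0"
  by (metis linorder_less_linear order_less_irrefl ssame_def)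

lemma ssame_mult: "ssame a b \<Longrightarrow> ssame c d \<Longrightarrow> ssame (a * c) (b * d)"
  by (auto simp: ssame_def zero_less_mult_iff mult_less_0_iff)

lemma ssame_prod_neg: "ssame a b \<Longrightarrow> ssame c d \<Longrightarrow> a * c < 0 \<Longrightarrow> b * d < 0"
  using ssame_mult by (auto simp: ssame_def)

lemma ssame_mult_pos: "c > 0 \<Longrightarrow> ssame (c * a) a" "c > 0 \<Longrightarrow> ssame a (c * a)"
  by (auto simp: ssame_def zero_less_mult_iff mult_less_0_iff)

lemma ssame_mult_gt_0: "ssame a b \<Longrightarrow> a \<noteq> 0 \<Longrightarrow> a * b > 0"
  by (auto simp: ssame_def zero_less_mult_iff linorder_neq_iff)

lemma poly_no_root_ssame:
  fixes p :: "'a::rcf poly"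
  assumes "\<And>z. x \<le> z \<Longrightarrow> z \<le> y \<Longrightarrow> poly p z \<noteq> 0" "x \<le> y"
  shows "ssame (poly p x) (poly p y)"
proof (cases "x = y")
  case False
  then have xy: "x < y" using assms by simp
  have nz: "poly p x \<noteq> 0" "poly p y \<noteq> 0" using assms by auto
  have "\<not> poly p x * poly p y < 0" using poly_ivt[OF xy] assms(1) by (metis order_less_imp_le)
  then show ?thesis using nz by (auto simp: ssame_def mult_less_0_iff not_less)
qed simp

text \<open>Horner step: once the tail satisfies s * p(x) > 1, the product x * (s * p(x)) is at
  least x for x \<ge> 1, which absorbs the constant term and K.\<close>

lemma poly_large:
  fixes p :: "'a::linordered_field poly"
  assumes "degree p > 0"
  shows "\<exists>B. \<forall>x\<ge>B. sgn (lead_coeff p) * poly p x > K"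
  using assms
proof (induction p arbitrary: K)
  case (pCons a p)
  then have p0: "p \<noteq> 0" by auto
  define s where "s = sgn (lead_coeff p)"
  have lc: "lead_coeff (pCons a p) = lead_coeff p" using p0 by simp
  show ?case
  proof (cases "degree p > 0")
    case True
    then obtain B where B: "\<And>x. x \<ge> B \<Longrightarrow> s * poly p x > 1" using pCons.IH[of 1] by (auto simp: s_def)
    show ?thesis
    proof (intro exI[of _ "max B (max 1 (K - s * a + 1))"] allI impI)
      fix x assume "max B (max 1 (K - s * a + 1)) \<le> x"
      then have x: "B \<le> x" "1 \<le> x" "K - s * a + 1 \<le> x" by auto
      have "x * 1 \<le> x * (s * poly p x)" using B[OF x(1)] x(2) by (intro mult_left_mono) auto
      moreover have "sgn (lead_coeff (pCons a p)) * poly (pCons a p) x = s * a + x * (s * poly p x)"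
        by (simp add: s_def algebra_simps p0)
      ultimately show "K < sgn (lead_coeff (pCons a p)) * poly (pCons a p) x"
        using x(3) by (simp add: algebra_simps)
    qed
  next
    case False
    then obtain c where c: "p = [:c:]" using degree_eq_zeroE by blast
    then have c0: "c \<noteq> 0" using p0 by auto
    have sc: "sgn c * c = \<bar>c\<bar>" by (simp add: abs_sgn mult.commute)
    show ?thesis
    proof (intro exI[of _ "(K - s * a) / \<bar>c\<bar> + 1"] allI impI)
      fix x assume "(K - s * a) / \<bar>c\<bar> + 1 \<le> x"
      then have "(K - s * a) / \<bar>c\<bar> < x" by (metis add_strict_increasing2 less_add_one order_less_le_trans)
      then have "K - s * a < x * \<bar>c\<bar>" using c0 by (simp add: pos_divide_less_eq)
      moreover have "sgn (lead_coeff (pCons a p)) * poly (pCons a p) x = s * a + x * \<bar>c\<bar>"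
        using c0 by (simp add: c s_def sc[symmetric] algebra_simps)
      ultimately show "K < sgn (lead_coeff (pCons a p)) * poly (pCons a p) x" by (simp add: algebra_simps)
    qed
  qed
qed simp


lemma poly_sgn_at_top:
  fixes p :: "'a::linordered_field poly"
  shows "\<exists>B. \<forall>x\<ge>B. ssame (poly p x) (lead_coeff p)"
proof (cases "degree p > 0")
  case True
  then obtain B where B: "\<And>x. x \<ge> B \<Longrightarrow> sgn (lead_coeff p) * poly p x > 0"
    using poly_large[of p 0] by auto
  have "ssame (poly p x) (lead_coeff p)" if "x \<ge> B" for x
    using B[OF that] True by (cases "lead_coeff p" "0::'a" rule: linorder_cases) (auto simp: ssame_def)
  then show ?thesis by blast
next
  case False
  then obtain c where "p = [:c:]" using degree_eq_zeroE by blast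
  then show ?thesis by auto
qed

lemma poly_sgn_at_bot:
  fixes p :: "'a::linordered_field poly"
  shows "\<exists>B. \<forall>x\<le>B. ssame (poly p x) ((-1) ^ degree p * lead_coeff p)"
proof -
  define r where "r = pcompose p [:0, -1:]"
  have "lead_coeff r = (-1) ^ degree p * lead_coeff p"
    by (simp add: r_def lead_coeff_comp mult.commute)
  moreover obtain B where "\<And>x. x \<ge> B \<Longrightarrow> ssame (poly r x) (lead_coeff r)"
    using poly_sgn_at_top[of r] by blast
  ultimately have "\<And>x. x \<ge> B \<Longrightarrow> ssame (poly p (- x)) ((-1) ^ degree p * lead_coeff p)"
    by (simp add: r_def poly_pcompose)
  then show ?thesis by (metis minus_minus neg_le_iff_le)
qed

lemma ssame_at_bot:
  fixes p :: "'a::linordered_field poly" and q :: "'b::linordered_field poly"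
  assumes "ssame (lead_coeff p) (lead_coeff q)" "degree p = degree q"
  shows "\<exists>B C. \<forall>x\<le>B. \<forall>y\<le>C. ssame (poly p x) (poly q y)"
proof -
  have "ssame ((-1) ^ degree p * lead_coeff p) ((-1) ^ degree q * lead_coeff q)"
    using assms by (cases "even (degree q)") (auto simp: ssame_def)
  then show ?thesis using poly_sgn_at_bot[of p] poly_sgn_at_bot[of q] by (meson ssame_sym ssame_trans)
qed

lemma ssame_at_top:
  fixes p :: "'a::linordered_field poly" and q :: "'b::linordered_field poly"
  assumes "ssame (lead_coeff p) (lead_coeff q)"
  shows "\<exists>B C. \<forall>x\<ge>B. \<forall>y\<ge>C. ssame (poly p x) (poly q y)"
  using assms poly_sgn_at_top[of p] poly_sgn_at_top[of q] by (meson ssame_sym ssame_trans)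

text \<open>The pairs in \<open>Z\<close> match the end points of the cells of two ordered fields; \<open>sim Z x y\<close> says that
  \<open>x\<close> and \<open>y\<close> lie in corresponding cells.\<close>

definition sim :: "('a::linordered_field \<times> 'b::linordered_field) set \<Rightarrow> 'a \<Rightarrow> 'b \<Rightarrow> bool" where
  "sim Z x y \<longleftrightarrow> (\<forall>(z, w)\<in>Z. (z < x \<longleftrightarrow> w < y) \<and> (x < z \<longleftrightarrow> y < w))"

text \<open>Applied to the pairs of Z, \<open>sim\<close> makes Z an order isomorphism between two
  finite sets. Z may contain points that are roots of no polynomial in S;
  \<open>matched_coarsen\<close> removes this surplus when S shrinks.\<close>

definition matched :: "('a::linordered_field poly \<times> 'b::linordered_field poly) set \<Rightarrow> ('a \<times> 'b) set \<Rightarrow> bool" where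
  "matched S Z \<longleftrightarrow> finite Z \<and> (\<forall>(z, w)\<in>Z. sim Z z w) \<and>
    (\<forall>(p, q)\<in>S. (p = 0 \<longleftrightarrow> q = 0) \<and> (p \<noteq> 0 \<longrightarrow> {x. poly p x = 0} \<subseteq> fst ` Z \<and> {y. poly q y = 0} \<subseteq> snd ` Z)) \<and>
    (\<forall>x y. sim Z x y \<longrightarrow> (\<forall>(p, q)\<in>S. ssame (poly p x) (poly q y)))"

lemma sim_converse: "sim (Z\<inverse>) y x \<longleftrightarrow> sim Z x y"
  by (auto simp: sim_def)

lemma sim_mono: "sim Z x y \<Longrightarrow> Y \<subseteq> Z \<Longrightarrow> sim Y x y"
  by (auto simp: sim_def)

lemma simD: "sim Z x y \<Longrightarrow> (z, w) \<in> Z \<Longrightarrow> (z < x \<longleftrightarrow> w < y) \<and> (x < z \<longleftrightarrow> y < w) \<and> (z = x \<longleftrightarrow> w = y)"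
  unfolding sim_def by (metis (mono_tags, lifting) case_prodD linorder_less_linear order_less_irrefl)

lemma finite_between:
  fixes L U :: "'a::linordered_field set"
  assumes "finite L" "finite U" "\<And>l u. l \<in> L \<Longrightarrow> u \<in> U \<Longrightarrow> l < u"
  shows "\<exists>y. (\<forall>l\<in>L. l < y) \<and> (\<forall>u\<in>U. y < u)"
proof (cases "L = {} \<or> U = {}")
  case True
  then show ?thesis
  proof
    assume L: "L = {}"
    show ?thesis
    proof (cases "U = {}")
      case False
      then have "Min U - 1 < u" if "u \<in> U" for u using that assms(2) Min_le[of U u] by (metis diff_less_eq le_less_trans less_add_one)
      then show ?thesis using L by auto
    qed (use L in auto)
  next
    assume U: "U = {}"
    show ?thesis
    proof (cases "L = {}")
      case False
      then have "l < Max L + 1" if "l \<in> L" for l using that assms(1) Max_ge[of L l] by (metis le_less_trans less_add_one)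
      then show ?thesis using U by auto
    qed (use U in auto)
  qed
next
  case False
  then have "Max L < Min U" using assms by auto
  then obtain y where "Max L < y" "y < Min U" using dense by blast
  then show ?thesis using False assms(1,2) by auto
qed

text \<open>Transfers a point of one field to the corresponding cell of the other. In
  \<open>ordering_approx\<close> this produces the real value of a new indeterminate.\<close>

lemma sim_exists:
  assumes fin: "finite Z" and Z: "\<And>z w. (z, w) \<in> Z \<Longrightarrow> sim Z z w"
  shows "\<exists>y. sim Z x y"
proof (cases "x \<in> fst ` Z")
  case True
  then obtain y where "(x, y) \<in> Z" by force
  then show ?thesis using Z by blast
next
  case False
  define L where "L = {w. \<exists>z. (z, w) \<in> Z \<and> z < x}"
  define U where "U = {w. \<exists>z. (z, w) \<in> Z \<and> x < z}"
  have "finite L" "finite U"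
    by (rule finite_subset[OF _ finite_imageI[OF fin, of snd]]; force simp: L_def U_def)+
  moreover have "l < u" if "l \<in> L" "u \<in> U" for l u
    using that unfolding L_def U_def by clarify (meson Z order_less_trans simD)
  ultimately obtain y where y: "\<forall>l\<in>L. l < y" "\<forall>u\<in>U. y < u" using finite_between[of L U] by blast
  have "(z < x \<longleftrightarrow> w < y) \<and> (x < z \<longleftrightarrow> y < w)" if zw: "(z, w) \<in> Z" for z w
  proof -
    have "z \<noteq> x" using False zw by force
    then consider "z < x" | "x < z" by fastforce
    then show ?thesis
    proof cases
      case 1
      then have "w < y" using y(1) zw by (auto simp: L_def)
      then show ?thesis using 1 by auto
    next
      case 2
      then have "y < w" using y(2) zw by (auto simp: U_def)
      then show ?thesis using 2 by auto
    qed
  qed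
  then show ?thesis unfolding sim_def by blast
qed

section \<open>Matchings: symmetry, restriction and extension\<close>

lemma matchedD:
  assumes "matched S Z"
  shows "finite Z" "\<And>z w. (z, w) \<in> Z \<Longrightarrow> sim Z z w"
    "\<And>p q. (p, q) \<in> S \<Longrightarrow> p = 0 \<longleftrightarrow> q = 0"
    "\<And>p q x. (p, q) \<in> S \<Longrightarrow> p \<noteq> 0 \<Longrightarrow> poly p x = 0 \<Longrightarrow> \<exists>y. (x, y) \<in> Z"
    "\<And>p q y. (p, q) \<in> S \<Longrightarrow> q \<noteq> 0 \<Longrightarrow> poly q y = 0 \<Longrightarrow> \<exists>x. (x, y) \<in> Z"
    "\<And>p q x y. (p, q) \<in> S \<Longrightarrow> sim Z x y \<Longrightarrow> ssame (poly p x) (poly q y)"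
proof -
  note m = assms[unfolded matched_def]
  show "finite Z" "\<And>z w. (z, w) \<in> Z \<Longrightarrow> sim Z z w" "\<And>p q. (p, q) \<in> S \<Longrightarrow> p = 0 \<longleftrightarrow> q = 0"
    "\<And>p q x y. (p, q) \<in> S \<Longrightarrow> sim Z x y \<Longrightarrow> ssame (poly p x) (poly q y)"
    using m by blast+
  show "\<exists>y. (x, y) \<in> Z" if pq: "(p, q) \<in> S" "p \<noteq> 0" and r: "poly p x = 0" for p q x
  proof -
    have "{x. poly p x = 0} \<subseteq> fst ` Z" using m pq by blast
    then show ?thesis using r by force
  qed
  show "\<exists>x. (x, y) \<in> Z" if pq: "(p, q) \<in> S" "q \<noteq> 0" and r: "poly q y = 0" for p q y
  proof -
    have "{x. poly q x = 0} \<subseteq> snd ` Z" using m pq by blast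
    then show ?thesis using r by force
  qed
qed

lemma matchedI:
  assumes "finite Z" "\<And>z w. (z, w) \<in> Z \<Longrightarrow> sim Z z w"
    "\<And>p q. (p, q) \<in> S \<Longrightarrow> p = 0 \<longleftrightarrow> q = 0"
    "\<And>p q x. (p, q) \<in> S \<Longrightarrow> p \<noteq> 0 \<Longrightarrow> poly p x = 0 \<Longrightarrow> \<exists>y. (x, y) \<in> Z"
    "\<And>p q y. (p, q) \<in> S \<Longrightarrow> q \<noteq> 0 \<Longrightarrow> poly q y = 0 \<Longrightarrow> \<exists>x. (x, y) \<in> Z"
    "\<And>p q x y. (p, q) \<in> S \<Longrightarrow> sim Z x y \<Longrightarrow> ssame (poly p x) (poly q y)"
  shows "matched S Z"
proof -
  have "{x. poly p x = 0} \<subseteq> fst ` Z" "{y. poly q y = 0} \<subseteq> snd ` Z" if "(p, q) \<in> S" "p \<noteq> 0" for p q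
    using assms(3,4,5)[OF that(1)] that(2) by force+
  then show ?thesis unfolding matched_def using assms(1,2,3,6) by blast
qed

lemma matched_converse:
  assumes "matched S Z"
  shows "matched (S\<inverse>) (Z\<inverse>)"
proof -
  note D = matchedD[OF assms]
  show ?thesis
    by (rule matchedI) (use D in \<open>auto simp: sim_converse intro: ssame_sym\<close>)
qed

text \<open>Fewer breakpoints make larger cells, so \<open>sim Y\<close> is weaker than
  \<open>sim Z\<close>. Given x and y in matching large cells, choose y0 in the small cell of x: a
  root of q between y0 and y would be a breakpoint in Y separating them, so q has the same sign at
  both.\<close>

lemma matched_coarsen:
  fixes S T :: "('a::rcf poly \<times> 'b::rcf poly) set"
  assumes m: "matched S Z" and TS: "T \<subseteq> S"
  defines "Y \<equiv> {(z, w) \<in> Z. \<exists>(p, q)\<in>T. p \<noteq> 0 \<and> poly p z = 0}"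
  shows "matched T Y"
proof -
  note D = matchedD[OF m]
  have YZ: "Y \<subseteq> Z" by (auto simp: Y_def)
  \<comment> \<open>Y is selected by roots on the first side only; sign agreement at the pairs of Z
    carries this over to the second side.\<close>
  have rq: "\<exists>x. (x, y) \<in> Y" if t: "(p, q) \<in> T" "q \<noteq> 0" "poly q y = 0" for p q y
  proof -
    have pq: "(p, q) \<in> S" using t TS by blast
    then obtain x where x: "(x, y) \<in> Z" using D(5)[OF pq t(2,3)] by blast
    then have "ssame (poly p x) (poly q y)" using D(2,6) pq by blast
    then have "poly p x = 0" using t by simp
    then have "(x, y) \<in> Y" using x t D(3)[OF pq] unfolding Y_def by auto
    then show ?thesis by blast
  qed
  have same: "ssame (poly q y0) (poly q y)" 
    if pq: "(p, q) \<in> T" and s: "sim Y x y0" "sim Y x y" and le: "y0 \<le> y" for p q x y0 y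
  proof (cases "q = 0 \<or> y0 = y")
    case False
    have "poly q r \<noteq> 0" if r: "y0 \<le> r" "r \<le> y" for r
    proof
      assume "poly q r = 0"
      then obtain z where "(z, r) \<in> Y" using rq pq False by blast
      then show False using simD[OF s(1)] simD[OF s(2)] r False
        by (metis le_less order_less_le_trans not_less)
    qed
    then show ?thesis using poly_no_root_ssame[of y0 y q] le by blast
  qed auto
  show ?thesis
  proof (rule matchedI)
    show "finite Y" using finite_subset[OF YZ] D(1) by blast
    show "sim Y z w" if "(z, w) \<in> Y" for z w using that D(2) YZ sim_mono by blast
    show "p = 0 \<longleftrightarrow> q = 0" if "(p, q) \<in> T" for p q using D(3) TS that by blast
    show "\<exists>y. (x, y) \<in> Y" if t: "(p, q) \<in> T" "p \<noteq> 0" "poly p x = 0" for p q x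
    proof -
      obtain y where "(x, y) \<in> Z" using D(4)[of p q x] t TS by blast
      then show ?thesis using t unfolding Y_def by blast
    qed
    show "\<exists>x. (x, y) \<in> Y" if "(p, q) \<in> T" "q \<noteq> 0" "poly q y = 0" for p q y using rq that by blast
    show "ssame (poly p x) (poly q y)" if pq: "(p, q) \<in> T" and s: "sim Y x y" for p q x y
    proof -
      obtain y0 where y0: "sim Z x y0" using sim_exists[OF D(1,2)] by blast
      then have s0: "sim Y x y0" using YZ sim_mono by blast
      have "ssame (poly p x) (poly q y0)" using D(6) y0 pq TS by blast
      moreover have "ssame (poly q y0) (poly q y)"
        using same[OF pq s0 s] same[OF pq s s0] ssame_sym by (cases "y0 \<le> y") auto
      ultimately show ?thesis using ssame_trans by blast
    qed
  qed
qed


text \<open>The roots of p' are breakpoints, so any two roots of p are separated by Z: p has at most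
  one root inside a cell.\<close>

lemma matched_rolle:
  fixes S :: "('a::rcf poly \<times> 'b::rcf poly) set"
  assumes m: "matched S Z" and d: "(pderiv p, pderiv q) \<in> S" "degree p > 0"
    and x: "poly p x = 0" "poly p x' = 0" "x < x'"
  obtains z w where "(z, w) \<in> Z" "x < z" "z < x'"
proof -
  have p0: "p \<noteq> 0" using d by auto
  have dp0: "pderiv p \<noteq> 0" using d by (metis order_less_irrefl pderiv_eq_0_iff)
  obtain c where "x < c" "c < x'" "poly (pderiv p) c = 0" using poly_rolle[OF x(3,1,2) p0] by blast
  then show ?thesis using matchedD(4)[OF m d(1) dp0] that by blast
qed

text \<open>Supplies sample points at the left end of the cell of x: the last breakpoint and its
  partner or, if there is none, points so far left that the leading terms decide the signs. The
  bound u matters only in the second case, where l' could be chosen too large.\<close>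

lemma matched_lower:
  fixes S :: "('a::rcf poly \<times> 'b::rcf poly) set"
  assumes m: "matched S Z"
    and pq: "degree p = degree q" "ssame (lead_coeff p) (lead_coeff q)"
    and old: "\<And>z w. (z, w) \<in> Z \<Longrightarrow> ssame (poly p z) (poly q w)"
    and u: "\<And>z w. (z, w) \<in> Z \<Longrightarrow> z < x \<Longrightarrow> w < u"
  obtains l l' where "l < x" "l' < u" "ssame (poly p l) (poly q l')"
    "\<And>z w. (z, w) \<in> Z \<Longrightarrow> z < x \<Longrightarrow> z \<le> l \<and> w \<le> l'" "\<And>z w. (z, w) \<in> Z \<Longrightarrow> x < z \<Longrightarrow> l' < w"
proof (cases "\<exists>z w. (z, w) \<in> Z \<and> z < x")
  case True
  note D = matchedD[OF m]
  define L where "L = {z. \<exists>w. (z, w) \<in> Z \<and> z < x}"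
  have fL: "finite L"
    by (rule finite_subset[OF _ finite_imageI[OF D(1), of fst]]) (force simp: L_def)
  have "L \<noteq> {}" using True by (auto simp: L_def)
  then have "Max L \<in> L" using fL Max_in by blast
  then obtain w where w: "(Max L, w) \<in> Z" "Max L < x" by (auto simp: L_def)
  show ?thesis
  proof (rule that[of "Max L" w])
    show "Max L < x" "w < u" "ssame (poly p (Max L)) (poly q w)" using w u old by blast+
    show "z \<le> Max L \<and> w' \<le> w" if z: "(z, w') \<in> Z" "z < x" for z w'
    proof -
      have "z \<le> Max L" using fL z by (intro Max_ge) (auto simp: L_def)
      then show ?thesis using simD[OF D(2)[OF w(1)] z(1)] by auto
    qed
    show "w < w'" if z: "(z, w') \<in> Z" "x < z" for z w'
      using simD[OF D(2)[OF w(1)] z(1)] z(2) w(2) by auto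
  qed
next
  case False
  obtain B C where BC: "\<And>x y. x \<le> B \<Longrightarrow> y \<le> C \<Longrightarrow> ssame (poly p x) (poly q y)"
    using ssame_at_bot[OF pq(2,1)] by blast
  obtain l' where l': "\<forall>w \<in> insert C (insert u (snd ` Z)). l' < w"
    using finite_between[of "{}" "insert C (insert u (snd ` Z))"] matchedD(1)[OF m] by auto
  have "min B (x - 1) < x" by (metis diff_less_eq less_add_one min_less_iff_disj)
  then show ?thesis using that[of "min B (x - 1)" l'] l' BC[of "min B (x - 1)" l'] False by force
qed

lemma matched_upper:
  fixes S :: "('a::rcf poly \<times> 'b::rcf poly) set"
  assumes m: "matched S Z"
    and pq: "ssame (lead_coeff p) (lead_coeff q)"
    and old: "\<And>z w. (z, w) \<in> Z \<Longrightarrow> ssame (poly p z) (poly q w)"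
  obtains l l' where "x < l" "ssame (poly p l) (poly q l')"
    "\<And>z w. (z, w) \<in> Z \<Longrightarrow> x < z \<Longrightarrow> l \<le> z \<and> l' \<le> w" "\<And>z w. (z, w) \<in> Z \<Longrightarrow> z < x \<Longrightarrow> w < l'"
proof (cases "\<exists>z w. (z, w) \<in> Z \<and> x < z")
  case True
  note D = matchedD[OF m]
  define L where "L = {z. \<exists>w. (z, w) \<in> Z \<and> x < z}"
  have fL: "finite L"
    by (rule finite_subset[OF _ finite_imageI[OF D(1), of fst]]) (force simp: L_def)
  have "L \<noteq> {}" using True by (auto simp: L_def)
  then have "Min L \<in> L" using fL Min_in by blast
  then obtain w where w: "(Min L, w) \<in> Z" "x < Min L" by (auto simp: L_def)
  show ?thesis
  proof (rule that[of "Min L" w])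
    show "x < Min L" "ssame (poly p (Min L)) (poly q w)" using w old by blast+
    show "Min L \<le> z \<and> w \<le> w'" if z: "(z, w') \<in> Z" "x < z" for z w'
    proof -
      have "Min L \<le> z" using fL z by (intro Min_le) (auto simp: L_def)
      then show ?thesis using simD[OF D(2)[OF w(1)] z(1)] by auto
    qed
    show "w' < w" if z: "(z, w') \<in> Z" "z < x" for z w'
      using simD[OF D(2)[OF w(1)] z(1)] z(2) w(2) by auto
  qed
next
  case False
  obtain B C where BC: "\<And>x y. x \<ge> B \<Longrightarrow> y \<ge> C \<Longrightarrow> ssame (poly p x) (poly q y)"
    using ssame_at_top[OF pq] by blast
  obtain l' where l': "\<forall>w \<in> insert C (snd ` Z). w < l'"
    using finite_between[of "insert C (snd ` Z)" "{}"] matchedD(1)[OF m] by auto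
  have "x < max B (x + 1)" by (metis less_add_one less_max_iff_disj)
  then show ?thesis using that[of "max B (x + 1)" l'] l' BC[of "max B (x + 1)" l'] False by force
qed

text \<open>p' has no root in the open gap between the sample points l and u, so by the mean value
  theorem p is strictly monotone there in effect: p(l) and p(u) have opposite signs. The signs carry
  over to q at l' and u', and the intermediate value property gives a root of q in the matching
  gap.\<close>

lemma matched_new_root:
  fixes S :: "('a::rcf poly \<times> 'b::rcf poly) set"
  assumes m: "matched S Z" and d: "(pderiv p, pderiv q) \<in> S" "degree p > 0"
    and pq: "degree p = degree q" "ssame (lead_coeff p) (lead_coeff q)"
    and old: "\<And>z w. (z, w) \<in> Z \<Longrightarrow> ssame (poly p z) (poly q w)"
    and x: "poly p x = 0" "x \<notin> fst ` Z"
  shows "\<exists>y. poly q y = 0 \<and> sim Z x y"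
proof -
  obtain u u' where u: "x < u" "ssame (poly p u) (poly q u')"
    "\<And>z w. (z, w) \<in> Z \<Longrightarrow> x < z \<Longrightarrow> u \<le> z \<and> u' \<le> w" "\<And>z w. (z, w) \<in> Z \<Longrightarrow> z < x \<Longrightarrow> w < u'"
    by (rule matched_upper[OF m pq(2), of x]) (use old in blast)+
  obtain l l' where l: "l < x" "l' < u'" "ssame (poly p l) (poly q l')"
    "\<And>z w. (z, w) \<in> Z \<Longrightarrow> z < x \<Longrightarrow> z \<le> l \<and> w \<le> l'" "\<And>z w. (z, w) \<in> Z \<Longrightarrow> x < z \<Longrightarrow> l' < w"
    by (rule matched_lower[OF m pq, of x u']) (use old u(4) in blast)+
  have nz: "z \<noteq> x" if "(z, w) \<in> Z" for z w using x(2) that by force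
  have gap: "z \<le> l \<or> u \<le> z" if "(z, w) \<in> Z" for z w
    using l(4) u(3) nz that by (metis linorder_less_linear)
  have dp0: "pderiv p \<noteq> 0" using d by (metis order_less_irrefl pderiv_eq_0_iff)
  have nr: "poly (pderiv p) c \<noteq> 0" if "l < c" "c < u" for c
    using matchedD(4)[OF m d(1) dp0] gap that by (meson leD)
  obtain a where a: "l < a" "a < x" "poly p x - poly p l = (x - l) * poly (pderiv p) a"
    using poly_mvt[OF l(1)] by metis
  obtain b where b: "x < b" "b < u" "poly p u - poly p x = (u - x) * poly (pderiv p) b"
    using poly_mvt[OF u(1)] by metis
  have nab: "poly (pderiv p) c \<noteq> 0" if "a \<le> c" "c \<le> b" for c
    using nr[of c] a(1) b(2) that by simp
  have ab: "a \<le> b" using a(2) b(1) by simp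
  have "poly (pderiv p) a * poly (pderiv p) b > 0"
    by (rule ssame_mult_gt_0[OF poly_no_root_ssame[OF nab ab] nab]) (use ab in auto)
  then have "(x - l) * (u - x) * (poly (pderiv p) a * poly (pderiv p) b) > 0"
    using l(1) u(1) by simp
  moreover have "poly p l * poly p u = - ((x - l) * (u - x) * (poly (pderiv p) a * poly (pderiv p) b))"
  proof -
    have "poly p l = - ((x - l) * poly (pderiv p) a)" "poly p u = (u - x) * poly (pderiv p) b"
      using a(3) b(3) x(1) by (simp_all add: minus_equation_iff)
    then show ?thesis by (simp only: mult_minus_left mult_minus_right ac_simps)
  qed
  ultimately have "poly p l * poly p u < 0" by simp
  then have "poly q l' * poly q u' < 0" using ssame_prod_neg[OF l(3) u(2)] by blast
  then obtain y where y: "l' < y" "y < u'" "poly q y = 0" using poly_ivt[OF l(2)] by metis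
  have "(z < x \<longleftrightarrow> w < y) \<and> (x < z \<longleftrightarrow> y < w)" if zw: "(z, w) \<in> Z" for z w
  proof (cases "z < x")
    case True
    then have "w < y" using l(4)[OF zw] y(1) by auto
    then show ?thesis using True by auto
  next
    case False
    then have "x < z" using nz[OF zw] by auto
    then have "y < w" using u(3)[OF zw] y(2) by auto
    then show ?thesis using \<open>x < z\<close> by auto
  qed
  then show ?thesis using y(3) unfolding sim_def by blast
qed

text \<open>Each open cell contains at most one root of p and at most one of q, and
  \<open>matched_new_root\<close>, used in both directions, shows that they occur in the same cells.
  Adding these pairs to Z leaves cells without roots, where signs are read off at an end point or at
  infinity.\<close>

lemma matched_insert:
  fixes S :: "('a::rcf poly \<times> 'b::rcf poly) set"
  assumes m: "matched S Z" and d: "(pderiv p, pderiv q) \<in> S" "degree p > 0"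
    and pq: "degree p = degree q" "ssame (lead_coeff p) (lead_coeff q)"
    and old: "\<And>z w. (z, w) \<in> Z \<Longrightarrow> ssame (poly p z) (poly q w)"
  shows "\<exists>Y. matched (insert (p, q) S) Y"
proof -
  note D = matchedD[OF m]
  note mc = matched_converse[OF m]
  have p0: "p \<noteq> 0" "q \<noteq> 0" "degree q > 0" using d pq by auto
  define N where "N = {(x, y). poly p x = 0 \<and> poly q y = 0 \<and> sim Z x y \<and> x \<notin> fst ` Z}"
  define Y where "Y = Z \<union> N"
  have old': "ssame (poly q w) (poly p z)" if "(w, z) \<in> Z\<inverse>" for z w using old that ssame_sym by auto
  have dc: "(pderiv q, pderiv p) \<in> S\<inverse>" using d by simp
  have pqc: "degree q = degree p" "ssame (lead_coeff q) (lead_coeff p)" using pq ssame_sym by auto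
  have Nfst: "x \<notin> fst ` Z" if s: "sim Z x y" "y \<notin> snd ` Z" for x y
  proof
    assume "x \<in> fst ` Z"
    then obtain w where w: "(x, w) \<in> Z" by auto
    then have "w = y" using simD[OF s(1) w] by blast
    then show False using s(2) w by force
  qed
  have finN: "finite N"
    by (rule finite_subset[of _ "{x. poly p x = 0} \<times> {y. poly q y = 0}"])
      (auto simp: N_def poly_roots_finite p0)
  \<comment> \<open>Rolle puts a point of Z between two new roots, and that point separates their
    partners in the same order.\<close>
  have NN1: "y < y'" if n: "(x, y) \<in> N" "(x', y') \<in> N" "x < x'" for x y x' y'
  proof -
    have s: "sim Z x y" "sim Z x' y'" "poly p x = 0" "poly p x' = 0" using n by (auto simp: N_def)
    obtain z w where z: "(z, w) \<in> Z" "x < z" "z < x'" using matched_rolle[OF m d s(3,4) n(3)] .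
    then show ?thesis using simD[OF s(1) z(1)] simD[OF s(2) z(1)] by auto
  qed
  have NN2: "y = y'" if n: "(x, y) \<in> N" "(x, y') \<in> N" for x y y'
  proof -
    have s: "sim Z x y" "sim Z x y'" "poly q y = 0" "poly q y' = 0" using n by (auto simp: N_def)
    have F: False if lt: "y1 < y2" and s: "sim Z x y1" "sim Z x y2" "poly q y1 = 0" "poly q y2 = 0" for y1 y2
    proof -
      obtain w z where z: "(w, z) \<in> Z\<inverse>" "y1 < w" "w < y2" using matched_rolle[OF mc dc p0(3) s(3,4) lt] .
      then show False using simD[OF s(1)] simD[OF s(2)] by (metis converseD order_less_imp_not_less)
    qed
    show ?thesis using F s by (metis linorder_less_linear)
  qed
  have simN: "sim N x y" if n: "(x, y) \<in> N" for x y
  proof -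
    have "(x' < x \<longleftrightarrow> y' < y) \<and> (x < x' \<longleftrightarrow> y < y')" if n': "(x', y') \<in> N" for x' y'
    proof (cases x x' rule: linorder_cases)
      case less
      then show ?thesis using NN1[OF n n'] by simp
    next
      case equal
      then have "y = y'" using NN2 n n' by blast
      then show ?thesis using equal by simp
    next
      case greater
      then show ?thesis using NN1[OF n' n] by simp
    qed
    then show ?thesis unfolding sim_def by blast
  qed
  have simZN: "sim N z w" if zw: "(z, w) \<in> Z" for z w
  proof -
    have "(x < z \<longleftrightarrow> y < w) \<and> (z < x \<longleftrightarrow> w < y)" if "(x, y) \<in> N" for x y
      using simD[OF _ zw, of x y] that by (auto simp: N_def)
    then show ?thesis unfolding sim_def by blast
  qed
  have simNZ: "sim Z x y" if "(x, y) \<in> N" for x y using that by (auto simp: N_def)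
  have simY: "sim Y x y \<longleftrightarrow> sim Z x y \<and> sim N x y" for x y by (auto simp: sim_def Y_def)
  have YY: "sim Y z w" if "(z, w) \<in> Y" for z w
    using that simN simZN simNZ D(2) unfolding simY by (auto simp: Y_def)
  have rp: "\<exists>y. (x, y) \<in> Y" if r: "poly p x = 0" for x
  proof (cases "x \<in> fst ` Z")
    case False
    obtain y where "poly q y = 0" "sim Z x y" using matched_new_root[OF m d pq _ r False] old by blast
    then have "(x, y) \<in> N" using False r by (auto simp: N_def)
    then show ?thesis by (auto simp: Y_def)
  qed (auto simp: Y_def)
  have rq: "\<exists>x. (x, y) \<in> Y" if r: "poly q y = 0" for y
  proof (cases "y \<in> snd ` Z")
    case False
    have yn: "y \<notin> fst ` (Z\<inverse>)" using False by force
    obtain x where x: "poly p x = 0" "sim (Z\<inverse>) y x" using matched_new_root[OF mc dc p0(3) pqc _ r yn] old' by blast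
    then have "sim Z x y" by (simp add: sim_converse)
    then have "(x, y) \<in> N" using Nfst[OF _ False] r x(1) by (auto simp: N_def)
    then show ?thesis by (auto simp: Y_def)
  qed (auto simp: Y_def)
  have oldY: "ssame (poly p z) (poly q w)" if "(z, w) \<in> Y" for z w
    using that old by (auto simp: Y_def N_def)
  have finY: "finite Y" using finN D(1) by (simp add: Y_def)
  have sgY: "ssame (poly p x) (poly q y)" if s: "sim Y x y" for x y
  proof (cases "x \<in> fst ` Y")
    case True
    then obtain w where w: "(x, w) \<in> Y" by auto
    then have "w = y" using simD[OF s w] by auto
    then show ?thesis using oldY w by auto
  next
    case False
    have xn: "z \<noteq> x" "w \<noteq> y" if "(z, w) \<in> Y" for z w using False that simD[OF s that] by force+
    define L where "L = {z. \<exists>w. (z, w) \<in> Y \<and> z < x}"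
    define U where "U = {z. \<exists>w. (z, w) \<in> Y \<and> x < z}"
    have fL: "finite L" and fU: "finite U"
      by (rule finite_subset[OF _ finite_imageI[OF finY, of fst]]; force simp: L_def U_def)+
    show ?thesis
    proof (cases "L = {}")
      case True
      then have nl: "\<not> z < x" if "(z, w) \<in> Y" for z w using that by (auto simp: L_def)
      obtain B C where BC: "\<And>x y. x \<le> B \<Longrightarrow> y \<le> C \<Longrightarrow> ssame (poly p x) (poly q y)"
        using ssame_at_bot[OF pq(2,1)] by blast
      \<comment> \<open>No breakpoint lies to the left of x, so p has at x its sign near minus
        infinity; likewise for q at y.\<close>
      have "ssame (poly p (min B x)) (poly p x)"
        proof (rule poly_no_root_ssame)
          fix z assume z: "min B x \<le> z" "z \<le> x"
          show "poly p z \<noteq> 0"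
          proof
            assume "poly p z = 0"
            then obtain w where w: "(z, w) \<in> Y" using rp by blast
            show False using nl[OF w] xn(1)[OF w] z by simp
          qed
        qed simp
      moreover have "ssame (poly q (min C y)) (poly q y)"
        proof (rule poly_no_root_ssame)
          fix w assume w: "min C y \<le> w" "w \<le> y"
          show "poly q w \<noteq> 0"
          proof
            assume "poly q w = 0"
            then obtain z where z: "(z, w) \<in> Y" using rq by blast
            show False using nl[OF z] xn(2)[OF z] simD[OF s z] w by simp
          qed
        qed simp
      moreover have "ssame (poly p (min B x)) (poly q (min C y))" using BC by simp
      ultimately show ?thesis using ssame_sym ssame_trans by meson
    next
      case Ln: False
      show ?thesis
      proof (cases "U = {}")
        case True
        then have nl: "\<not> x < z" if "(z, w) \<in> Y" for z w using that by (auto simp: U_def)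
        obtain B C where BC: "\<And>x y. x \<ge> B \<Longrightarrow> y \<ge> C \<Longrightarrow> ssame (poly p x) (poly q y)"
          using ssame_at_top[OF pq(2)] by blast
        have "ssame (poly p x) (poly p (max B x))"
          proof (rule poly_no_root_ssame)
          fix z assume z: "x \<le> z" "z \<le> max B x"
          show "poly p z \<noteq> 0"
          proof
            assume "poly p z = 0"
            then obtain w where w: "(z, w) \<in> Y" using rp by blast
            show False using nl[OF w] xn(1)[OF w] z by simp
          qed
        qed simp
        moreover have "ssame (poly q y) (poly q (max C y))"
          proof (rule poly_no_root_ssame)
          fix w assume w: "y \<le> w" "w \<le> max C y"
          show "poly q w \<noteq> 0"
          proof
            assume "poly q w = 0"
            then obtain z where z: "(z, w) \<in> Y" using rq by blast
            show False using nl[OF z] xn(2)[OF z] simD[OF s z] w by simp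
          qed
        qed simp
        moreover have "ssame (poly p (max B x)) (poly q (max C y))" using BC by simp
        ultimately show ?thesis using ssame_sym ssame_trans by meson
      next
        case Un: False
        obtain l' where l: "(Max L, l') \<in> Y" "Max L < x" using Max_in[OF fL Ln] by (auto simp: L_def)
        obtain u' where u: "(Min U, u') \<in> Y" "x < Min U" using Min_in[OF fU Un] by (auto simp: U_def)
        have gl: "z \<le> Max L" if "(z, w) \<in> Y" "z < x" for z w using that fL by (intro Max_ge) (auto simp: L_def)
        have gu: "Min U \<le> z" if "(z, w) \<in> Y" "x < z" for z w using that fU by (intro Min_le) (auto simp: U_def)
        have ly: "l' < y" "y < u'" using simD[OF s] l u by blast+
        \<comment> \<open>If p vanished at both ends, Rolle would put a breakpoint inside the cell.
          So at least one end carries a nonzero sign that extends to the whole cell.\<close>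
        consider "poly p (Max L) \<noteq> 0" | "poly p (Min U) \<noteq> 0" | "poly p (Max L) = 0" "poly p (Min U) = 0" by blast
        then show ?thesis
        proof cases
          case 1
          have q1: "poly q l' \<noteq> 0" using 1 oldY[OF l(1)] ssame_eq_0_iff by blast
          have "ssame (poly p (Max L)) (poly p x)"
          proof (rule poly_no_root_ssame)
            fix z assume z: "Max L \<le> z" "z \<le> x"
            show "poly p z \<noteq> 0"
            proof
              assume r: "poly p z = 0"
              then obtain w where w: "(z, w) \<in> Y" using rp by blast
              have "z \<noteq> Max L" using r 1 by blast
              then show False using gl[OF w] z xn(1)[OF w] by simp
            qed
          qed (use l in simp)
          moreover have "ssame (poly q l') (poly q y)"
          proof (rule poly_no_root_ssame)
            fix w assume w: "l' \<le> w" "w \<le> y"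
            show "poly q w \<noteq> 0"
            proof
              assume r: "poly q w = 0"
              then obtain z where z: "(z, w) \<in> Y" using rq by blast
              have "w \<noteq> l'" using r q1 by blast
              then have "l' < w" "w < y" using w xn[OF z] by auto
              then have "Max L < z" "z < x" using simD[OF YY[OF l(1)] z] simD[OF s z] by auto
              then show False using gl[OF z] by simp
            qed
          qed (use ly in simp)
          ultimately show ?thesis using oldY[OF l(1)] ssame_sym ssame_trans by meson
        next
          case 2
          have q1: "poly q u' \<noteq> 0" using 2 oldY[OF u(1)] ssame_eq_0_iff by blast
          have "ssame (poly p x) (poly p (Min U))"
          proof (rule poly_no_root_ssame)
            fix z assume z: "x \<le> z" "z \<le> Min U"
            show "poly p z \<noteq> 0"
            proof
              assume r: "poly p z = 0"
              then obtain w where w: "(z, w) \<in> Y" using rp by blast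
              have "z \<noteq> Min U" using r 2 by blast
              then show False using gu[OF w] z xn(1)[OF w] by simp
            qed
          qed (use u in simp)
          moreover have "ssame (poly q y) (poly q u')"
          proof (rule poly_no_root_ssame)
            fix w assume w: "y \<le> w" "w \<le> u'"
            show "poly q w \<noteq> 0"
            proof
              assume r: "poly q w = 0"
              then obtain z where z: "(z, w) \<in> Y" using rq by blast
              have "w \<noteq> u'" using r q1 by blast
              then have "w < u'" "y < w" using w xn[OF z] by auto
              then have "z < Min U" "x < z" using simD[OF YY[OF u(1)] z] simD[OF s z] by auto
              then show False using gu[OF z] by simp
            qed
          qed (use ly in simp)
          ultimately show ?thesis using oldY[OF u(1)] ssame_sym ssame_trans by meson
        next
          case 3
          have "Max L < Min U" using l u by simp
          then obtain z w where z: "(z, w) \<in> Z" "Max L < z" "z < Min U" using matched_rolle[OF m d 3] by metis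
          then have zw: "(z, w) \<in> Y" by (simp add: Y_def)
          show ?thesis using gl[OF zw] gu[OF zw] xn(1)[OF zw] z by fastforce
        qed
      qed
    qed
  qed
  have "matched (insert (p, q) S) Y"
  proof (rule matchedI)
    show "a = 0 \<longleftrightarrow> b = 0" if "(a, b) \<in> insert (p, q) S" for a b using that D(3) p0 by auto
    show "\<exists>y. (x, y) \<in> Y" if "(a, b) \<in> insert (p, q) S" "a \<noteq> 0" "poly a x = 0" for a b x
      using that D(4)[of a b x] rp by (auto simp: Y_def)
    show "\<exists>x. (x, y) \<in> Y" if "(a, b) \<in> insert (p, q) S" "b \<noteq> 0" "poly b y = 0" for a b y
      using that D(5)[of a b y] rq by (auto simp: Y_def)
    show "ssame (poly a x) (poly b y)" if "(a, b) \<in> insert (p, q) S" "sim Y x y" for a b x y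
      using that D(6)[of a b x y] sgY simY by auto
  qed (use finY YY in auto)
  then show ?thesis by blast
qed

text \<open>After coarsening, every breakpoint is a root of some a in T. There c * p = a * h + r
  reduces the sign of p to that of the remainder r, whose signs are already matched through R; this
  is the hypothesis \<open>old\<close> of \<open>matched_insert\<close>.\<close>

lemma matched_step:
  fixes T R :: "('a::rcf poly \<times> 'b::rcf poly) set"
  assumes m: "matched (T \<union> R) Z" and d: "(pderiv p, pderiv q) \<in> T" "degree p > 0"
    and pq: "degree p = degree q" "ssame (lead_coeff p) (lead_coeff q)"
    and R: "\<And>a b. (a, b) \<in> T \<Longrightarrow> a \<noteq> 0 \<Longrightarrow> \<exists>r s c d h k. (r, s) \<in> R \<and> c > 0 \<and> d > 0 \<and>
      smult c p = a * h + r \<and> smult d q = b * k + s"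
  shows "\<exists>Y. matched (insert (p, q) T) Y"
proof -
  define Y where "Y = {(z, w) \<in> Z. \<exists>(a, b)\<in>T. a \<noteq> 0 \<and> poly a z = 0}"
  have mY: "matched T Y" unfolding Y_def by (rule matched_coarsen[OF m]) simp
  have "ssame (poly p z) (poly q w)" if zw: "(z, w) \<in> Y" for z w
  proof -
    obtain a b where ab: "(a, b) \<in> T" "a \<noteq> 0" "poly a z = 0" "(z, w) \<in> Z" using zw unfolding Y_def by blast
    obtain r s c d h k where r: "(r, s) \<in> R" "c > 0" "d > 0" "smult c p = a * h + r" "smult d q = b * k + s"
      using R ab by metis
    have sZ: "sim Z z w" using matchedD(2)[OF m ab(4)] .
    have "ssame (poly a z) (poly b w)" using matchedD(6)[OF m _ sZ] ab(1) by blast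
    then have b0: "poly b w = 0" using ab(3) by simp
    have "ssame (poly r z) (poly s w)" using matchedD(6)[OF m _ sZ] r(1) by blast
    moreover have "poly r z = c * poly p z" using arg_cong[OF r(4), of "\<lambda>p. poly p z"] ab(3) by simp
    moreover have "poly s w = d * poly q w" using arg_cong[OF r(5), of "\<lambda>p. poly p w"] b0 by simp
    ultimately show ?thesis using ssame_mult_pos r(2,3) ssame_trans by metis
  qed
  then show ?thesis using matched_insert[OF mY d pq] by blast
qed

section \<open>Ring homomorphisms and their action on univariate polynomials\<close>

definition rhom :: "('a::comm_ring_1 \<Rightarrow> 'b::comm_ring_1) \<Rightarrow> bool" where
  "rhom h \<longleftrightarrow> h 1 = 1 \<and> (\<forall>x y. h (x + y) = h x + h y) \<and> (\<forall>x y. h (x * y) = h x * h y)"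

lemma rhom_1: "rhom h \<Longrightarrow> h 1 = 1"
  and rhom_add: "rhom h \<Longrightarrow> h (x + y) = h x + h y"
  and rhom_mult: "rhom h \<Longrightarrow> h (x * y) = h x * h y"
  by (auto simp: rhom_def)

lemma rhom_0: "rhom h \<Longrightarrow> h 0 = 0"
  using rhom_add[of h 0 0] by simp

lemma rhom_uminus: "rhom h \<Longrightarrow> h (- x) = - h x"
  using rhom_add[of h x "- x"] rhom_0[of h] by (simp add: eq_neg_iff_add_eq_0 add.commute)

lemma rhom_diff: "rhom h \<Longrightarrow> h (x - y) = h x - h y"
  using rhom_add[of h x "- y"] by (simp add: rhom_uminus)

lemma rhom_power: "rhom h \<Longrightarrow> h (x ^ n) = h x ^ n"
  by (induction n) (simp_all add: rhom_1 rhom_mult)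

lemma rhom_sum: "rhom h \<Longrightarrow> h (sum f A) = (\<Sum>i\<in>A. h (f i))"
  by (induction A rule: infinite_finite_induct) (simp_all add: rhom_0 rhom_add)

lemma rhom_prod: "rhom h \<Longrightarrow> h (prod f A) = (\<Prod>i\<in>A. h (f i))"
  by (induction A rule: infinite_finite_induct) (simp_all add: rhom_1 rhom_mult)

lemma rhom_of_nat: "rhom h \<Longrightarrow> h (of_nat n) = of_nat n"
  by (induction n) (simp_all add: rhom_0 rhom_1 rhom_add)

lemmas rhom_simps = rhom_0 rhom_1 rhom_add rhom_mult rhom_uminus rhom_diff rhom_power

lemma map_poly_rhom_mult:
  assumes "rhom h"
  shows "map_poly h (p * q) = map_poly h p * map_poly h q"
  by (rule poly_eqI) (simp add: coeff_map_poly rhom_simps[OF assms] coeff_mult rhom_sum[OF assms])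

lemma map_poly_rhom_add:
  assumes "rhom h"
  shows "map_poly h (p + q) = map_poly h p + map_poly h q"
  by (rule poly_eqI) (simp add: coeff_map_poly rhom_simps[OF assms])

lemma map_poly_rhom_smult:
  assumes "rhom h"
  shows "map_poly h (smult c p) = smult (h c) (map_poly h p)"
  by (rule poly_eqI) (simp add: coeff_map_poly rhom_simps[OF assms])

lemma map_poly_rhom_pderiv:
  assumes "rhom h"
  shows "map_poly h (pderiv p) = pderiv (map_poly h p)"
proof (rule poly_eqI)
  fix n
  have "h (of_nat (Suc n)) = of_nat (Suc n)" by (rule rhom_of_nat[OF assms])
  then show "coeff (map_poly h (pderiv p)) n = coeff (pderiv (map_poly h p)) n"
    by (simp only: coeff_map_poly[of h, OF rhom_0[OF assms]] coeff_pderiv rhom_mult[OF assms])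
qed

definition peval :: "('a::comm_ring_1 \<Rightarrow> 'b::comm_ring_1) \<Rightarrow> 'b \<Rightarrow> 'a poly \<Rightarrow> 'b" where
  "peval h x p = poly (map_poly h p) x"

lemma rhom_peval: "rhom h \<Longrightarrow> rhom (peval h x)"
  unfolding rhom_def[of "peval h x"] peval_def
  by (simp add: map_poly_rhom_add map_poly_rhom_mult map_poly_1' rhom_1)

lemma peval_pCons: "rhom h \<Longrightarrow> peval h x (pCons c p) = h c + x * peval h x p"
  by (simp add: peval_def map_poly_pCons rhom_0)

lemma peval_const: "rhom h \<Longrightarrow> peval h x [:c:] = h c"
  by (simp add: peval_pCons) (simp add: peval_def)

lemma peval_smult: "rhom h \<Longrightarrow> peval h x (smult c p) = h c * peval h x p"
  by (simp add: peval_def map_poly_rhom_smult)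

section \<open>Cones and maximal orderings\<close>

text \<open>A cone need not contain the squares of the whole ring, only those of the subring it generates;
  so a cone in a field \<open>C\<close> may describe an ordering of a subfield of \<open>C\<close>.\<close>

definition pcone :: "'a::comm_ring_1 set \<Rightarrow> bool" where
  "pcone P \<longleftrightarrow> 0 \<in> P \<and> 1 \<in> P \<and> (\<forall>x\<in>P. \<forall>y\<in>P. x + y \<in> P \<and> x * y \<in> P \<and> (x - y)\<^sup>2 \<in> P) \<and>
    (\<forall>x. x \<in> P \<and> - x \<in> P \<longrightarrow> x = 0)"

definition fcone :: "'a::field set \<Rightarrow> bool" where
  "fcone P \<longleftrightarrow> pcone P \<and> (\<forall>x\<in>P. inverse x \<in> P)"

text \<open>The comparison is with all cones of the ambient field, including those that generate a
  larger subfield. This is why maximality yields a real closed field and not merely a total ordering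
  of a given one.\<close>

definition max_fcone :: "'a::field set \<Rightarrow> bool" where
  "max_fcone M \<longleftrightarrow> fcone M \<and> (\<forall>N. fcone N \<and> M \<subseteq> N \<longrightarrow> N = M)"

lemma pconeD:
  assumes "pcone P"
  shows "0 \<in> P" "1 \<in> P" "\<And>x y. x \<in> P \<Longrightarrow> y \<in> P \<Longrightarrow> x + y \<in> P"
    "\<And>x y. x \<in> P \<Longrightarrow> y \<in> P \<Longrightarrow> x * y \<in> P" "\<And>x y. x \<in> P \<Longrightarrow> y \<in> P \<Longrightarrow> (x - y)\<^sup>2 \<in> P"
    "\<And>x. x \<in> P \<Longrightarrow> - x \<in> P \<Longrightarrow> x = 0"
  using assms by (auto simp: pcone_def)

lemma pconeI:
  assumes "0 \<in> P" "1 \<in> P" "\<And>x y. x \<in> P \<Longrightarrow> y \<in> P \<Longrightarrow> x + y \<in> P"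
    "\<And>x y. x \<in> P \<Longrightarrow> y \<in> P \<Longrightarrow> x * y \<in> P" "\<And>x y. x \<in> P \<Longrightarrow> y \<in> P \<Longrightarrow> (x - y)\<^sup>2 \<in> P"
    "\<And>x. x \<in> P \<Longrightarrow> - x \<in> P \<Longrightarrow> x = 0"
  shows "pcone P"
  using assms by (auto simp: pcone_def)

text \<open>Clearing denominators turns x = a/b and -x = c/d into cb + ad = 0 with both summands in
  T, so pointedness of T carries over.\<close>

lemma fcone_fractions:
  fixes h :: "'a::idom \<Rightarrow> 'c::field"
  assumes T: "pcone T" and h: "rhom h" and inj: "\<And>x. h x = 0 \<Longrightarrow> x = 0"
  shows "fcone {h a / h b |a b. a \<in> T \<and> b \<in> T \<and> b \<noteq> 0}" (is "fcone ?P")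
proof -
  note D = pconeD[OF T]
  note hs = rhom_simps[OF h]
  have I: "h a / h b \<in> ?P" if "a \<in> T" "b \<in> T" "b \<noteq> 0" for a b using that by blast
  have nz: "h b \<noteq> 0" if "b \<noteq> 0" for b using inj that by blast
  have "pcone ?P"
  proof (rule pconeI)
    show "0 \<in> ?P" "1 \<in> ?P" using I[OF D(1,2)] I[OF D(2,2)] by (simp_all add: hs)
  next
    fix x y assume "x \<in> ?P" "y \<in> ?P"
    then obtain a b c d where x: "x = h a / h b" "a \<in> T" "b \<in> T" "b \<noteq> 0"
      and y: "y = h c / h d" "c \<in> T" "d \<in> T" "d \<noteq> 0" by blast
    have bd: "b * d \<in> T" "b * d \<noteq> 0" "(b * d)\<^sup>2 \<in> T" "(b * d)\<^sup>2 \<noteq> 0"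
      using x y D(4) by (auto simp: power2_eq_square)
    have "x + y = h (a * d + c * b) / h (b * d)" using nz[OF x(4)] nz[OF y(4)] by (simp add: x(1) y(1) hs add_frac_eq)
    then show "x + y \<in> ?P" using I[OF _ bd(1,2)] x y D(3,4) by simp
    have "x * y = h (a * c) / h (b * d)" using x y by (simp add: hs)
    then show "x * y \<in> ?P" using I[OF _ bd(1,2)] x y D(3,4) by simp
    have "x - y = h (a * d - c * b) / h (b * d)" using nz[OF x(4)] nz[OF y(4)] by (simp add: x(1) y(1) hs diff_frac_eq)
    then have "(x - y)\<^sup>2 = h ((a * d - c * b)\<^sup>2) / h ((b * d)\<^sup>2)" by (simp add: hs power_divide)
    then show "(x - y)\<^sup>2 \<in> ?P" using I[OF _ bd(3,4)] x y D(4,5) by simp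
  next
    fix x assume "x \<in> ?P" "- x \<in> ?P"
    then obtain a b c d where x: "x = h a / h b" "a \<in> T" "b \<in> T" "b \<noteq> 0"
      and y: "- x = h c / h d" "c \<in> T" "d \<in> T" "d \<noteq> 0" by blast
    have "- (h a / h b) = h c / h d" using x(1) y(1) by simp
    then have "h c * h b = - (h a * h d)"
      using nz[OF x(4)] nz[OF y(4)] frac_eq_eq[of "h b" "h d" "- h a" "h c"] by simp
    then have "h (c * b + a * d) = 0" by (simp add: hs)
    then have "c * b + a * d = 0" using inj by blast
    then have "- (a * d) = c * b" by (simp add: add_eq_0_iff)
    then have "- (a * d) \<in> T" using D(4) x y by simp
    then have "a * d = 0" using D(4,6) x y by blast
    then show "x = 0" using x y by (simp add: hs)
  qed
  moreover have "inverse x \<in> ?P" if xP: "x \<in> ?P" for x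
  proof -
    obtain a b where x: "x = h a / h b" "a \<in> T" "b \<in> T" "b \<noteq> 0" using xP by blast
    show ?thesis
    proof (cases "a = 0")
      case True
      then show ?thesis using I[OF D(1,2)] x by (simp add: hs)
    next
      case False
      then show ?thesis using I[OF x(3,2)] x by simp
    qed
  qed
  ultimately show ?thesis by (simp add: fcone_def)
qed

lemma ex_max_fcone:
  assumes "fcone P"
  shows "\<exists>M. P \<subseteq> M \<and> max_fcone M"
proof -
  define A where "A = {N. fcone N \<and> P \<subseteq> N}"
  have "\<exists>M\<in>A. \<forall>N\<in>A. M \<subseteq> N \<longrightarrow> N = M"
  proof (rule subset_Zorn_nonempty)
    show "A \<noteq> {}" using assms by (auto simp: A_def)
  next
    fix \<C> assume ne: "\<C> \<noteq> {}" and ch: "subset.chain A \<C>"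
    have cA: "fcone N" "pcone N" "P \<subseteq> N" if N: "N \<in> \<C>" for N
    proof -
      have "N \<in> A" using ch N by (auto simp: subset_chain_def)
      then show "fcone N" "pcone N" "P \<subseteq> N" by (auto simp: A_def fcone_def)
    qed
    have two: "\<exists>N\<in>\<C>. x \<in> N \<and> y \<in> N" if xy: "x \<in> \<Union>\<C>" "y \<in> \<Union>\<C>" for x y
    proof -
      obtain U V where UV: "U \<in> \<C>" "x \<in> U" "V \<in> \<C>" "y \<in> V" using xy by blast
      then have "U \<subseteq> V \<or> V \<subseteq> U" using ch by (auto simp: subset_chain_def)
      then show ?thesis using UV by blast
    qed
    obtain N where N: "N \<in> \<C>" using ne by blast
    have "pcone (\<Union>\<C>)"
    proof (rule pconeI)
      show "0 \<in> \<Union>\<C>" "1 \<in> \<Union>\<C>" using N pconeD(1,2)[OF cA(2)[OF N]] by blast+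
      show "x + y \<in> \<Union>\<C>" if xy: "x \<in> \<Union>\<C>" "y \<in> \<Union>\<C>" for x y
      proof -
        obtain K where "K \<in> \<C>" "x \<in> K" "y \<in> K" using two[OF xy] by blast
        then show ?thesis using pconeD(3)[OF cA(2), of K x y] by blast
      qed
      show "x * y \<in> \<Union>\<C>" if xy: "x \<in> \<Union>\<C>" "y \<in> \<Union>\<C>" for x y
      proof -
        obtain K where "K \<in> \<C>" "x \<in> K" "y \<in> K" using two[OF xy] by blast
        then show ?thesis using pconeD(4)[OF cA(2), of K x y] by blast
      qed
      show "(x - y)\<^sup>2 \<in> \<Union>\<C>" if xy: "x \<in> \<Union>\<C>" "y \<in> \<Union>\<C>" for x y
      proof -
        obtain K where "K \<in> \<C>" "x \<in> K" "y \<in> K" using two[OF xy] by blast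
        then show ?thesis using pconeD(5)[OF cA(2), of K x y] by blast
      qed
      show "x = 0" if xy: "x \<in> \<Union>\<C>" "- x \<in> \<Union>\<C>" for x
      proof -
        obtain K where "K \<in> \<C>" "x \<in> K" "- x \<in> K" using two[OF xy] by blast
        then show ?thesis using pconeD(6)[OF cA(2), of K x] by blast
      qed
    qed
    moreover have "inverse x \<in> \<Union>\<C>" if x: "x \<in> \<Union>\<C>" for x
    proof -
      obtain K where "K \<in> \<C>" "x \<in> K" using x by blast
      then show ?thesis using cA(1)[of K] by (auto simp: fcone_def)
    qed
    moreover have "P \<subseteq> \<Union>\<C>" using N cA(3) by blast
    ultimately show "\<Union>\<C> \<in> A" by (simp add: A_def fcone_def)
  qed
  then obtain M where M: "M \<in> A" "\<And>N. N \<in> A \<Longrightarrow> M \<subseteq> N \<Longrightarrow> N = M" by blast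
  then have "fcone M" "P \<subseteq> M" by (auto simp: A_def)
  moreover have "N = M" if "fcone N" "M \<subseteq> N" for N
    using M(2)[of N] that \<open>P \<subseteq> M\<close> by (auto simp: A_def)
  ultimately show ?thesis unfolding max_fcone_def by blast
qed

text \<open>Adjoin u = x - y to get N = M + uM. If N fails to be pointed, a relation (a + c') + u (b
  + d) = 0 can be solved for -u = y - x inside M. Inverses exist in N because 1/w = w (1/w^2) and
  w^2 already lies in M.\<close>

lemma max_fcone_total:
  fixes M :: "'a::field set"
  assumes M: "max_fcone M" and xy: "x \<in> M" "y \<in> M"
  shows "x - y \<in> M \<or> y - x \<in> M"
proof (rule ccontr)
  assume c: "\<not> ?thesis"
  have f: "pcone M" "\<And>z. z \<in> M \<Longrightarrow> inverse z \<in> M" using M by (auto simp: max_fcone_def fcone_def)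
  note D = pconeD[OF f(1)]
  define u where "u = x - y"
  define N where "N = {a + u * b |a b. a \<in> M \<and> b \<in> M}"
  have I: "a + u * b \<in> N" if "a \<in> M" "b \<in> M" for a b using that by (auto simp: N_def)
  have MN: "M \<subseteq> N" using I[OF _ D(1)] by auto
  have uN: "u \<in> N" using I[OF D(1,2)] by simp
  have u2: "u\<^sup>2 \<in> M" using D(5) xy by (simp add: u_def)
  have mul: "w * z \<in> N" if wz: "w \<in> N" "z \<in> N" for w z
  proof -
    obtain a b c d where w: "w = a + u * b" "a \<in> M" "b \<in> M" and z: "z = c + u * d" "c \<in> M" "d \<in> M"
      using wz by (auto simp: N_def)
    have "w * z = (a * c + u\<^sup>2 * (b * d)) + u * (a * d + b * c)"
      by (simp add: w z algebra_simps power2_eq_square)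
    then show ?thesis using I D(3,4) u2 w z by simp
  qed
  have sq: "(w - z)\<^sup>2 \<in> M" if wz: "w \<in> N" "z \<in> N" for w z
  proof -
    obtain a b c d where w: "w = a + u * b" "a \<in> M" "b \<in> M" and z: "z = c + u * d" "c \<in> M" "d \<in> M"
      using wz by (auto simp: N_def)
    \<comment> \<open>M contains squares only of differences of its own elements, so w - z is
      rewritten as such a difference.\<close>
    have "w - z = (a + x * b + y * d) - (c + y * b + x * d)"
      by (simp add: w z u_def algebra_simps)
    then show ?thesis by (simp only:) (intro D(3,4,5) w z xy)
  qed
  have "pcone N"
  proof (rule pconeI)
    show "0 \<in> N" "1 \<in> N" using MN D(1,2) by auto
    show "w + z \<in> N" if wz: "w \<in> N" "z \<in> N" for w z
    proof -
      obtain a b c d where w: "w = a + u * b" "a \<in> M" "b \<in> M" and z: "z = c + u * d" "c \<in> M" "d \<in> M"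
        using wz by (auto simp: N_def)
      have "w + z = (a + c) + u * (b + d)" by (simp add: w z algebra_simps)
      then show ?thesis by (simp only:) (intro I D(3) w z)
    qed
    show "w * z \<in> N" if "w \<in> N" "z \<in> N" for w z using mul that .
    show "(w - z)\<^sup>2 \<in> N" if "w \<in> N" "z \<in> N" for w z using sq that MN by blast
    show "s = 0" if s: "s \<in> N" "- s \<in> N" for s
    proof -
      obtain a b c' d where w: "s = a + u * b" "a \<in> M" "b \<in> M" and z: "- s = c' + u * d" "c' \<in> M" "d \<in> M"
        using s by (auto simp: N_def)
      have e: "(a + c') + u * (b + d) = 0" 
      proof -
        have "(a + c') + u * (b + d) = (a + u * b) + (c' + u * d)" by (simp add: algebra_simps)
        also have "\<dots> = s + - s" by (simp only: w(1)[symmetric] z(1)[symmetric])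
        finally show ?thesis by simp
      qed
      show ?thesis
      proof (cases "b + d = 0")
        case True
        then have "- b = d" by (simp add: add_eq_0_iff)
        then have "b = 0" using D(6) w(3) z(3) by simp
        moreover have "- a = c'" using e True by (simp add: add_eq_0_iff)
        then have "a = 0" using D(6) w(2) z(2) by simp
        ultimately show ?thesis by (simp add: w)
      next
        case False
        have "y - x = (a + c') * inverse (b + d)"
        proof -
          have "a + c' = (y - x) * (b + d)" using e by (simp add: u_def algebra_simps add_eq_0_iff)
          then show ?thesis using False by simp
        qed
        then have "y - x \<in> M" using D(3,4) f(2) w z by simp
        then show ?thesis using c by simp
      qed
    qed
  qed
  moreover have "inverse w \<in> N" if w: "w \<in> N" for w
  proof -
    have "w\<^sup>2 \<in> M" using sq[OF w] MN D(1) by (metis diff_zero subsetD)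
    then have "inverse (w\<^sup>2) \<in> N" using f(2) MN by blast
    then have "w * inverse (w\<^sup>2) \<in> N" using mul w by blast
    then show ?thesis by (cases "w = 0") (simp_all add: power2_eq_square flip: mult.assoc)
  qed
  ultimately have "fcone N" by (simp add: fcone_def)
  then have "N = M" using M MN by (simp add: max_fcone_def)
  then show False using uN c by (simp add: u_def)
qed


section \<open>Intermediate values in a maximal ordering\<close>

text \<open>The weights c cannot be absorbed into the squares, since nonnegative elements of
  \<open>'r\<close> are not yet known to have square roots.\<close>

inductive_set wsos :: "nat \<Rightarrow> 'r::linordered_field poly set" for d where
  wsos_0: "0 \<in> wsos d"
| wsos_add: "s \<in> wsos d \<Longrightarrow> 0 \<le> c \<Longrightarrow> degree f < d \<Longrightarrow> s + smult c (f\<^sup>2) \<in> wsos d"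

lemma wsos_plus:
  assumes "s \<in> wsos d" "t \<in> wsos d"
  shows "s + t \<in> wsos d"
  using assms(2)
proof induction
  case (wsos_add t c f)
  then show ?case using wsos.wsos_add[of "s + t" d c f] by (simp add: add.assoc)
qed (simp add: assms(1))

lemma wsos_nonneg: "s \<in> wsos d \<Longrightarrow> 0 \<le> poly s x"
  by (induction rule: wsos.induct) simp_all

lemma wsos_degree: "s \<in> wsos d \<Longrightarrow> degree s \<le> 2 * (d - 1)"
proof (induction rule: wsos.induct)
  case (wsos_add s c f)
  have "degree (smult c (f\<^sup>2)) \<le> 2 * (d - 1)"
    using wsos_add(3) degree_smult_le[of c "f\<^sup>2"] degree_power_le[of f 2] by linarith
  then show ?case using wsos_add(4) by (intro degree_add_le)
qed simp

text \<open>The induction on the degree: if \<open>q\<close> is the minimal polynomial of a root \<open>\<alpha>\<close> and the ordering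
  does not extend to the field generated by \<open>\<alpha>\<close>, then \<open>1 + \<Sum> c f\<^sup>2 = q h\<close> with all degrees of the \<open>f\<close> smaller
  than the degree of \<open>q\<close>, and the cofactor \<open>h\<close> of smaller degree inherits the sign change.\<close>

lemma ivt_of_max_fcone:
  fixes e :: "'r::linordered_field \<Rightarrow> 'c::alg_closed_field" and q :: "'r poly"
  assumes e: "rhom e" and M: "max_fcone (e ` {0..})"
    and ab: "a < b" and q: "poly q a * poly q b < 0"
  shows "\<exists>x>a. x < b \<and> poly q x = 0"
  using q
proof (induction "degree q" arbitrary: q rule: less_induct)
  case less
  note es = rhom_simps[OF e]
  have e0: "c = 0" if "e c = 0" for c
  proof (rule ccontr)
    assume "c \<noteq> 0"
    then have "e c * e (inverse c) = 1" using rhom_mult[OF e, of c "inverse c"] rhom_1[OF e] by simp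
    then show False using that by simp
  qed
  have IH: "\<exists>x>a. x < b \<and> poly r x = 0" if "degree r < degree q" "poly r a * poly r b < 0" for r
    using less.hyps that by blast
  have q0: "q \<noteq> 0" using less.prems by auto
  have dq: "degree q > 0"
  proof (rule ccontr)
    assume "\<not> ?thesis"
    then obtain c where "q = [:c:]" using degree_eq_zeroE by blast
    then show False using less.prems by (simp add: mult_less_0_iff)
  qed
  have "degree (map_poly e q) = degree q" by (rule degree_map_poly) (use e0 in blast)
  then obtain \<alpha> where \<alpha>: "poly (map_poly e q) \<alpha> = 0" using alg_closed_imp_poly_has_root[of "map_poly e q"] dq by auto
  define E where "E = peval e \<alpha>"
  have Eh: "rhom E" unfolding E_def by (rule rhom_peval[OF e])
  note Es = rhom_simps[OF Eh]
  have Ec: "E [:c:] = e c" for c by (simp add: E_def peval_const[OF e])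
  have Esm: "E (smult c f) = e c * E f" for c f by (simp add: E_def peval_smult[OF e])
  have Eq: "E q = 0" using \<alpha> by (simp add: E_def peval_def)
  have Emod: "E (f mod q) = E f" for f
  proof -
    have "E f = E (f div q * q + f mod q)" by simp
    also have "\<dots> = E (f mod q)" by (simp only: rhom_add[OF Eh] rhom_mult[OF Eh] Eq) simp
    finally show ?thesis by simp
  qed
  have dmod: "degree (f mod q) < degree q" for f using degree_mod_less[OF q0, of f] dq by auto
  show ?case
  proof (cases "\<exists>r. r \<noteq> 0 \<and> degree r < degree q \<and> E r = 0")
    case True
    \<comment> \<open>Here q is not of least degree among the polynomials vanishing at \<alpha>. One
      of least degree divides q, and one of the two proper factors inherits the sign change.\<close>
    define R where "R = {r. r \<noteq> 0 \<and> degree r < degree q \<and> E r = 0}"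
    define r where "r = arg_min degree (\<lambda>r. r \<in> R)"
    have "r \<in> R" using True arg_min_natI[of "\<lambda>r. r \<in> R"] unfolding r_def R_def by blast
    then have r: "r \<noteq> 0" "degree r < degree q" "E r = 0" by (auto simp: R_def)
    have rmin: "degree r \<le> degree s" if "s \<in> R" for s
      unfolding r_def using arg_min_nat_le[of "\<lambda>r. r \<in> R", OF that] .
    have "E (q mod r) = E q - E (q div r) * E r"
      by (simp flip: rhom_mult[OF Eh] rhom_diff[OF Eh] add: minus_div_mult_eq_mod)
    then have "E (q mod r) = 0" using Eq r(3) by simp
    then have "q mod r = 0" using degree_mod_less[OF r(1), of q] rmin[of "q mod r"] r(2) by (force simp: R_def)
    then have qr: "q = (q div r) * r" by (metis add.right_neutral div_mult_mod_eq)
    define s where "s = q div r"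
    have qs: "q = s * r" unfolding s_def by (fact qr)
    then have "degree q = degree s + degree r" using q0 by (metis degree_mult_eq mult_eq_0_iff)
    moreover have "degree r > 0"
    proof (rule ccontr)
      assume "\<not> ?thesis"
      then obtain c where "r = [:c:]" using degree_eq_zeroE by blast
      then show False using r(1,3) Ec e0 by auto
    qed
    ultimately have ds: "degree s < degree q" by simp
    have "(poly s a * poly s b) * (poly r a * poly r b) < 0" using less.prems by (simp add: qs ac_simps)
    then have "poly s a * poly s b < 0 \<or> poly r a * poly r b < 0" by (metis mult_less_0_iff)
    then show ?thesis using IH[OF ds] IH[OF r(2)] by (auto simp: qs)
  next
    case False
    then have B: "r = 0" if "E r = 0" "degree r < degree q" for r using that by blast
    have dvd: "q dvd r" if "E r = 0" for r
      using B[of "r mod q"] Emod[of r] dmod[of r] that by (simp add: dvd_eq_mod_eq_0)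
    \<comment> \<open>Euclid's algorithm in disguise: a nonzero multiple of E g with a
      representative u of least degree has u constant, for otherwise the remainder of q by u would
      give a smaller one.\<close>
    have inv: "\<exists>v. E v * E g = 1" if g: "E g \<noteq> 0" for g
    proof -
      define U where "U = {u. degree u < degree q \<and> E u \<noteq> 0 \<and> (\<exists>v. E u = E v * E g)}"
      have "E (g mod q) = E 1 * E g" by (simp only: Emod rhom_1[OF Eh] mult_1_left)
      then have "g mod q \<in> U" using g Emod dmod unfolding U_def by auto
      define u where "u = arg_min degree (\<lambda>u. u \<in> U)"
      have "u \<in> U" using \<open>g mod q \<in> U\<close> arg_min_natI[of "\<lambda>r. r \<in> U"] unfolding u_def by blast
      then obtain v where u: "degree u < degree q" "E u \<noteq> 0" "E u = E v * E g" by (auto simp: U_def)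
      have umin: "degree u \<le> degree s" if "s \<in> U" for s
        unfolding u_def using arg_min_nat_le[of "\<lambda>r. r \<in> U", OF that] .
      have u0: "u \<noteq> 0" using u(2) Es by auto
      show ?thesis
      proof (cases "degree u = 0")
        case True
        then obtain c where c: "u = [:c:]" using degree_eq_zeroE by blast
        then have c0: "c \<noteq> 0" using u0 by simp
        have "E (smult (inverse c) v) * E g = e (inverse c) * E u" by (simp add: Esm u(3))
        also have "\<dots> = 1" using c0 rhom_mult[OF e, of "inverse c" c] rhom_1[OF e] by (simp add: c Ec)
        finally show ?thesis by blast
      next
        case False
        then have lt: "q mod u = 0 \<or> degree (q mod u) < degree u" using degree_mod_less[OF u0, of q] by auto
        have em: "E (q mod u) = E (- (q div u) * v) * E g"
        proof -
          have "E (q mod u) = E (q - (q div u) * u)" by (simp add: minus_div_mult_eq_mod)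
          also have "\<dots> = - (E (q div u) * E u)" by (simp only: rhom_diff[OF Eh] rhom_mult[OF Eh] Eq) simp
          finally show ?thesis by (simp add: Es u(3))
        qed
        have "q mod u = 0"
        proof (rule ccontr)
          assume ne: "q mod u \<noteq> 0"
          then have dlt: "degree (q mod u) < degree u" using lt by blast
          then have "q mod u \<notin> U" using umin[of "q mod u"] by fastforce
          then have "E (q mod u) = 0" using em dlt u(1) unfolding U_def by fastforce
          then show False using B[of "q mod u"] ne dlt u(1) by simp
        qed
        then have qu: "q = (q div u) * u" by (metis add.right_neutral div_mult_mod_eq)
        then have "E (q div u) * E u = 0" using Eq by (metis rhom_mult[OF Eh])
        then have "E (q div u) = 0" using u(2) by simp
        moreover have "degree q = degree (q div u) + degree u" using q0 qu by (metis degree_mult_eq mult_eq_0_iff)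
        ultimately have "q div u = 0" using B False by simp
        then show ?thesis using qu q0 by (metis mult_zero_left)
      qed
    qed
    \<comment> \<open>The cone generated by the nonnegative constants and the squares of the field
      obtained by adjoining \<alpha>. Reducing each f modulo q meets the degree bound without
      changing its value.\<close>
    define N where "N = E ` wsos (degree q)"
    have N0: "0 \<in> N" using wsos_0 Es(1) by (metis N_def image_eqI)
    have Nadd: "x + y \<in> N" if "x \<in> N" "y \<in> N" for x y
    proof -
      obtain s t where "x = E s" "s \<in> wsos (degree q)" "y = E t" "t \<in> wsos (degree q)"
        using \<open>x \<in> N\<close> \<open>y \<in> N\<close> by (auto simp: N_def)
      then show ?thesis using wsos_plus[of s _ t] unfolding N_def by (intro image_eqI[of _ _ "s + t"]) (auto simp: Es)
    qed
    have Ncs: "e c * (E f)\<^sup>2 \<in> N" if "0 \<le> c" for c f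
    proof -
      have "0 + smult c ((f mod q)\<^sup>2) \<in> wsos (degree q)" by (intro wsos.intros that dmod)
      moreover have "E (0 + smult c ((f mod q)\<^sup>2)) = e c * (E f)\<^sup>2" by (simp add: Esm Es Emod)
      ultimately show ?thesis unfolding N_def by (metis image_eqI)
    qed
    have Nsq: "(E f)\<^sup>2 \<in> N" for f using Ncs[of 1 f] by (simp add: es)
    have Nmulcs: "x * (e c * (E f)\<^sup>2) \<in> N" if "x \<in> N" "0 \<le> c" for x c f
    proof -
      obtain s where s: "x = E s" "s \<in> wsos (degree q)" using \<open>x \<in> N\<close> by (auto simp: N_def)
      from s(2) have "E s * (e c * (E f)\<^sup>2) \<in> N"
      proof induction
        case (wsos_add s c' g)
        have "E (s + smult c' (g\<^sup>2)) * (e c * (E f)\<^sup>2) = E s * (e c * (E f)\<^sup>2) + e (c' * c) * (E (g * f))\<^sup>2"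
          by (simp add: Es es Esm algebra_simps power_mult_distrib)
        then show ?case using Nadd wsos_add Ncs[of "c' * c" "g * f"] that(2) by simp
      qed (simp add: Es N0)
      then show ?thesis by (simp add: s)
    qed
    have Nmul: "x * y \<in> N" if "x \<in> N" "y \<in> N" for x y
    proof -
      obtain s where s: "y = E s" "s \<in> wsos (degree q)" using \<open>y \<in> N\<close> by (auto simp: N_def)
      from s(2) have "x * E s \<in> N"
      proof induction
        case (wsos_add s c' g)
        have "x * E (s + smult c' (g\<^sup>2)) = x * E s + x * (e c' * (E g)\<^sup>2)"
          by (simp add: Es Esm algebra_simps)
        then show ?case using Nadd wsos_add Nmulcs[OF \<open>x \<in> N\<close>, of c' g] by simp
      qed (simp add: Es N0)
      then show ?thesis by (simp add: s)
    qed
    have Ndiffsq: "(x - y)\<^sup>2 \<in> N" if xy: "x \<in> N" "y \<in> N" for x y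
    proof -
      obtain s t where "x = E s" "y = E t" using xy by (auto simp: N_def)
      then have "(x - y)\<^sup>2 = (E (s - t))\<^sup>2" by (simp add: Es)
      then show ?thesis using Nsq by simp
    qed
    have Ninv: "inverse x \<in> N" if x: "x \<in> N" for x
    proof (cases "x = 0")
      case False
      obtain s where s: "x = E s" using x by (auto simp: N_def)
      obtain v where v: "E v * E s = 1" using inv False s by blast
      then have xv: "x * E v = 1" by (simp add: s mult.commute)
      then have "inverse x = (x * E v) * E v" using inverse_unique by simp
      then have "inverse x = x * (e 1 * (E v)\<^sup>2)" by (simp add: rhom_1[OF e] power2_eq_square)
      then show ?thesis using Nmulcs[OF x, of 1 v] by simp
    qed (simp add: N0)
    show ?thesis
    proof (cases "\<exists>x. x \<in> N \<and> - x \<in> N \<and> x \<noteq> 0")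
      case True
      then obtain x where x: "x \<in> N" "- x \<in> N" "x \<noteq> 0" by blast
      have "- x * inverse x \<in> N" using Nmul x Ninv by blast
      then have "- 1 \<in> N" using x by simp
      then obtain s where s: "E s = - 1" "s \<in> wsos (degree q)" unfolding N_def by (metis imageE)
      have "E (1 + s) = 0" by (simp add: Es s)
      then obtain h where h: "1 + s = q * h" using dvd by (metis dvdE)
      have pos: "poly (1 + s) x > 0" for x using wsos_nonneg[OF s(2), of x] by simp
      have h0: "h \<noteq> 0" using pos[of 0] h by auto
      have "degree (1 + s) \<le> 2 * (degree q - 1)" using wsos_degree[OF s(2)] by (intro degree_add_le) auto
      moreover have "degree (1 + s) = degree q + degree h" using h q0 h0 by (simp add: degree_mult_eq)
      ultimately have dh: "degree h < degree q" using dq by linarith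
      have "(poly q a * poly q b) * (poly h a * poly h b) = poly (1 + s) a * poly (1 + s) b"
        by (simp only: h poly_mult ac_simps)
      then have "(poly q a * poly q b) * (poly h a * poly h b) > 0" using pos by simp
      then have "poly h a * poly h b < 0"
        using less.prems zero_less_mult_iff[of "poly q a * poly q b" "poly h a * poly h b"] by linarith
      then obtain x where "poly h x = 0" using IH[OF dh] by blast
      then show ?thesis using pos[of x] by (simp add: h)
    next
      case False
      have "pcone N"
      proof (rule pconeI)
        show "1 \<in> N" using Nsq[of 1] by (simp add: rhom_1[OF Eh])
        show "x = 0" if "x \<in> N" "- x \<in> N" for x using False that by blast
        show "0 \<in> N" by (rule N0)
        show "x + y \<in> N" if "x \<in> N" "y \<in> N" for x y by (rule Nadd[OF that])
        show "x * y \<in> N" if "x \<in> N" "y \<in> N" for x y by (rule Nmul[OF that])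
        show "(x - y)\<^sup>2 \<in> N" if "x \<in> N" "y \<in> N" for x y by (rule Ndiffsq[OF that])
      qed
      then have "fcone N" using Ninv by (simp add: fcone_def)
      moreover have "e ` {0..} \<subseteq> N" using Ncs[of _ 1] by (auto simp: Es)
      ultimately have NM: "N = e ` {0..}" using M by (simp add: max_fcone_def)
      have "degree q = 1"
      proof (rule ccontr)
        assume "degree q \<noteq> 1"
        then have d1: "degree q > 1" using dq by simp
        \<comment> \<open>Since (\<alpha>+1)^2 - (\<alpha>-1)^2 = 4\<alpha> and N has not grown,
          \<alpha> lies in the image of e. This contradicts the minimality of a degree above
          1.\<close>
        obtain c1 where c1: "(E [:1, 1:])\<^sup>2 = e c1" using Nsq[of "[:1, 1:]"] NM by auto
        obtain c2 where c2: "(E [:-1, 1:])\<^sup>2 = e c2" using Nsq[of "[:-1, 1:]"] NM by auto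
        have eq: "[:1, 1:]\<^sup>2 - [:-1, 1:]\<^sup>2 - [:c1 - c2:] = [:c2 - c1, 4:]" by (simp add: power2_eq_square)
        have "E ([:1, 1:]\<^sup>2 - [:-1, 1:]\<^sup>2 - [:c1 - c2:]) = 0"
          by (simp only: rhom_diff[OF Eh] rhom_power[OF Eh] c1 c2 Ec rhom_diff[OF e]) simp
        then have "[:c2 - c1, 4:] = 0" using B[of "[:c2 - c1, 4:]"] d1 by (simp add: eq)
        then show False by simp
      qed
      then obtain c0 c1 where q01: "q = [:c0, c1:]" "c1 \<noteq> 0"
        by (cases q rule: pCons_cases) (auto split: if_splits elim!: degree_eq_zeroE)
      define x where "x = - c0 / c1"
      have qx: "poly q y = c1 * (y - x)" for y using q01 by (simp add: x_def algebra_simps)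
      have "c1\<^sup>2 * ((a - x) * (b - x)) < 0" using less.prems by (simp add: qx power2_eq_square ac_simps)
      then have "(a - x) * (b - x) < 0" by (simp add: mult_less_0_iff)
      then have "a < x" "x < b" using ab by (auto simp: mult_less_0_iff)
      then show ?thesis using qx by (intro exI[of _ x]) simp
    qed
  qed
qed

section \<open>Elimination of one variable\<close>

definition subrng :: "'a::comm_ring_1 set \<Rightarrow> bool" where
  "subrng B \<longleftrightarrow> 1 \<in> B \<and> (\<forall>x\<in>B. \<forall>y\<in>B. x - y \<in> B \<and> x * y \<in> B)"

lemma subrngD:
  assumes "subrng B"
  shows "1 \<in> B" "0 \<in> B" "\<And>x. x \<in> B \<Longrightarrow> - x \<in> B" "\<And>x y. x \<in> B \<Longrightarrow> y \<in> B \<Longrightarrow> x + y \<in> B"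
    "\<And>x y. x \<in> B \<Longrightarrow> y \<in> B \<Longrightarrow> x - y \<in> B" "\<And>x y. x \<in> B \<Longrightarrow> y \<in> B \<Longrightarrow> x * y \<in> B"
proof -
  show 1: "1 \<in> B" and d: "\<And>x y. x \<in> B \<Longrightarrow> y \<in> B \<Longrightarrow> x - y \<in> B" and "\<And>x y. x \<in> B \<Longrightarrow> y \<in> B \<Longrightarrow> x * y \<in> B"
    using assms by (auto simp: subrng_def)
  show 0: "0 \<in> B" using d[OF 1 1] by simp
  show m: "- x \<in> B" if "x \<in> B" for x using d[OF 0 that] by simp
  show "x + y \<in> B" if "x \<in> B" "y \<in> B" for x y using d[OF that(1) m[OF that(2)]] by simp
qed

lemma subrng_sum: "subrng B \<Longrightarrow> (\<And>i. i \<in> I \<Longrightarrow> f i \<in> B) \<Longrightarrow> sum f I \<in> B"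
  by (induction I rule: infinite_finite_induct) (auto intro: subrngD)

lemma subrng_power: "subrng B \<Longrightarrow> x \<in> B \<Longrightarrow> x ^ n \<in> B"
  by (induction n) (auto intro: subrngD)

lemma subrng_of_nat: "subrng B \<Longrightarrow> of_nat n \<in> B"
  by (induction n) (auto intro: subrngD)

definition polys :: "'a::comm_ring_1 set \<Rightarrow> 'a poly set" where
  "polys B = {p. \<forall>i. coeff p i \<in> B}"

lemma subrng_polys:
  assumes "subrng B"
  shows "subrng (polys B)"
  unfolding subrng_def
  by (auto simp: polys_def coeff_1 coeff_mult intro!: subrng_sum[OF assms] intro: subrngD[OF assms])

lemma polys_smult: "subrng B \<Longrightarrow> c \<in> B \<Longrightarrow> p \<in> polys B \<Longrightarrow> smult c p \<in> polys B"
  by (auto simp: polys_def intro: subrngD)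

lemma polys_monom: "subrng B \<Longrightarrow> c \<in> B \<Longrightarrow> monom c n \<in> polys B"
  by (auto simp: polys_def intro: subrngD)

lemma polys_pderiv: "subrng B \<Longrightarrow> p \<in> polys B \<Longrightarrow> pderiv p \<in> polys B"
  by (auto simp: polys_def coeff_pderiv simp del: of_nat_Suc intro!: subrngD(6) subrng_of_nat)

text \<open>The multiplier is a power of the squared leading coefficient, so that it becomes
  positive in every ordered field in which the leading coefficient of g does not vanish.\<close>

lemma polys_pseudo_mod:
  fixes f g :: "'a::idom poly"
  assumes B: "subrng B" and g: "g \<in> polys B" "g \<noteq> 0" and f: "f \<in> polys B"
  shows "\<exists>k h r. h \<in> polys B \<and> r \<in> polys B \<and> smult ((lead_coeff g)\<^sup>2 ^ k) f = g * h + r \<and>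
    (r = 0 \<or> degree r < degree g)"
  using f
\<comment> \<open>The measure puts 0 strictly below the nonzero constants, since division by a
  constant ends at the zero polynomial without lowering the degree.\<close>
proof (induction "if f = 0 then 0 else Suc (degree f)" arbitrary: f rule: less_induct)
  case less
  note P = subrngD[OF subrng_polys[OF B]]
  have lc: "lead_coeff p \<in> B" if "p \<in> polys B" for p using that by (simp add: polys_def)
  show ?case
  proof (cases "f = 0 \<or> degree f < degree g")
    case True
    then show ?thesis by (intro exI[of _ 0] exI[of _ f]) (use less.prems P(2) in auto)
  next
    case False
    define m where "m = monom (lead_coeff f) (degree f - degree g)"
    define l where "l = lead_coeff g"
    define f1 where "f1 = smult l f - m * g"
    have mB: "m \<in> polys B" unfolding m_def using polys_monom B lc less.prems by blast
    have lB: "l \<in> B" unfolding l_def using lc g(1) by blast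
    have f1B: "f1 \<in> polys B" unfolding f1_def using P(5,6) polys_smult[OF B lB less.prems] mB g(1) by blast
    have "f1 = 0 \<or> degree f1 < degree f"
    proof -
      have dm: "degree (m * g) = degree f"
        using False g(2) by (simp add: m_def degree_mult_eq degree_monom_eq monom_eq_0_iff)
      have "degree f1 \<le> degree f" unfolding f1_def
        by (rule degree_diff_le) (use dm degree_smult_le in auto)
      moreover have "coeff f1 (degree f) = 0"
      proof -
        have "coeff (m * g) (degree f) = lead_coeff m * lead_coeff g"
          using dm lead_coeff_mult[of m g] by simp
        also have "lead_coeff m = lead_coeff f" using False by (simp add: m_def degree_monom_eq)
        finally show ?thesis by (simp add: f1_def l_def mult.commute)
      qed
      ultimately show ?thesis by (metis leading_coeff_0_iff order_le_imp_less_or_eq)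
    qed
    then have "(if f1 = 0 then 0 else Suc (degree f1)) < (if f = 0 then 0 else Suc (degree f))"
      using False by auto
    then obtain k h r where IH: "h \<in> polys B" "r \<in> polys B" "smult (l\<^sup>2 ^ k) f1 = g * h + r"
      "r = 0 \<or> degree r < degree g" using less.hyps f1B unfolding l_def by blast
    \<comment> \<open>The cancellation uses one factor l; the other is spent on completing the
      square and also multiplies the remainder.\<close>
    have "smult (l\<^sup>2 ^ Suc k) f = smult l (smult (l\<^sup>2 ^ k) (f1 + m * g))"
      by (simp add: f1_def power2_eq_square ac_simps)
    also have "\<dots> = smult l (g * h + r + smult (l\<^sup>2 ^ k) (m * g))"
      by (simp only: smult_add_right IH(3))
    also have "\<dots> = g * (smult l (h + smult (l\<^sup>2 ^ k) m)) + smult l r"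
      by (simp add: algebra_simps smult_add_right)
    finally have eq: "smult (l\<^sup>2 ^ Suc k) f = g * (smult l (h + smult (l\<^sup>2 ^ k) m)) + smult l r" .
    have "l\<^sup>2 ^ k \<in> B" using subrng_power[OF B] lB by blast
    then have "smult l (h + smult (l\<^sup>2 ^ k) m) \<in> polys B" "smult l r \<in> polys B"
      using polys_smult[OF B] lB P(4) IH(1,2) mB by blast+
    moreover have "smult l r = 0 \<or> degree (smult l r) < degree g"
      using IH(4) degree_smult_le[of l r] by (auto intro: le_less_trans)
    ultimately show ?thesis using eq unfolding l_def by blast
  qed
qed

lemma coeff_map_rhom: "rhom h \<Longrightarrow> coeff (map_poly h p) i = h (coeff p i)"
  by (rule coeff_map_poly) (rule rhom_0)

lemma map_poly_rhom_0_iff: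
  assumes "rhom h" "h (lead_coeff p) = 0 \<Longrightarrow> p = 0"
  shows "map_poly h p = 0 \<longleftrightarrow> p = 0" and "degree (map_poly h p) = degree p"
proof -
  show "map_poly h p = 0 \<longleftrightarrow> p = 0"
    using assms coeff_map_rhom[OF assms(1), of p "degree p"] by (metis coeff_0 map_poly_0)
  show "degree (map_poly h p) = degree p"
  proof (cases "p = 0")
    case False
    then have "coeff (map_poly h p) (degree p) \<noteq> 0" using assms coeff_map_rhom by metis
    then have "degree p \<le> degree (map_poly h p)" by (rule le_degree)
    then show ?thesis using map_poly_degree_leq[of h p] by simp
  qed simp
qed

text \<open>\<open>evl\<close> is a family of specialisations of a ring \<open>A\<close> and \<open>\<Phi>\<close> a generic point; a property of specialisations
  holds near the generic point if it follows from finitely many sign agreements on \<open>B\<close>.\<close>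

definition near :: "('a \<Rightarrow> 'r::linordered_field) \<Rightarrow> ('b \<Rightarrow> 'a \<Rightarrow> 's::linordered_field) \<Rightarrow> 'a set \<Rightarrow> ('b \<Rightarrow> bool) \<Rightarrow> bool" where
  "near \<Phi> evl B W \<longleftrightarrow> (\<exists>Q\<subseteq>B. finite Q \<and> (\<forall>b. (\<forall>q\<in>Q. ssame (\<Phi> q) (evl b q)) \<longrightarrow> W b))"

lemma near_basic: "q \<in> B \<Longrightarrow> near \<Phi> evl B (\<lambda>b. ssame (\<Phi> q) (evl b q))"
  unfolding near_def by (rule exI[of _ "{q}"]) auto

lemma near_mono: "near \<Phi> evl B W \<Longrightarrow> (\<And>b. W b \<Longrightarrow> Y b) \<Longrightarrow> near \<Phi> evl B Y"
  unfolding near_def by meson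

lemma near_ball:
  assumes "finite I" "\<And>i. i \<in> I \<Longrightarrow> near \<Phi> evl B (W i)"
  shows "near \<Phi> evl B (\<lambda>b. \<forall>i\<in>I. W i b)"
proof -
  have "\<forall>i\<in>I. \<exists>Q\<subseteq>B. finite Q \<and> (\<forall>b. (\<forall>q\<in>Q. ssame (\<Phi> q) (evl b q)) \<longrightarrow> W i b)"
    using assms(2) unfolding near_def by blast
  then obtain Q where Q: "\<And>i. i \<in> I \<Longrightarrow> Q i \<subseteq> B" "\<And>i. i \<in> I \<Longrightarrow> finite (Q i)"
    "\<And>i b. i \<in> I \<Longrightarrow> (\<forall>q\<in>Q i. ssame (\<Phi> q) (evl b q)) \<Longrightarrow> W i b"
    by (auto dest!: bchoice)
  show ?thesis unfolding near_def
    by (rule exI[of _ "\<Union>i\<in>I. Q i"]) (use Q assms(1) in auto)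
qed

lemma near_conj: "near \<Phi> evl B W \<Longrightarrow> near \<Phi> evl B Y \<Longrightarrow> near \<Phi> evl B (\<lambda>b. W b \<and> Y b)"
  unfolding near_def
proof clarify
  fix Q R assume "Q \<subseteq> B" "finite Q" "\<forall>b. (\<forall>q\<in>Q. ssame (\<Phi> q) (evl b q)) \<longrightarrow> W b"
    "R \<subseteq> B" "finite R" "\<forall>b. (\<forall>q\<in>R. ssame (\<Phi> q) (evl b q)) \<longrightarrow> Y b"
  then show "\<exists>Q\<subseteq>B. finite Q \<and> (\<forall>b. (\<forall>q\<in>Q. ssame (\<Phi> q) (evl b q)) \<longrightarrow> W b \<and> Y b)"
    by (intro exI[of _ "Q \<union> R"]) auto
qed

text \<open>The Cohen--Hoermander induction: a polynomial of maximal degree is replaced by its derivative and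
  its pseudo-remainders modulo the other polynomials and the derivative.\<close>

lemma near_matched:
  fixes \<Phi> :: "'a::idom \<Rightarrow> 'r::rcf" and evl :: "'b \<Rightarrow> 'a \<Rightarrow> 's::rcf"
  assumes B: "subrng B" and \<Phi>: "rhom \<Phi>" and inj: "\<And>a. \<Phi> a = 0 \<Longrightarrow> a = 0" and e: "\<And>b. rhom (evl b)"
  shows "finite S \<Longrightarrow> S \<subseteq> polys B \<Longrightarrow>
    near \<Phi> evl B (\<lambda>b. \<exists>Z. matched ((\<lambda>p. (map_poly \<Phi> p, map_poly (evl b) p)) ` S) Z)"
\<comment> \<open>The multiset of degrees decreases: one polynomial of degree d > 0 is traded for
  finitely many of smaller degree.\<close>
proof (induction S rule: wf_induct[OF wf_inv_image[OF wf_mult[OF wf_less_than]], of "\<lambda>S. image_mset degree (mset_set S)"])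
  case (1 S)
  define pr where "pr b p = (map_poly \<Phi> p, map_poly (evl b) p)" for b p
  have fin: "finite S" and SB: "S \<subseteq> polys B" using 1(2,3) .
  note P = subrngD[OF subrng_polys[OF B]]
  \<comment> \<open>Sign agreement of the leading coefficients keeps degrees from dropping under
    specialisation.\<close>
  define lcs where "lcs b p \<longleftrightarrow> ssame (\<Phi> (lead_coeff p)) (evl b (lead_coeff p))" for b p
  have nlcs: "near \<Phi> evl B (\<lambda>b. lcs b p)" if "p \<in> polys B" for p
    unfolding lcs_def by (rule near_basic) (use that in \<open>simp add: polys_def\<close>)
  have nz\<Phi>: "map_poly \<Phi> p = 0 \<longleftrightarrow> p = 0" "degree (map_poly \<Phi> p) = degree p" for p
    by (rule map_poly_rhom_0_iff[OF \<Phi>]; use inj in force)+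
  have lcs0: "p = 0" if "lcs b p" "evl b (lead_coeff p) = 0" for b p
    using that inj unfolding lcs_def by (metis leading_coeff_0_iff ssame_eq_0_iff)
  have nze: "map_poly (evl b) p = 0 \<longleftrightarrow> p = 0" "degree (map_poly (evl b) p) = degree p" if "lcs b p" for b p
    by (rule map_poly_rhom_0_iff[OF e]; use lcs0[OF that] in blast)+
  show ?case
  proof (cases "\<exists>p\<in>S. degree p > 0")
    case False
    have "near \<Phi> evl B (\<lambda>b. \<forall>p\<in>S. lcs b p)" by (rule near_ball[OF fin nlcs]) (use SB in blast)
    then show ?thesis
    proof (rule near_mono)
      fix b assume l: "\<forall>p\<in>S. lcs b p"
      have "matched (pr b ` S) {}"
      proof (rule matchedI)
        fix p q assume "(p, q) \<in> pr b ` S"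
        then obtain s where s: "p = map_poly \<Phi> s" "q = map_poly (evl b) s" "s \<in> S" by (auto simp: pr_def)
        obtain c where c: "s = [:c:]" using s(3) False degree_eq_zeroE by (metis gr0I)
        have ls: "lcs b s" using l s(3) by blast
        then have sc: "ssame (\<Phi> c) (evl b c)" by (simp add: lcs_def c)
        have pq: "p = [:\<Phi> c:]" "q = [:evl b c:]"
          by (auto simp: s c map_poly_pCons rhom_0[OF \<Phi>] rhom_0[OF e])
        show "p = 0 \<longleftrightarrow> q = 0" using ssame_eq_0_iff[OF sc] by (simp add: pq)
        show "\<exists>y. (x, y) \<in> {}" if "p \<noteq> 0" "poly p x = 0" for x using that by (simp add: pq)
        show "\<exists>x. (x, y) \<in> {}" if "q \<noteq> 0" "poly q y = 0" for y using that by (simp add: pq)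
        show "ssame (poly p x) (poly q y)" for x y using sc by (simp add: pq)
      qed auto
      then show "\<exists>Z. matched ((\<lambda>p. (map_poly \<Phi> p, map_poly (evl b) p)) ` S) Z" unfolding pr_def by blast
    qed
  next
    case True
    define d where "d = Max (degree ` S)"
    have "d \<in> degree ` S" unfolding d_def using fin True by (intro Max_in) auto
    then obtain p where p: "p \<in> S" "degree p = d" by auto
    have dmax: "degree s \<le> d" if "s \<in> S" for s using that fin by (simp add: d_def)
    have d0: "degree p > 0" using True dmax p by fastforce
    have p0: "p \<noteq> 0" using d0 by auto
    define T where "T = insert (pderiv p) (S - {p})"
    have pB: "p \<in> polys B" using p SB by blast
    have dpB: "pderiv p \<in> polys B" using polys_pderiv[OF B pB] .
    have TB: "T \<subseteq> polys B" using dpB SB by (auto simp: T_def)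
    have ddp: "degree (pderiv p) < d"
    proof -
      have "degree (pderiv p) \<le> d - 1"
        by (rule degree_le) (use p(2) in \<open>simp add: coeff_pderiv coeff_eq_0\<close>)
      then show ?thesis using d0 p(2) by linarith
    qed
    have Td: "degree t \<le> d" if "t \<in> T" for t using that dmax ddp by (auto simp: T_def)
    have finT: "finite T" using fin by (simp add: T_def)
    have "\<forall>t\<in>T - {0}. \<exists>k h r. h \<in> polys B \<and> r \<in> polys B \<and>
        smult ((lead_coeff t)\<^sup>2 ^ k) p = t * h + r \<and> (r = 0 \<or> degree r < degree t)"
      using polys_pseudo_mod[OF B _ _ pB] TB by auto
    then obtain k h r where *: "\<forall>t\<in>T - {0}. h t \<in> polys B \<and> r t \<in> polys B \<and>
        smult ((lead_coeff t)\<^sup>2 ^ k t) p = t * h t + r t \<and> (r t = 0 \<or> degree (r t) < degree t)"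
      by metis
    have khr: "h t \<in> polys B" "r t \<in> polys B" "smult ((lead_coeff t)\<^sup>2 ^ k t) p = t * h t + r t"
      "r t = 0 \<or> degree (r t) < degree t" if "t \<in> T" "t \<noteq> 0" for t
      using * that by blast+
    define R where "R = r ` (T - {0})"
    have RB: "R \<subseteq> polys B" using khr(2) by (auto simp: R_def)
    have Rd: "degree u < d" if u: "u \<in> R" for u
    proof -
      obtain t where t: "t \<in> T" "t \<noteq> 0" "u = r t" using u by (auto simp: R_def)
      show ?thesis using khr(4)[OF t(1,2)] Td[OF t(1)] t(3) d0 p(2) by auto
    qed
    have finR: "finite R" using finT by (simp add: R_def)
    \<comment> \<open>Polynomials already present in S are discarded so that the union below is
      disjoint and its degree multiset is a sum.\<close>
    define L where "L = (insert (pderiv p) R) - (S - {p})"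
    have TR: "T \<union> R = (S - {p}) \<union> L" by (auto simp: L_def T_def)
    have finL: "finite L" using finR by (simp add: L_def)
    have "mset_set (T \<union> R) = mset_set (S - {p}) + mset_set L"
      unfolding TR by (rule mset_set_Union) (use fin finL in \<open>auto simp: L_def\<close>)
    moreover have "mset_set S = mset_set (S - {p}) + {#p#}"
      using mset_set.remove[OF fin p(1)] by simp
    moreover have "(image_mset degree (mset_set (S - {p})) + image_mset degree (mset_set L),
        image_mset degree (mset_set (S - {p})) + {#d#}) \<in> mult less_than"
    proof (rule one_step_implies_mult)
      show "\<forall>j\<in>#image_mset degree (mset_set L). \<exists>i\<in>#{#d#}. (j, i) \<in> less_than"
        using finL Rd ddp by (auto simp: L_def)
    qed simp
    ultimately have rel: "(T \<union> R, S) \<in> inv_image (mult less_than) (\<lambda>S. image_mset degree (mset_set S))"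
      using p(2) by simp
    have IH: "near \<Phi> evl B (\<lambda>b. \<exists>Z. matched (pr b ` (T \<union> R)) Z)"
      unfolding pr_def by (rule 1(1)[rule_format, OF rel]) (use finT finR TB RB in auto)
    have "near \<Phi> evl B (\<lambda>b. \<forall>t\<in>insert p T. lcs b t)"
      by (rule near_ball[OF _ nlcs]) (use finT pB TB in auto)
    with IH have "near \<Phi> evl B (\<lambda>b. (\<exists>Z. matched (pr b ` (T \<union> R)) Z) \<and> (\<forall>t\<in>insert p T. lcs b t))"
      by (rule near_conj)
    then show ?thesis
    proof (rule near_mono)
      fix b assume "(\<exists>Z. matched (pr b ` (T \<union> R)) Z) \<and> (\<forall>t\<in>insert p T. lcs b t)"
      then obtain Z where Z: "matched (pr b ` T \<union> pr b ` R) Z" and l: "\<And>t. t \<in> insert p T \<Longrightarrow> lcs b t"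
        by (auto simp: image_Un)
      have lp: "lcs b p" using l by blast
      have "\<exists>Y. matched (insert (map_poly \<Phi> p, map_poly (evl b) p) (pr b ` T)) Y"
      proof (rule matched_step[OF Z])
        show "(pderiv (map_poly \<Phi> p), pderiv (map_poly (evl b) p)) \<in> pr b ` T"
          by (rule image_eqI[of _ _ "pderiv p"])
            (auto simp: pr_def T_def map_poly_rhom_pderiv[OF \<Phi>] map_poly_rhom_pderiv[OF e])
        show "0 < degree (map_poly \<Phi> p)" "degree (map_poly \<Phi> p) = degree (map_poly (evl b) p)"
          using d0 nz\<Phi> nze[OF lp] by simp_all
        show "ssame (lead_coeff (map_poly \<Phi> p)) (lead_coeff (map_poly (evl b) p))"
          using lp nz\<Phi>(2) nze(2)[OF lp] by (simp add: lcs_def coeff_map_rhom[OF \<Phi>] coeff_map_rhom[OF e])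
      next
        fix a c assume ac: "(a, c) \<in> pr b ` T" "a \<noteq> 0"
        then obtain t where t: "t \<in> T" "a = map_poly \<Phi> t" "c = map_poly (evl b) t" by (auto simp: pr_def)
        have t0: "t \<noteq> 0" using ac(2) t(2) by auto
        have lt: "lcs b t" using l t(1) by blast
        define m where "m = (lead_coeff t)\<^sup>2 ^ k t"
        have eq: "smult m p = t * h t + r t" using khr(3)[OF t(1) t0] by (simp add: m_def)
        have "\<Phi> (lead_coeff t) \<noteq> 0" "evl b (lead_coeff t) \<noteq> 0"
          using inj t0 lcs0[OF lt] by (metis leading_coeff_0_iff, metis)
        then have pos: "\<Phi> m > 0" "evl b m > 0"
          by (simp_all add: m_def rhom_power[OF \<Phi>] rhom_power[OF e])
        have "(map_poly \<Phi> (r t), map_poly (evl b) (r t)) \<in> pr b ` R"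
          using t(1) t0 by (auto simp: pr_def R_def)
        moreover have "smult (\<Phi> m) (map_poly \<Phi> p) = a * map_poly \<Phi> (h t) + map_poly \<Phi> (r t)"
          using arg_cong[OF eq, of "map_poly \<Phi>"]
          by (simp add: t(2) map_poly_rhom_smult[OF \<Phi>] map_poly_rhom_add[OF \<Phi>] map_poly_rhom_mult[OF \<Phi>])
        moreover have "smult (evl b m) (map_poly (evl b) p) = c * map_poly (evl b) (h t) + map_poly (evl b) (r t)"
          using arg_cong[OF eq, of "map_poly (evl b)"]
          by (simp add: t(3) map_poly_rhom_smult[OF e] map_poly_rhom_add[OF e] map_poly_rhom_mult[OF e])
        ultimately show "\<exists>r s c' d h k. (r, s) \<in> pr b ` R \<and> c' > 0 \<and> d > 0 \<and>
            smult c' (map_poly \<Phi> p) = a * h + r \<and> smult d (map_poly (evl b) p) = c * k + s"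
          using pos by blast
      qed
      then obtain Y where "matched (insert (pr b p) (pr b ` T)) Y" unfolding pr_def by blast
      \<comment> \<open>T contains the derivative of p, which need not belong to S.\<close>
      then have "matched (pr b ` S) {(z, w) \<in> Y. \<exists>(p, q)\<in>pr b ` S. p \<noteq> 0 \<and> poly p z = 0}"
        by (rule matched_coarsen) (auto simp: T_def)
      then show "\<exists>Z. matched ((\<lambda>p. (map_poly \<Phi> p, map_poly (evl b) p)) ` S) Z" unfolding pr_def by blast
    qed
  qed
qed

section \<open>Polynomials and their evaluation\<close>

definition mvar_code :: "'n::finite mvar \<Rightarrow> nat" where
  "mvar_code v = (case v of XV i \<Rightarrow> 2 * to_nat i | MV a \<Rightarrow> 2 * to_nat (Rep_nzidx a) + 1)"

lemma inj_mvar_code: "inj mvar_code"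
proof (rule injI)
  fix v w :: "'n::finite mvar"
  have par: "2 * a \<noteq> Suc (2 * b)" "Suc (2 * b) \<noteq> 2 * a" for a b :: nat by presburger+
  assume "mvar_code v = mvar_code w"
  then show "v = w" by (auto simp: mvar_code_def par Rep_nzidx_inject split: mvar.splits)
qed

text \<open>Any linear order of the indeterminates makes the ring of polynomials an integral domain.\<close>

instantiation mvar :: (finite) linorder
begin

definition "v \<le> w \<longleftrightarrow> mvar_code v \<le> mvar_code w"
definition "(v :: 'a mvar) < w \<longleftrightarrow> mvar_code v < mvar_code w"

instance
  by standard (auto simp: less_eq_mvar_def less_mvar_def dest: injD[OF inj_mvar_code])

end

section \<open>Evaluation at real points and subalgebras generated by indeterminates\<close>

definition mev :: "('v \<Rightarrow> 'r::comm_semiring_1) \<Rightarrow> ('v \<Rightarrow>\<^sub>0 nat) \<Rightarrow> 'r" where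
  "mev f m = (\<Prod>v\<in>Poly_Mapping.keys m. f v ^ Poly_Mapping.lookup m v)"

lemma mev_superset:
  assumes "finite V" "Poly_Mapping.keys m \<subseteq> V"
  shows "mev f m = (\<Prod>v\<in>V. f v ^ Poly_Mapping.lookup m v)"
  unfolding mev_def by (rule prod.mono_neutral_left) (use assms in \<open>auto simp: in_keys_iff\<close>)

lemma mev_add: "mev f (m + n) = mev f m * mev f n"
proof -
  define V where "V = Poly_Mapping.keys m \<union> Poly_Mapping.keys n"
  have "finite V" "Poly_Mapping.keys m \<subseteq> V" "Poly_Mapping.keys n \<subseteq> V" "Poly_Mapping.keys (m + n) \<subseteq> V"
    using keys_add[of m n] by (auto simp: V_def)
  then show ?thesis by (simp add: mev_superset[of V] lookup_add power_add prod.distrib)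
qed

lemma mev_zero [simp]: "mev f 0 = 1"
  by (simp add: mev_def)

lemma mev_single [simp]: "mev f (Poly_Mapping.single v k) = f v ^ k"
  by (cases "k = 0") (simp_all add: mev_def)

lemma sum_keys_superset:
  assumes "\<And>m. F m 0 = 0" "finite V" "Poly_Mapping.keys p \<subseteq> V"
  shows "(\<Sum>m\<in>Poly_Mapping.keys p. F m (Poly_Mapping.lookup p m)) = (\<Sum>m\<in>V. F m (Poly_Mapping.lookup p m))"
  by (rule sum.mono_neutral_left) (use assms in \<open>auto simp: in_keys_iff\<close>)

lemma sum_keys_add:
  fixes F :: "'k \<Rightarrow> 'a::monoid_add \<Rightarrow> 'b::comm_monoid_add"
  assumes "\<And>m. F m 0 = 0" "\<And>m a b. F m (a + b) = F m a + F m b"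
  shows "(\<Sum>m\<in>Poly_Mapping.keys (p + q). F m (Poly_Mapping.lookup (p + q) m)) =
    (\<Sum>m\<in>Poly_Mapping.keys p. F m (Poly_Mapping.lookup p m)) +
    (\<Sum>m\<in>Poly_Mapping.keys q. F m (Poly_Mapping.lookup q m))"
proof -
  define V where "V = Poly_Mapping.keys p \<union> Poly_Mapping.keys q"
  have V: "finite V" "Poly_Mapping.keys p \<subseteq> V" "Poly_Mapping.keys q \<subseteq> V" "Poly_Mapping.keys (p + q) \<subseteq> V"
    using keys_add[of p q] by (auto simp: V_def)
  show ?thesis
    unfolding sum_keys_superset[of F, OF assms(1) V(1,2)] sum_keys_superset[of F, OF assms(1) V(1,3)]
      sum_keys_superset[of F, OF assms(1) V(1,4)]
    by (simp add: assms lookup_add sum.distrib)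
qed

lemma poly_mapping_sum_singles:
  fixes p :: "'k \<Rightarrow>\<^sub>0 'a::comm_monoid_add"
  shows "p = (\<Sum>m\<in>Poly_Mapping.keys p. Poly_Mapping.single m (Poly_Mapping.lookup p m))"
proof (rule poly_mapping_eqI)
  fix k
  have "(\<Sum>m\<in>Poly_Mapping.keys p. Poly_Mapping.lookup (Poly_Mapping.single m (Poly_Mapping.lookup p m)) k)
    = (\<Sum>m\<in>Poly_Mapping.keys p. if k = m then Poly_Mapping.lookup p m else 0)"
    by (rule sum.cong) (auto simp: lookup_single when_def)
  also have "\<dots> = Poly_Mapping.lookup p k" by (simp add: in_keys_iff)
  finally show "Poly_Mapping.lookup p k =
      Poly_Mapping.lookup (\<Sum>m\<in>Poly_Mapping.keys p. Poly_Mapping.single m (Poly_Mapping.lookup p m)) k"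
    by (simp add: lookup_sum)
qed

lemma additive_ext:
  fixes F G :: "('k \<Rightarrow>\<^sub>0 'a::comm_monoid_add) \<Rightarrow> 'b::comm_monoid_add"
  assumes "\<And>p q. F (p + q) = F p + F q" "\<And>p q. G (p + q) = G p + G q" "F 0 = 0" "G 0 = 0"
    and "\<And>m c. F (Poly_Mapping.single m c) = G (Poly_Mapping.single m c)"
  shows "F p = G p"
proof -
  have "F (\<Sum>m\<in>I. Poly_Mapping.single m (c m)) = G (\<Sum>m\<in>I. Poly_Mapping.single m (c m))" for I c
    by (induction I rule: infinite_finite_induct) (simp_all add: assms)
  then show ?thesis by (metis poly_mapping_sum_singles)
qed

definition ev :: "('n mvar \<Rightarrow> real) \<Rightarrow> 'n Mpoly \<Rightarrow> real" where
  "ev b p = (\<Sum>m\<in>Poly_Mapping.keys p. Poly_Mapping.lookup p m * mev b m)"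

lemma ev_add: "ev b (p + q) = ev b p + ev b q"
  unfolding ev_def using sum_keys_add[of "\<lambda>m c. c * mev b m"] by (simp add: algebra_simps)

lemma ev_zero [simp]: "ev b 0 = 0"
  by (simp add: ev_def)

lemma ev_single [simp]: "ev b (Poly_Mapping.single m c) = c * mev b m"
  by (cases "c = 0") (simp_all add: ev_def)

lemma ev_mult: "ev b (p * q) = ev b p * ev b q"
proof -
  have s: "ev b (Poly_Mapping.single m c * q) = ev b (Poly_Mapping.single m c) * ev b q" for m c q
    by (rule additive_ext[of "\<lambda>q. ev b (Poly_Mapping.single m c * q)"])
      (simp_all add: distrib_left ev_add mult_single mev_add)
  show ?thesis
    by (rule additive_ext[of "\<lambda>p. ev b (p * q)"]) (simp_all add: distrib_right ev_add s)
qed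

lemma rhom_ev: "rhom (ev b)"
  by (simp add: rhom_def ev_add ev_mult flip: single_one)

lemma ev_pconst [simp]: "ev b (pconst c) = c"
  by (simp add: pconst_def)

lemma ev_pvar [simp]: "ev b (pvar v) = b v"
  by (simp add: pvar_def)

lemma pconst_simps: "pconst 0 = 0" "pconst 1 = 1" "pconst (a + b) = pconst a + pconst b"
  "pconst (a * b) = pconst a * pconst b" "pconst (- a) = - pconst a"
  by (simp_all add: pconst_def single_add mult_single single_uminus)

text \<open>The polynomial subalgebra on the indeterminates in V, presented by generators so that
  facts about evaluations follow by rule induction.\<close>

inductive_set AV :: "'n mvar set \<Rightarrow> 'n Mpoly set" for V where
  AV_const: "pconst c \<in> AV V"
| AV_var: "v \<in> V \<Longrightarrow> pvar v \<in> AV V"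
| AV_add: "p \<in> AV V \<Longrightarrow> q \<in> AV V \<Longrightarrow> p + q \<in> AV V"
| AV_mult: "p \<in> AV V \<Longrightarrow> q \<in> AV V \<Longrightarrow> p * q \<in> AV V"

lemma subrng_AV: "subrng (AV V)"
proof -
  have "x - y \<in> AV V" if xy: "x \<in> AV V" "y \<in> AV V" for x y
  proof -
    have "x - y = x + pconst (-1) * y" by (simp add: pconst_simps)
    then show ?thesis using xy AV.intros by metis
  qed
  then show ?thesis unfolding subrng_def using AV_const[of 1 V] AV_mult by (auto simp: pconst_simps)
qed

lemmas AV_closed = subrngD[OF subrng_AV]

lemma AV_prod: "(\<And>i. i \<in> I \<Longrightarrow> f i \<in> AV V) \<Longrightarrow> prod f I \<in> AV V"
  by (induction I rule: infinite_finite_induct) (auto intro: AV_closed)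

lemma AV_mono: "p \<in> AV V \<Longrightarrow> V \<subseteq> W \<Longrightarrow> p \<in> AV W"
  by (induction rule: AV.induct) (auto intro: AV.intros)

lemma ev_AV_cong:
  assumes "p \<in> AV V" "\<And>v. v \<in> V \<Longrightarrow> b v = b' v"
  shows "ev b p = ev b' p"
  using assms by induction (simp_all add: ev_add ev_mult)

lemma single_eq_mev: "Poly_Mapping.single m (1::real) = mev pvar m"
proof -
  have k: "Poly_Mapping.single (Poly_Mapping.single v k) (1::real) = pvar v ^ k" for v :: "'a mvar" and k
  proof (induction k)
    case (Suc k)
    have "Poly_Mapping.single (Poly_Mapping.single v (Suc k)) (1::real) =
        pvar v * Poly_Mapping.single (Poly_Mapping.single v k) 1"
      by (simp add: pvar_def mult_single flip: single_add)
    then show ?case by (simp add: Suc)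
  qed simp
  have "Poly_Mapping.single (\<Sum>v\<in>I. Poly_Mapping.single v (f v)) (1::real) = (\<Prod>v\<in>I. pvar v ^ f v)"
    for I :: "'a mvar set" and f
  proof -
    have "Poly_Mapping.single (m + n) (1::real) = Poly_Mapping.single m 1 * Poly_Mapping.single n 1"
      for m n :: "'a mvar \<Rightarrow>\<^sub>0 nat" by (simp add: mult_single)
    then show ?thesis by (induction I rule: infinite_finite_induct) (simp_all add: k)
  qed
  then show ?thesis unfolding mev_def by (metis poly_mapping_sum_singles)
qed

lemma single_eq_pconst_mev: "Poly_Mapping.single m c = pconst c * mev pvar m"
  by (simp flip: single_eq_mev add: pconst_def mult_single)

lemma in_AV_vars: "p \<in> AV (\<Union>m\<in>Poly_Mapping.keys p. Poly_Mapping.keys m)"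
proof -
  have "Poly_Mapping.single m c \<in> AV (Poly_Mapping.keys m)" for m and c :: real
    unfolding single_eq_pconst_mev mev_def
    by (intro AV_mult AV_const AV_prod subrng_power[OF subrng_AV] AV_var)
  then have "(\<Sum>m\<in>Poly_Mapping.keys p. Poly_Mapping.single m (Poly_Mapping.lookup p m))
      \<in> AV (\<Union>m\<in>Poly_Mapping.keys p. Poly_Mapping.keys m)"
    by (intro subrng_sum[OF subrng_AV]) (rule AV_mono, auto)
  then show ?thesis by (metis poly_mapping_sum_singles)
qed

lemma in_some_AV: "\<exists>V. finite V \<and> p \<in> AV V"
  using in_AV_vars[of p] by (intro exI[of _ "\<Union>m\<in>Poly_Mapping.keys p. Poly_Mapping.keys m"]) auto

lemma in_AV_UNIV: "p \<in> AV UNIV"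
  using in_AV_vars AV_mono by blast

lemma rhom_poly: "rhom h \<Longrightarrow> h (poly P x) = peval h (h x) P"
  by (induction P) (simp_all add: peval_pCons rhom_0 rhom_add rhom_mult, simp add: peval_def)

text \<open>Splits off one indeterminate, which turns multivariate sign conditions into univariate
  ones over the smaller algebra.\<close>

lemma AV_insert_poly:
  assumes "p \<in> AV (insert v V)"
  shows "\<exists>P\<in>polys (AV V). p = poly P (pvar v)"
  using assms
proof induction
  note D = subrngD[OF subrng_polys[OF subrng_AV]]
  have c: "[:q:] \<in> polys (AV V)" if "q \<in> AV V" for q :: "'a Mpoly"
    using that AV_closed(2) by (auto simp: polys_def coeff_pCons split: nat.splits)
  {
    case (AV_const r)
    show ?case by (rule bexI[of _ "[:pconst r:]"]) (auto intro: c AV.intros)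
  next
    case (AV_var w)
    show ?case
    proof (cases "w = v")
      case True
      have "[:0, 1:] \<in> polys (AV V)"
        using AV_closed(1,2) by (auto simp: polys_def coeff_pCons split: nat.splits)
      then show ?thesis using True by (intro bexI[of _ "[:0, 1:]"]) auto
    next
      case False
      then show ?thesis using AV_var by (intro bexI[of _ "[:pvar w:]"]) (auto intro: c AV.intros)
    qed
  next
    case (AV_add p q)
    then obtain P Q where "P \<in> polys (AV V)" "Q \<in> polys (AV V)" "p = poly P (pvar v)" "q = poly Q (pvar v)" by blast
    then show ?case using D(4) by (intro bexI[of _ "P + Q"]) auto
  next
    case (AV_mult p q)
    then obtain P Q where "P \<in> polys (AV V)" "Q \<in> polys (AV V)" "p = poly P (pvar v)" "q = poly Q (pvar v)" by blast
    then show ?case using D(6) by (intro bexI[of _ "P * Q"]) auto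
  }
qed

lemma ev_update_poly:
  assumes P: "P \<in> polys (AV V)" and v: "v \<notin> V"
  shows "ev (b(v := t)) (poly P (pvar v)) = poly (map_poly (ev b) P) t"
proof -
  have "ev (b(v := t)) c = ev b c" if "c \<in> AV V" for c
    by (rule ev_AV_cong[OF that]) (use v in auto)
  then have "ev (b(v := t)) (coeff P i) = ev b (coeff P i)" for i using P by (simp add: polys_def)
  then have "map_poly (ev (b(v := t))) P = map_poly (ev b) P"
    by (intro poly_eqI) (simp add: coeff_map_rhom[OF rhom_ev])
  then show ?thesis by (simp add: rhom_poly[OF rhom_ev] peval_def)
qed

text \<open>Induction on the number of indeterminates: choose a point where the leading coefficient
  survives, then a real number outside the finite root set.\<close>

lemma ev_nonzero:
  assumes "p \<noteq> 0"
  shows "\<exists>b. ev b p \<noteq> 0"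
proof -
  have "p \<in> AV V \<Longrightarrow> p \<noteq> 0 \<Longrightarrow> \<exists>b. ev b p \<noteq> 0" if "finite V" for V
    using that
  proof (induction V arbitrary: p rule: finite_induct)
    case empty
    have "\<exists>c. q = pconst c" if "q \<in> AV {}" for q :: "'a Mpoly"
      using that by induction (auto simp flip: pconst_simps)
    then obtain c where "p = pconst c" using empty by blast
    then show ?case using empty(2) by (auto simp: pconst_simps)
  next
    case (insert v V)
    obtain P where P: "P \<in> polys (AV V)" "p = poly P (pvar v)" using AV_insert_poly insert.prems(1) by blast
    have "P \<noteq> 0" using P(2) insert.prems(2) by auto
    then have "lead_coeff P \<noteq> 0" "lead_coeff P \<in> AV V" using P(1) by (auto simp: polys_def)
    then obtain b where b: "ev b (lead_coeff P) \<noteq> 0" using insert.IH by blast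
    then have "map_poly (ev b) P \<noteq> 0" by (metis coeff_0 coeff_map_rhom[OF rhom_ev])
    then obtain t where "poly (map_poly (ev b) P) t \<noteq> 0" using poly_all_0_iff_0 by blast
    then show ?case using ev_update_poly[OF P(1) insert.hyps(2), of b t] P(2) by metis
  qed
  then show ?thesis using in_some_AV assms by blast
qed

section \<open>Orderings of the polynomial ring are approximated by real points\<close>

text \<open>The Artin--Lang statement for sign conditions. Induction on the indeterminates:
  \<open>near_matched\<close> turns the conditions on Q into finitely many conditions on
  coefficients not involving v, and a matching at a point satisfying these supplies the value of
  v.\<close>

lemma ordering_approx:
  fixes \<Phi> :: "'n::finite Mpoly \<Rightarrow> 'r::rcf"
  assumes h: "rhom \<Phi>" and inj: "\<And>p. \<Phi> p = 0 \<Longrightarrow> p = 0"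
  shows "finite V \<Longrightarrow> finite Q \<Longrightarrow> Q \<subseteq> AV V \<Longrightarrow> \<exists>b. \<forall>q\<in>Q. ssame (\<Phi> q) (ev b q)"
proof (induction V arbitrary: Q rule: finite_induct)
  case empty
  \<comment> \<open>Positive real constants are squares, so \<Phi> has to respect their
    sign.\<close>
  have pos: "\<Phi> (pconst c) > 0" if "c > 0" for c
  proof -
    have "pconst c = pconst (sqrt c) * pconst (sqrt c)" using that by (simp flip: pconst_simps)
    then have "\<Phi> (pconst c) = \<Phi> (pconst (sqrt c)) * \<Phi> (pconst (sqrt c))" by (metis rhom_mult[OF h])
    moreover have "\<Phi> (pconst c) \<noteq> 0" using inj that by (metis ev_pconst ev_zero less_irrefl)
    ultimately show ?thesis by (metis not_square_less_zero linorder_neqE_linordered_idom)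
  qed
  have c: "ssame (\<Phi> (pconst c)) c" for c
  proof (cases c "0::real" rule: linorder_cases)
    case less
    then have "\<Phi> (pconst (- c)) > 0" using pos by simp
    then show ?thesis using less by (simp add: pconst_simps rhom_uminus[OF h] ssame_def)
  next
    case greater
    then show ?thesis using pos by (auto simp: ssame_def dest: order_less_imp_not_less)
  qed (simp add: pconst_simps rhom_0[OF h])
  have "\<exists>c. q = pconst c" if "q \<in> AV {}" for q :: "'n Mpoly"
    using that by induction (auto simp flip: pconst_simps)
  then have "ssame (\<Phi> q) (ev b q)" if "q \<in> Q" for q b using that empty c by force
  then show ?case by blast
next
  case (insert v V)
  have "\<forall>q\<in>Q. \<exists>P. P \<in> polys (AV V) \<and> q = poly P (pvar v)" using AV_insert_poly insert.prems(2) by blast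
  then obtain P where P: "\<And>q. q \<in> Q \<Longrightarrow> P q \<in> polys (AV V)" "\<And>q. q \<in> Q \<Longrightarrow> q = poly (P q) (pvar v)"
    by metis
  have "near \<Phi> ev (AV V) (\<lambda>b. \<exists>Z. matched ((\<lambda>p. (map_poly \<Phi> p, map_poly (ev b) p)) ` P ` Q) Z)"
    by (rule near_matched[OF subrng_AV h inj rhom_ev]) (use P(1) insert.prems in auto)
  then obtain R where R: "R \<subseteq> AV V" "finite R" "\<And>b. (\<forall>q\<in>R. ssame (\<Phi> q) (ev b q)) \<Longrightarrow>
      \<exists>Z. matched ((\<lambda>p. (map_poly \<Phi> p, map_poly (ev b) p)) ` P ` Q) Z" unfolding near_def by blast
  obtain b where "\<forall>q\<in>R. ssame (\<Phi> q) (ev b q)" using insert.IH[OF R(2,1)] by blast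
  then obtain Z where Z: "matched ((\<lambda>p. (map_poly \<Phi> p, map_poly (ev b) p)) ` P ` Q) Z" using R(3) by blast
  obtain t where t: "sim Z (\<Phi> (pvar v)) t" using sim_exists[OF matchedD(1,2)[OF Z]] by blast
  have "ssame (\<Phi> q) (ev (b(v := t)) q)" if q: "q \<in> Q" for q
  proof -
    have "\<Phi> q = poly (map_poly \<Phi> (P q)) (\<Phi> (pvar v))"
      using arg_cong[OF P(2)[OF q], of \<Phi>] by (simp add: rhom_poly[OF h] peval_def)
    moreover have "ev (b(v := t)) q = poly (map_poly (ev b) (P q)) t"
      using arg_cong[OF P(2)[OF q], of "ev (b(v := t))"] ev_update_poly[OF P(1)[OF q] insert.hyps(2)] by simp
    ultimately show ?thesis using matchedD(6)[OF Z _ t] q by auto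
  qed
  then show ?case by blast
qed


text \<open>A preordering \<open>T\<close> refutes the approximation theorem below if finitely many nonzero elements of \<open>T\<close> have no
  common point of positivity. If there is such a \<open>T\<close>, the type \<open>rc\<close> is a real closed field
  containing the polynomial ring in which all nonzero elements of one such \<open>T\<close> are positive.
  A type cannot depend on a local assumption, hence the choice of a hypothetical counterexample;
  the cone of the natural numbers only makes the definition total.\<close>

definition unrealisable :: "'n::finite Mpoly set \<Rightarrow> bool" where
  "unrealisable T \<longleftrightarrow> pcone T \<and> (\<forall>x. x\<^sup>2 \<in> T) \<and>
    (\<exists>Q. finite Q \<and> Q \<subseteq> T - {0} \<and> \<not> (\<exists>b. \<forall>q\<in>Q. 0 < ev b q))"

definition base_cone :: "'n::finite Mpoly set" where
  "base_cone = (if \<exists>T::'n Mpoly set. unrealisable T then SOME T. unrealisable T else range of_nat)"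

definition toC :: "'n::finite Mpoly \<Rightarrow> 'n Mpoly fract alg_closure" where
  "toC p = to_ac (Fract p 1)"

definition ord_cone :: "'n::finite Mpoly fract alg_closure set" where
  "ord_cone = (SOME M. {toC a / toC b |a b. a \<in> base_cone \<and> b \<in> base_cone \<and> b \<noteq> 0} \<subseteq> M \<and> max_fcone M)"

lemma pcone_of_nat: "pcone (range of_nat :: 'n::finite Mpoly set)"
proof (rule pconeI)
  fix x y :: "'n Mpoly" assume "x \<in> range of_nat" "y \<in> range of_nat"
  then obtain m n where x: "x = of_nat m" "y = of_nat n" by blast
  show "x + y \<in> range of_nat" "x * y \<in> range of_nat"
    unfolding x by (metis of_nat_add rangeI, metis of_nat_mult rangeI)
  have "(x - y)\<^sup>2 = of_int ((int m - int n)\<^sup>2)" by (simp add: x)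
  also have "\<dots> = of_nat (nat ((int m - int n)\<^sup>2))" by (simp only: of_nat_nat[OF zero_le_power2])
  finally show "(x - y)\<^sup>2 \<in> range of_nat" by (metis rangeI)
next
  fix x :: "'n Mpoly" assume "x \<in> range of_nat" "- x \<in> range of_nat"
  then obtain m n where x: "x = of_nat m" "- x = of_nat n" by blast
  have "ev b (of_nat k) = real k" for b :: "'n mvar \<Rightarrow> real" and k by (rule rhom_of_nat[OF rhom_ev])
  then have "real m = - real n" using x by (metis minus_minus rhom_uminus[OF rhom_ev])
  then show "x = 0" using x by simp
next
  show "0 \<in> range (of_nat :: nat \<Rightarrow> 'n Mpoly)" "1 \<in> range (of_nat :: nat \<Rightarrow> 'n Mpoly)"
    using rangeI[of of_nat 0] rangeI[of of_nat 1] by simp_all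
qed

lemma pcone_base_cone: "pcone (base_cone :: 'n::finite Mpoly set)"
proof (cases "\<exists>T::'n Mpoly set. unrealisable T")
  case True
  then have "unrealisable (base_cone :: 'n Mpoly set)" unfolding base_cone_def by (simp add: someI_ex)
  then show ?thesis by (simp add: unrealisable_def)
qed (simp add: base_cone_def pcone_of_nat)

lemma rhom_toC: "rhom toC"
  by (simp add: rhom_def toC_def flip: One_fract_def to_ac_add to_ac_mult)

lemma toC_eq_0: "toC p = 0 \<Longrightarrow> p = 0"
  by (simp add: toC_def Zero_fract_def eq_fract)

lemma ord_cone: "{toC a / toC b |a b. a \<in> base_cone \<and> b \<in> base_cone \<and> b \<noteq> 0} \<subseteq> ord_cone" "max_fcone ord_cone"
  using someI_ex[OF ex_max_fcone[OF fcone_fractions[OF pcone_base_cone rhom_toC toC_eq_0]]]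
  unfolding ord_cone_def by auto

lemma ord_cone_pcone: "pcone ord_cone" and ord_cone_inverse: "x \<in> ord_cone \<Longrightarrow> inverse x \<in> ord_cone"
  using ord_cone(2) by (auto simp: max_fcone_def fcone_def)

lemmas ord_coneD = pconeD[OF ord_cone_pcone]

text \<open>By \<open>max_fcone_total\<close> these are exactly the differences of cone elements,
  hence a subfield of the algebraic closure.\<close>

definition ord_field :: "'n::finite Mpoly fract alg_closure set" where
  "ord_field = {x. x \<in> ord_cone \<or> - x \<in> ord_cone}"

lemma ord_field_diff_cone:
  assumes "x \<in> ord_cone" "y \<in> ord_cone"
  shows "x - y \<in> ord_field"
  using max_fcone_total[OF ord_cone(2) assms] by (auto simp: ord_field_def)

lemma ord_fieldE:
  assumes "x \<in> ord_field"
  obtains a b where "a \<in> ord_cone" "b \<in> ord_cone" "x = a - b"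
proof (cases "x \<in> ord_cone")
  case True
  then show ?thesis using that[of x 0] ord_coneD(1) by simp
next
  case False
  then show ?thesis using that[of 0 "- x"] ord_coneD(1) assms by (auto simp: ord_field_def)
qed

lemma ord_field_closed:
  "0 \<in> ord_field" "1 \<in> ord_field"
  "x \<in> ord_field \<Longrightarrow> - x \<in> ord_field"
  "x \<in> ord_field \<Longrightarrow> y \<in> ord_field \<Longrightarrow> x + y \<in> ord_field"
  "x \<in> ord_field \<Longrightarrow> y \<in> ord_field \<Longrightarrow> x - y \<in> ord_field"
  "x \<in> ord_field \<Longrightarrow> y \<in> ord_field \<Longrightarrow> x * y \<in> ord_field"
  "x \<in> ord_field \<Longrightarrow> inverse x \<in> ord_field"
proof -
  show "0 \<in> ord_field" "1 \<in> ord_field" using ord_coneD(1,2) by (auto simp: ord_field_def)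
  show m: "- x \<in> ord_field" if "x \<in> ord_field" for x using that by (auto simp: ord_field_def)
  show a: "x + y \<in> ord_field" if xy: "x \<in> ord_field" "y \<in> ord_field" for x y
  proof -
    obtain a b where x: "a \<in> ord_cone" "b \<in> ord_cone" "x = a - b" using ord_fieldE[OF xy(1)] .
    obtain c d where y: "c \<in> ord_cone" "d \<in> ord_cone" "y = c - d" using ord_fieldE[OF xy(2)] .
    have "x + y = (a + c) - (b + d)" by (simp add: x y)
    then show ?thesis using ord_field_diff_cone ord_coneD(3) x y by metis
  qed
  show "x - y \<in> ord_field" if "x \<in> ord_field" "y \<in> ord_field" for x y
    using a[OF that(1) m[OF that(2)]] by simp
  show "x * y \<in> ord_field" if "x \<in> ord_field" "y \<in> ord_field"
    using that ord_coneD(4)[of x y] ord_coneD(4)[of "- x" y] ord_coneD(4)[of x "- y"] ord_coneD(4)[of "- x" "- y"]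
    by (auto simp: ord_field_def)
  show "inverse x \<in> ord_field" if "x \<in> ord_field"
    using that ord_cone_inverse[of x] ord_cone_inverse[of "- x"]
    by (auto simp: ord_field_def inverse_minus_eq)
qed

typedef (overloaded) ('n::finite) rc = "ord_field :: 'n Mpoly fract alg_closure set"
  using ord_field_closed(1) by blast

instantiation rc :: (finite) "{zero, one, plus, minus, times, uminus, inverse, ord, abs, sgn}"
begin

definition "0 = (Abs_rc 0 :: 'a rc)"
definition "1 = (Abs_rc 1 :: 'a rc)"
definition "(x :: 'a rc) + y = Abs_rc (Rep_rc x + Rep_rc y)"
definition "(x :: 'a rc) - y = Abs_rc (Rep_rc x - Rep_rc y)"
definition "(x :: 'a rc) * y = Abs_rc (Rep_rc x * Rep_rc y)"
definition "- (x :: 'a rc) = Abs_rc (- Rep_rc x)"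
definition "inverse (x :: 'a rc) = Abs_rc (inverse (Rep_rc x))"
definition "(x :: 'a rc) div y = Abs_rc (Rep_rc x * inverse (Rep_rc y))"
definition "(x :: 'a rc) \<le> y \<longleftrightarrow> Rep_rc y - Rep_rc x \<in> ord_cone"
definition "(x :: 'a rc) < y \<longleftrightarrow> Rep_rc y - Rep_rc x \<in> ord_cone \<and> x \<noteq> y"
definition "\<bar>x :: 'a rc\<bar> = (if Rep_rc x \<in> ord_cone then x else Abs_rc (- Rep_rc x))"
definition "sgn (x :: 'a rc) = Abs_rc (if Rep_rc x = 0 then 0 else if Rep_rc x \<in> ord_cone then 1 else - 1)"

instance ..

end

lemma Rep_rc_simps:
  "Rep_rc (0 :: 'a::finite rc) = 0" "Rep_rc (1 :: 'a rc) = 1"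
  "Rep_rc (x + y :: 'a rc) = Rep_rc x + Rep_rc y" "Rep_rc (x - y) = Rep_rc x - Rep_rc y"
  "Rep_rc (x * y) = Rep_rc x * Rep_rc y" "Rep_rc (- x) = - Rep_rc x"
  "Rep_rc (inverse x) = inverse (Rep_rc x)"
  unfolding zero_rc_def one_rc_def plus_rc_def minus_rc_def times_rc_def uminus_rc_def inverse_rc_def
  by (simp_all add: Abs_rc_inverse Rep_rc ord_field_closed)

instance rc :: (finite) linordered_field
proof
  fix x y z :: "'a rc"
  note [simp] = Rep_rc_simps Rep_rc_inject[symmetric]
  show "x + y + z = x + (y + z)" by (simp add: add.assoc)
  show "x + y = y + x" by (simp add: add.commute)
  show "0 + x = x" by simp
  show "- x + x = 0" by simp
  show "x - y = x + - y" by simp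
  show "x + y - x = y" "x - y - z = x - (y + z)" "0 * x = 0" "x * 0 = 0" by (simp_all add: diff_diff_eq)
  show "x * y * z = x * (y * z)" by (simp add: mult.assoc)
  show "x * y = y * x" by (simp add: mult.commute)
  show "1 * x = x" by simp
  show "(x + y) * z = x * z + y * z" by (simp add: distrib_right)
  show "(0 :: 'a rc) \<noteq> 1" by simp
  show "inverse (0 :: 'a rc) = 0" by simp
  show "x / y = x * inverse y"
    using ord_field_closed(6)[OF Rep_rc[of x] ord_field_closed(7)[OF Rep_rc[of y]]]
    by (simp add: divide_rc_def Abs_rc_inverse)
  show "inverse x * x = 1" if "x \<noteq> 0" using that by simp
  show le_refl: "x \<le> x" by (simp add: less_eq_rc_def ord_coneD(1))
  show tr: "x \<le> z" if "x \<le> y" "y \<le> z"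
    using that ord_coneD(3)[of "Rep_rc y - Rep_rc x" "Rep_rc z - Rep_rc y"] by (simp add: less_eq_rc_def)
  show as: "x = y" if "x \<le> y" "y \<le> x"
    using that ord_coneD(6)[of "Rep_rc y - Rep_rc x"] by (simp add: less_eq_rc_def)
  show "x \<le> y \<or> y \<le> x"
    using ord_field_closed(5)[OF Rep_rc Rep_rc, of y x] by (auto simp: less_eq_rc_def ord_field_def)
  show "x < y \<longleftrightarrow> x \<le> y \<and> \<not> y \<le> x" using as le_refl unfolding less_rc_def less_eq_rc_def by blast
  show "z + x \<le> z + y" if "x \<le> y" using that by (simp add: less_eq_rc_def)
  have n: "Rep_rc x \<notin> ord_cone \<longleftrightarrow> - Rep_rc x \<in> ord_cone \<and> Rep_rc x \<noteq> 0"
    using Rep_rc[of x] ord_coneD(6)[of "Rep_rc x"] ord_coneD(1) by (auto simp: ord_field_def)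
  show "\<bar>x\<bar> = (if x < 0 then - x else x)"
    by (simp add: abs_rc_def less_rc_def uminus_rc_def flip: n)
  show "sgn x = (if x = 0 then 0 else if 0 < x then 1 else - 1)"
    by (simp add: sgn_rc_def less_rc_def zero_rc_def[symmetric] one_rc_def[symmetric] Abs_rc_inverse ord_field_closed)
  show "z * x < z * y" if "x < y" "0 < z"
    using that ord_coneD(4)[of "Rep_rc z" "Rep_rc y - Rep_rc x"]
    by (simp add: less_rc_def less_eq_rc_def right_diff_distrib)
qed

lemma rhom_Rep_rc: "rhom Rep_rc"
  by (simp add: rhom_def Rep_rc_simps)

text \<open>Puts the maximal cone into the form that \<open>ivt_of_max_fcone\<close> expects, with
  \<open>Rep_rc\<close> as the embedding.\<close>

lemma Rep_rc_nonneg: "Rep_rc ` {0..} = (ord_cone :: 'a::finite Mpoly fract alg_closure set)"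
proof -
  have "x \<in> Rep_rc ` {0..}" if x: "x \<in> ord_cone" for x :: "'a Mpoly fract alg_closure"
  proof -
    have "Rep_rc (Abs_rc x) = x" using x by (intro Abs_rc_inverse) (simp add: ord_field_def)
    then show ?thesis
      using x by (intro image_eqI[of _ _ "Abs_rc x"]) (simp_all add: less_eq_rc_def Rep_rc_simps)
  qed
  moreover have "x \<in> ord_cone" if "x \<in> Rep_rc ` {0..}" for x :: "'a Mpoly fract alg_closure"
    using that by (auto simp: less_eq_rc_def Rep_rc_simps)
  ultimately show ?thesis by blast
qed

lemma poly_ivt_rc:
  fixes a b :: "'a::finite rc"
  assumes "a < b" "(\<Sum>k\<le>n. f k * a ^ k) * (\<Sum>k\<le>n. f k * b ^ k) < 0"
  shows "\<exists>x>a. x < b \<and> (\<Sum>k\<le>n. f k * x ^ k) = 0"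
proof -
  define p where "p = (\<Sum>k\<le>n. monom (f k) k)"
  have p: "poly p x = (\<Sum>k\<le>n. f k * x ^ k)" for x by (simp add: p_def poly_sum poly_monom)
  have "max_fcone (Rep_rc ` {0 :: 'a rc..})" by (simp only: Rep_rc_nonneg ord_cone(2))
  then show ?thesis using ivt_of_max_fcone[OF rhom_Rep_rc _ assms(1), of p] assms(2) unfolding p by blast
qed

instance rc :: (finite) rcf
  by standard (rule poly_ivt_rc)

text \<open>If T were a counterexample, \<open>base_cone\<close> would be one too, possibly a
  different one. The contradiction is therefore derived for \<open>base_cone\<close> and its own
  finite set R, not for T and Q.\<close>

lemma preordering_real_point:
  fixes T :: "'n::finite Mpoly set"
  assumes T: "pcone T" "\<And>x. x\<^sup>2 \<in> T" and Q: "finite Q" "Q \<subseteq> T" "0 \<notin> Q"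
  shows "\<exists>b. \<forall>q\<in>Q. 0 < ev b q"
proof (rule ccontr)
  assume "\<not> ?thesis"
  then have "unrealisable T" using T Q unfolding unrealisable_def by blast
  then have "unrealisable (base_cone :: 'n Mpoly set)" unfolding base_cone_def by (auto simp: someI_ex)
  then obtain R :: "'n Mpoly set" where C: "\<And>x :: 'n Mpoly. x\<^sup>2 \<in> base_cone"
    and R: "finite R" "R \<subseteq> base_cone - {0}" "\<not> (\<exists>b. \<forall>q\<in>R. 0 < ev b q)" unfolding unrealisable_def by blast
  note D = pconeD[OF pcone_base_cone]
  have cone: "toC a \<in> ord_cone" if "a \<in> base_cone" for a :: "'n Mpoly"
  proof -
    have "toC a / toC 1 \<in> ord_cone" using ord_cone(1) that D(2) by force
    then show ?thesis by (simp add: rhom_1[OF rhom_toC])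
  qed
  \<comment> \<open>Each a equals ((a+1)/2)^2 - ((a-1)/2)^2; here q is the constant 1/4, itself a
    square.\<close>
  have fld: "toC a \<in> ord_field" for a :: "'n Mpoly"
  proof -
    define q :: "'n Mpoly" where "q = pconst (1 / 4)"
    have q: "q * 4 = 1"
    proof -
      have "pconst (1 / 4) * pconst 4 = (1 :: 'n Mpoly)" by (simp flip: pconst_simps)
      moreover have "pconst 4 = (4 :: 'n Mpoly)" by (simp add: pconst_def)
      ultimately show ?thesis by (simp add: q_def)
    qed
    have "q = (pconst (1 / 2))\<^sup>2" by (simp add: q_def power2_eq_square flip: pconst_simps)
    then have qc: "q \<in> base_cone" using C by metis
    have "a = (q * 4) * a" by (simp add: q)
    also have "\<dots> = q * (a + 1)\<^sup>2 - q * (a - 1)\<^sup>2" by (simp add: power2_eq_square algebra_simps)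
    finally have "toC a = toC (q * (a + 1)\<^sup>2) - toC (q * (a - 1)\<^sup>2)" by (metis rhom_diff[OF rhom_toC])
    then show ?thesis using ord_field_diff_cone cone D(4) qc C by metis
  qed
  define \<Phi> where "\<Phi> p = Abs_rc (toC p)" for p :: "'n Mpoly"
  have rep: "Rep_rc (\<Phi> p) = toC p" for p unfolding \<Phi>_def by (rule Abs_rc_inverse[OF fld])
  have h: "rhom \<Phi>" unfolding rhom_def
    by (simp add: Rep_rc_inject[symmetric] rep Rep_rc_simps rhom_simps[OF rhom_toC])
  have inj: "\<Phi> p = 0 \<Longrightarrow> p = 0" for p using rep[of p] by (simp add: Rep_rc_simps toC_eq_0)
  have "\<exists>V. finite V \<and> q \<in> AV V" for q :: "'n Mpoly" by (rule in_some_AV)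
  then obtain V where V: "\<And>q :: 'n Mpoly. finite (V q)" "\<And>q :: 'n Mpoly. q \<in> AV (V q)" by metis
  have "R \<subseteq> AV (\<Union>q\<in>R. V q)" using V(2) AV_mono by blast
  then obtain b where b: "\<And>q. q \<in> R \<Longrightarrow> ssame (\<Phi> q) (ev b q)"
    using ordering_approx[OF h inj, of "\<Union>q\<in>R. V q" R] R(1) V(1) by auto
  have "0 < ev b q" if q: "q \<in> R" for q
  proof -
    have "\<Phi> q \<noteq> 0" using inj q R(2) by blast
    moreover have "0 \<le> \<Phi> q" using cone q R(2) by (auto simp: less_eq_rc_def Rep_rc_simps rep)
    ultimately show ?thesis using b[OF q] by (auto simp: ssame_def)
  qed
  then show False using R(3) by blast
qed

section \<open>A monomial order of type \<open>\<omega>\<close>\<close>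

definition nth_prime :: "'n::finite \<Rightarrow> nat" where
  "nth_prime i = enumerate {p::nat. prime p} (to_nat i)"

lemma prime_nth_prime: "prime (nth_prime i)"
  using enumerate_in_set[OF primes_infinite, of "to_nat i"] by (simp add: nth_prime_def)

lemma inj_nth_prime: "inj nth_prime"
proof -
  have "inj (enumerate {p::nat. prime p})"
    using strict_mono_enumerate[OF primes_infinite] by (rule strict_mono_imp_inj_on)
  then have "inj (enumerate {p::nat. prime p} \<circ> (to_nat :: 'a \<Rightarrow> nat))" by (intro inj_compose inj_to_nat)
  moreover have "enumerate {p::nat. prime p} \<circ> (to_nat :: 'a \<Rightarrow> nat) = nth_prime"
    by (auto simp: nth_prime_def)
  ultimately show ?thesis by simp
qed

text \<open>Multi-indices are compared through the integers \<open>\<Prod>p\<^sub>i\<^bsup>\<alpha> i\<^esup>\<close>; this order is total, compatible with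
  addition, and every multi-index has only finitely many predecessors.\<close>

definition wt :: "('n::finite \<Rightarrow> nat) \<Rightarrow> nat" where
  "wt \<alpha> = (\<Prod>i\<in>UNIV. nth_prime i ^ \<alpha> i)"

definition madd :: "('n \<Rightarrow> nat) \<Rightarrow> ('n \<Rightarrow> nat) \<Rightarrow> 'n \<Rightarrow> nat" where
  "madd \<alpha> \<beta> = (\<lambda>i. \<alpha> i + \<beta> i)"

lemma wt_madd: "wt (madd \<alpha> \<beta>) = wt \<alpha> * wt \<beta>"
  by (simp add: wt_def madd_def power_add prod.distrib)

lemma wt_pos: "wt \<alpha> > 0"
  unfolding wt_def by (intro prod_pos) (simp add: prime_gt_0_nat[OF prime_nth_prime])

lemma wt_zero: "wt (\<lambda>_. 0) = 1"
  by (simp add: wt_def)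

text \<open>Unique factorisation: the multiplicity of the i-th prime recovers the i-th
  exponent.\<close>

lemma inj_wt: "inj wt"
proof (rule injI)
  have m: "multiplicity (nth_prime i) (wt \<alpha>) = \<alpha> i" for \<alpha> :: "'a \<Rightarrow> nat" and i
  proof -
    have "wt \<alpha> = (\<Prod>p\<in>range (nth_prime :: 'a \<Rightarrow> nat). p ^ \<alpha> (inv_into UNIV nth_prime p))"
      unfolding wt_def by (subst prod.reindex[OF inj_nth_prime]) (simp add: inv_f_f[OF inj_nth_prime])
    moreover have "multiplicity (nth_prime i) (\<Prod>p\<in>range (nth_prime :: 'a \<Rightarrow> nat). p ^ \<alpha> (inv_into UNIV nth_prime p)) =
        (if nth_prime i \<in> range (nth_prime :: 'a \<Rightarrow> nat) then \<alpha> (inv_into UNIV nth_prime (nth_prime i)) else 0)"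
      by (rule multiplicity_prod_prime_powers) (auto simp: prime_nth_prime)
    ultimately show ?thesis by (simp add: inv_f_f[OF inj_nth_prime])
  qed
  show "\<alpha> = \<beta>" if "wt \<alpha> = wt \<beta>" for \<alpha> \<beta> :: "'a \<Rightarrow> nat"
    using m[of _ \<alpha>] m[of _ \<beta>] that by (intro ext) metis
qed

lemma wt_eq_1: "wt \<alpha> = 1 \<longleftrightarrow> \<alpha> = (\<lambda>_. 0)"
  using injD[OF inj_wt] wt_zero by metis

lemma finite_wt_less: "finite {\<alpha>. wt \<alpha> < k}"
  by (rule finite_imageD[of wt]) (auto intro: finite_subset[of _ "{..<k}"] inj_on_subset[OF inj_wt])

section \<open>The moment map\<close>

definition mexp :: "('n::finite \<Rightarrow> nat) \<Rightarrow> 'n mvar \<Rightarrow>\<^sub>0 nat" where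
  "mexp \<alpha> = (\<Sum>i\<in>UNIV. Poly_Mapping.single (XV i) (\<alpha> i))"

definition xmon :: "('n::finite \<Rightarrow> nat) \<Rightarrow> 'n Mpoly" where
  "xmon \<alpha> = Poly_Mapping.single (mexp \<alpha>) 1"

definition xpart :: "('n mvar \<Rightarrow>\<^sub>0 nat) \<Rightarrow> 'n \<Rightarrow> nat" where
  "xpart m = (\<lambda>i. Poly_Mapping.lookup m (XV i))"

lemma xmon_madd: "xmon (madd \<alpha> \<beta>) = xmon \<alpha> * xmon \<beta>"
  by (simp add: xmon_def mexp_def madd_def mult_single single_add sum.distrib)

lemma xmon_zero: "xmon (\<lambda>_. 0) = 1"
  by (simp add: xmon_def mexp_def)

lemma xpart_mexp: "xpart (mexp \<alpha>) = \<alpha>"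
  by (auto simp: xpart_def mexp_def lookup_sum lookup_single when_def fun_eq_iff)

lemma pvar_XV: "pvar (XV i) = xmon (\<lambda>j. if j = i then 1 else 0)"
proof -
  have "mexp (\<lambda>j. if j = i then 1 else 0) = (\<Sum>j\<in>UNIV. if j = i then Poly_Mapping.single (XV j) 1 else 0)"
    unfolding mexp_def by (rule sum.cong) auto
  then show ?thesis by (simp add: xmon_def pvar_def)
qed

text \<open>Sending each x_i to 1 makes the moment part a monomial evaluation, hence multiplicative
  by \<open>mev_add\<close>.\<close>

lemma mpart_eq_mev: "mpart m = mev (\<lambda>v. if is_M_var v then pvar v else 1) m"
proof -
  have "mev (\<lambda>v. if is_M_var v then pvar v else 1) m =
      (\<Prod>v\<in>Poly_Mapping.keys m. if is_M_var v then pvar v ^ Poly_Mapping.lookup m v else 1)"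
    unfolding mev_def by (rule prod.cong) auto
  also have "\<dots> = mpart m" unfolding mpart_def by (rule prod.inter_filter[symmetric]) simp
  finally show ?thesis by simp
qed

lemma mpart_mexp: "mpart (mexp \<alpha>) = 1"
proof -
  have "mev g (\<Sum>i\<in>I. Poly_Mapping.single (XV i) (\<alpha> i)) = 1" if "\<And>i. g (XV i) = 1"
    for g :: "'a mvar \<Rightarrow> 'a Mpoly" and I
    by (induction I rule: infinite_finite_induct) (simp_all add: mev_add that)
  then show ?thesis unfolding mpart_eq_mev mexp_def by (simp add: is_M_var_def)
qed

lemma mlin_alt: "mlin p = (\<Sum>m\<in>Poly_Mapping.keys p. pconst (Poly_Mapping.lookup p m) * (mpart m * mgen (xpart m)))"
  by (simp add: mlin_def xpart_def mult.assoc)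

lemma mlin_add: "mlin (p + q) = mlin p + mlin q"
  unfolding mlin_alt using sum_keys_add[of "\<lambda>m c. pconst c * (mpart m * mgen (xpart m))"]
  by (simp add: pconst_simps algebra_simps)

lemma mlin_0 [simp]: "mlin 0 = 0"
  by (simp add: mlin_alt)

lemma mlin_single: "mlin (Poly_Mapping.single m c) = pconst c * (mpart m * mgen (xpart m))"
  by (cases "c = 0") (simp_all add: mlin_alt pconst_simps)

lemma mlin_pconst_mult: "mlin (pconst c * p) = pconst c * mlin p"
proof (rule additive_ext[of "\<lambda>p. mlin (pconst c * p)"])
  fix m :: "'a mvar \<Rightarrow>\<^sub>0 nat" and d :: real
  have "pconst c * Poly_Mapping.single m d = Poly_Mapping.single m (c * d)" by (simp add: pconst_def mult_single)
  then show "mlin (pconst c * Poly_Mapping.single m d) = pconst c * mlin (Poly_Mapping.single m d)"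
    by (simp add: mlin_single pconst_simps mult.assoc)
qed (simp_all add: mlin_add distrib_left)

lemma mlin_MV_mult: "mlin (pvar (MV a) * p) = pvar (MV a) * mlin p"
proof (rule additive_ext[of "\<lambda>p. mlin (pvar (MV a) * p)"])
  fix m :: "'a mvar \<Rightarrow>\<^sub>0 nat" and c :: real
  have "xpart (Poly_Mapping.single (MV a) 1 + m) = xpart m"
    by (simp add: xpart_def lookup_add lookup_single)
  moreover have "mpart (Poly_Mapping.single (MV a) 1 + m) = pvar (MV a) * mpart m"
    by (simp add: mpart_eq_mev mev_add is_M_var_def)
  moreover have "pvar (MV a) * Poly_Mapping.single m c = Poly_Mapping.single (Poly_Mapping.single (MV a) 1 + m) c"
    by (simp add: pvar_def mult_single)
  ultimately show "mlin (pvar (MV a) * Poly_Mapping.single m c) = pvar (MV a) * mlin (Poly_Mapping.single m c)"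
    by (simp add: mlin_single ac_simps)
qed (simp_all add: mlin_add distrib_left)

lemma mlin_M_mult:
  assumes "C \<in> AV (range MV)"
  shows "mlin (C * p) = C * mlin p"
  using assms
proof (induction arbitrary: p)
  case (AV_var v)
  then show ?case using mlin_MV_mult by blast
next
  case (AV_add C D)
  then show ?case by (simp add: distrib_right mlin_add)
next
  case (AV_mult C D)
  then show ?case by (simp add: mult.assoc)
qed (simp add: mlin_pconst_mult)

lemma mlin_xmon: "mlin (xmon \<alpha>) = mgen \<alpha>"
  by (simp add: xmon_def mlin_single mpart_mexp xpart_mexp pconst_simps)

lemma mlin_uminus: "mlin (- p) = - mlin p"
  using mlin_pconst_mult[of "-1" p] by (simp add: pconst_simps)

lemma mlin_diff: "mlin (p - q) = mlin p - mlin q"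
  using mlin_add[of p "- q"] by (simp add: mlin_uminus)

lemma mlin_sum: "mlin (sum f I) = (\<Sum>i\<in>I. mlin (f i))"
  by (induction I rule: infinite_finite_induct) (simp_all add: mlin_add)

text \<open>Records which moments a Gram--Schmidt quantity can depend on. The weight
  \<open>wt\<close> of the index serves as the level of truncation, and no x_i is allowed.\<close>

definition Mless :: "nat \<Rightarrow> 'n::finite Mpoly set" where
  "Mless k = AV {MV g |g. wt (Rep_nzidx g) < k}"

lemma Mless_mono: "p \<in> Mless k \<Longrightarrow> k \<le> l \<Longrightarrow> p \<in> Mless l"
  unfolding Mless_def by (erule AV_mono) auto

lemma Mless_M: "p \<in> Mless k \<Longrightarrow> p \<in> AV (range MV)"
  unfolding Mless_def by (erule AV_mono) auto

lemma mgen_Mless: "wt \<alpha> < k \<Longrightarrow> mgen \<alpha> \<in> Mless k"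
  unfolding mgen_def Mless_def
  by (auto intro!: AV_var AV_closed(1) simp: Abs_nzidx_inverse)

inductive_set lspan :: "'a::comm_ring_1 set \<Rightarrow> 'a set \<Rightarrow> 'a set" for B G where
  lspan_0: "0 \<in> lspan B G"
| lspan_add: "s \<in> lspan B G \<Longrightarrow> c \<in> B \<Longrightarrow> g \<in> G \<Longrightarrow> s + c * g \<in> lspan B G"

lemma lspan_plus: 
  assumes "s \<in> lspan B G" "t \<in> lspan B G"
  shows "s + t \<in> lspan B G"
  using assms(2)
proof induction
  case (lspan_add t c g)
  then show ?case using lspan.lspan_add[of "s + t" B G c g] by (simp add: add.assoc)
qed (simp add: assms(1))

lemma lspan_scale:
  assumes "s \<in> lspan B G" "subrng B" "c \<in> B"
  shows "c * s \<in> lspan B G"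
  using assms(1)
proof induction
  case (lspan_add s d g)
  have "c * (s + d * g) = c * s + (c * d) * g" by (simp add: algebra_simps)
  then show ?case using lspan.lspan_add[OF lspan_add.IH subrngD(6)[OF assms(2,3) lspan_add.hyps(2)] lspan_add.hyps(3)] by simp
qed (simp add: lspan_0)

lemma lspan_gen: "subrng B \<Longrightarrow> g \<in> G \<Longrightarrow> g \<in> lspan B G"
  using lspan_add[OF lspan_0, of 1 B g G] subrngD(1) by auto

lemma lspan_mono: "s \<in> lspan B G \<Longrightarrow> B \<subseteq> C \<Longrightarrow> G \<subseteq> H \<Longrightarrow> s \<in> lspan C H"
  by (induction rule: lspan.induct) (auto intro: lspan.intros)

lemma lspan_sum: "(\<And>i. i \<in> I \<Longrightarrow> f i \<in> lspan B G) \<Longrightarrow> sum f I \<in> lspan B G"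
  by (induction I rule: infinite_finite_induct) (auto intro: lspan_0 lspan_plus)

lemma lspan_finite_sum:
  assumes "s \<in> lspan B (range g)" "subrng B"
  shows "\<exists>S a. finite S \<and> (\<forall>w. a w \<in> B) \<and> s = (\<Sum>w\<in>S. a w * g w)"
  using assms(1)
proof induction
  case lspan_0
  then show ?case using subrngD(2)[OF assms(2)] by (intro exI[of _ "{}"] exI[of _ "\<lambda>_. 0"]) auto
next
  case (lspan_add s c h)
  then obtain S a v where S: "finite S" "\<And>w. a w \<in> B" "s = (\<Sum>w\<in>S. a w * g w)" "h = g v" by blast
  \<comment> \<open>The new generator may have an index v already in S; its coefficient is then
    added to the old one.\<close>
  define a' where "a' w = (if w \<in> S then a w else 0) + (if w = v then c else 0)" for w
  have "(\<Sum>w\<in>insert v S. a' w * g w) =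
      (\<Sum>w\<in>insert v S. (if w \<in> S then a w * g w else 0)) + (\<Sum>w\<in>insert v S. (if w = v then c * g w else 0))"
    unfolding a'_def sum.distrib[symmetric] by (rule sum.cong) (auto simp: distrib_right)
  also have "(\<Sum>w\<in>insert v S. (if w \<in> S then a w * g w else 0)) = s"
    unfolding S(3) using S(1) by (intro sum.mono_neutral_cong_right) auto
  also have "(\<Sum>w\<in>insert v S. (if w = v then c * g w else 0)) = c * h" using S(1,4) by simp
  finally have "s + c * h = (\<Sum>w\<in>insert v S. a' w * g w)" by simp
  moreover have "a' w \<in> B" for w using S(2) lspan_add.hyps(2) subrngD(2,4)[OF assms(2)] by (auto simp: a'_def)
  ultimately show ?case using S(1) by blast
qed

lemma in_lspan_xmon: "p \<in> lspan (AV (range MV)) (range xmon)"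
proof -
  let ?L = "lspan (AV (range MV)) (range xmon)"
  note sM = subrng_AV[of "range MV"]
  have one: "c \<in> ?L" if "c \<in> AV (range MV)" for c :: "'a Mpoly"
  proof -
    have "c * xmon (\<lambda>_. 0) \<in> ?L" by (intro lspan_scale lspan_gen sM that rangeI)
    then show ?thesis by (simp add: xmon_zero)
  qed
  have xm: "s * xmon \<alpha> \<in> ?L" if "s \<in> ?L" for s :: "'a Mpoly" and \<alpha>
    using that
  proof induction
    case (lspan_add s c g)
    then obtain \<beta> where "g = xmon \<beta>" by blast
    then have "(s + c * g) * xmon \<alpha> = s * xmon \<alpha> + c * xmon (madd \<beta> \<alpha>)"
      by (simp add: algebra_simps xmon_madd)
    then show ?case using lspan_plus[OF lspan_add.IH lspan_scale[OF lspan_gen[OF sM rangeI] sM lspan_add.hyps(2)]] by simp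
  qed (simp add: lspan_0)
  have mul: "s * t \<in> ?L" if s: "s \<in> ?L" and "t \<in> ?L" for s t :: "'a Mpoly"
    using that(2)
  proof induction
    case (lspan_add t c g)
    then obtain \<beta> where "g = xmon \<beta>" by blast
    then have "s * (t + c * g) = s * t + c * (s * xmon \<beta>)" by (simp add: algebra_simps)
    then show ?case using lspan_plus[OF lspan_add.IH lspan_scale[OF xm[OF s] sM lspan_add.hyps(2)]] by simp
  qed (simp add: lspan_0)
  show ?thesis using in_AV_UNIV[of p]
  proof induction
    case (AV_var v)
    show ?case
    proof (cases v)
      case (XV i)
      then show ?thesis using lspan_gen[OF sM rangeI] by (simp add: pvar_XV)
    next
      case (MV a)
      then show ?thesis using one[OF AV.AV_var[of v "range MV"]] by simp
    qed
  qed (auto intro: one AV_const lspan_plus mul)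
qed

section \<open>Gram--Schmidt for the generic moment functional\<close>

text \<open>The denominators of the Gram--Schmidt process, the norms \<open>m(G\<^sub>u\<^sup>2)\<close> of the previous polynomials, are cleared.\<close>

function gram :: "('n::finite \<Rightarrow> nat) \<Rightarrow> 'n Mpoly" where
  "gram w = (\<Prod>u\<in>{u. wt u < wt w}. mlin ((gram u)\<^sup>2)) * xmon w -
    (\<Sum>v\<in>{v. wt v < wt w}. mlin (xmon w * gram v) * (\<Prod>u\<in>{u. wt u < wt w} - {v}. mlin ((gram u)\<^sup>2)) * gram v)"
  by pat_completeness auto
termination by (relation "measure wt") auto

declare gram.simps [simp del]

definition gnorm :: "('n::finite \<Rightarrow> nat) \<Rightarrow> 'n Mpoly" where
  "gnorm w = mlin ((gram w)\<^sup>2)"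

definition glead :: "('n::finite \<Rightarrow> nat) \<Rightarrow> 'n Mpoly" where
  "glead w = (\<Prod>u\<in>{u. wt u < wt w}. gnorm u)"

text \<open>The usual coefficient m(x^w G_v) / N_v, multiplied by the common denominator
  \<open>glead w\<close>.\<close>

definition gcf :: "('n::finite \<Rightarrow> nat) \<Rightarrow> ('n \<Rightarrow> nat) \<Rightarrow> 'n Mpoly" where
  "gcf w v = mlin (xmon w * gram v) * (\<Prod>u\<in>{u. wt u < wt w} - {v}. gnorm u)"

lemma gram_eq: "gram w = glead w * xmon w - (\<Sum>v\<in>{v. wt v < wt w}. gcf w v * gram v)"
  unfolding glead_def gcf_def gnorm_def by (subst gram.simps) simp

text \<open>Weights multiply when monomials do, so the moments created here have weight at most wt w
  * j.\<close>

lemma mlin_xmon_mult_Mless: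
  assumes "p \<in> lspan (Mless k) {xmon \<alpha> |\<alpha>. wt \<alpha> \<le> j}" "k \<le> l" "wt w * j < l"
  shows "mlin (xmon w * p) \<in> Mless l"
  using assms(1)
proof induction
  case (lspan_add s c g)
  then obtain \<alpha> where \<alpha>: "g = xmon \<alpha>" "wt \<alpha> \<le> j" by blast
  have c: "c \<in> Mless l" using Mless_mono lspan_add.hyps(2) assms(2) by blast
  have "xmon w * (s + c * g) = xmon w * s + c * xmon (madd w \<alpha>)" by (simp add: \<alpha> xmon_madd algebra_simps)
  then have "mlin (xmon w * (s + c * g)) = mlin (xmon w * s) + c * mgen (madd w \<alpha>)"
    using mlin_M_mult[OF Mless_M[OF c]] by (simp add: mlin_add mlin_xmon)
  moreover have "wt (madd w \<alpha>) < l"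
    using assms(3) \<alpha>(2) by (simp add: wt_madd) (meson le_less_trans mult_le_mono2)
  then have "c * mgen (madd w \<alpha>) \<in> Mless l" using c mgen_Mless AV_closed(6) unfolding Mless_def by blast
  ultimately show ?case using lspan_add.IH AV_closed(4) unfolding Mless_def by simp
qed (use AV_closed(2) in \<open>simp add: Mless_def\<close>)

lemma mlin_mult_Mless:
  assumes p: "p \<in> lspan (Mless k) {xmon \<alpha> |\<alpha>. wt \<alpha> \<le> j}" and q: "q \<in> lspan (Mless k) {xmon \<alpha> |\<alpha>. wt \<alpha> \<le> i}"
    and "k \<le> l" "i * j < l"
  shows "mlin (q * p) \<in> Mless l"
  using q
proof induction
  case (lspan_add s c g)
  then obtain \<alpha> where \<alpha>: "g = xmon \<alpha>" "wt \<alpha> \<le> i" by blast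
  have c: "c \<in> Mless l" using Mless_mono lspan_add.hyps(2) assms(3) by blast
  have "(s + c * g) * p = s * p + c * (xmon \<alpha> * p)" by (simp add: \<alpha> algebra_simps)
  then have "mlin ((s + c * g) * p) = mlin (s * p) + c * mlin (xmon \<alpha> * p)"
    using mlin_M_mult[OF Mless_M[OF c]] by (simp add: mlin_add)
  moreover have "wt \<alpha> * j < l" using assms(4) \<alpha>(2) by (meson le_less_trans mult_le_mono1)
  then have "mlin (xmon \<alpha> * p) \<in> Mless l" using mlin_xmon_mult_Mless[OF p assms(3)] by blast
  then have "c * mlin (xmon \<alpha> * p) \<in> Mless l" using c AV_closed(6) unfolding Mless_def by blast
  ultimately show ?case using lspan_add.IH AV_closed(4) unfolding Mless_def by simp
qed (use AV_closed(2) in \<open>simp add: Mless_def\<close>)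

lemma subrng_Mless: "subrng (Mless k)"
  unfolding Mless_def by (rule subrng_AV)

text \<open>m(x^w G_v) creates moments of weight at most wt w * wt v, which is below (wt w)^2 for
  predecessors v. Only the norm reaches the weight (wt w)^2 of m_{2w}, whence the \<open>Suc\<close>
  in its bound.\<close>

lemma gram_bounds:
  fixes w :: "'n::finite \<Rightarrow> nat"
  shows
  "gram w \<in> lspan (Mless ((wt w)\<^sup>2)) {xmon \<alpha> |\<alpha>. wt \<alpha> \<le> wt w} \<and>
   gnorm w \<in> Mless (Suc ((wt w)\<^sup>2)) \<and> glead w \<in> Mless ((wt w)\<^sup>2) \<and>
   (\<forall>v :: 'n \<Rightarrow> nat. wt v < wt w \<longrightarrow> gcf w v \<in> Mless ((wt w)\<^sup>2) \<and> mlin (xmon w * gram v) \<in> Mless ((wt w)\<^sup>2))"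
proof (induction "wt w" arbitrary: w rule: less_induct)
  case less
  let ?k = "(wt w)\<^sup>2"
  have sq: "(wt v)\<^sup>2 < ?k" if "wt v < wt w" for v :: "'n \<Rightarrow> nat"
    using that by (simp add: power_strict_mono)
  have n: "gnorm v \<in> Mless ?k" if "wt v < wt w" for v :: "'n \<Rightarrow> nat"
    using less[OF that] Mless_mono[OF _ Suc_leI[OF sq[OF that]]] by blast
  have lead: "glead w \<in> Mless ?k" unfolding glead_def Mless_def by (rule AV_prod) (use n Mless_def in auto)
  have xg: "mlin (xmon w * gram v) \<in> Mless ?k" if v: "wt v < wt w" for v :: "'n \<Rightarrow> nat"
  proof (rule mlin_xmon_mult_Mless)
    show "gram v \<in> lspan (Mless ((wt v)\<^sup>2)) {xmon \<alpha> |\<alpha>. wt \<alpha> \<le> wt v}" using less[OF v] by blast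
    show "(wt v)\<^sup>2 \<le> ?k" using sq[OF v] by (rule less_imp_le)
    show "wt w * wt v < ?k" using v wt_pos[of w] by (simp add: power2_eq_square)
  qed
  have cf: "gcf w v \<in> Mless ?k" if v: "wt v < wt w" for v :: "'n \<Rightarrow> nat"
  proof -
    have "(\<Prod>u\<in>{u. wt u < wt w} - {v}. gnorm u) \<in> Mless ?k"
      unfolding Mless_def by (rule AV_prod) (use n Mless_def in auto)
    then show ?thesis unfolding gcf_def using xg[OF v] subrngD(6)[OF subrng_Mless] by blast
  qed
  let ?L = "lspan (Mless ?k) {xmon \<alpha> |\<alpha>. wt \<alpha> \<le> wt w}"
  have A: "glead w * xmon w \<in> ?L" by (intro lspan_scale lspan_gen subrng_Mless lead) auto
  have S: "(\<Sum>v\<in>{v. wt v < wt w}. gcf w v * gram v) \<in> ?L"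
  proof (intro lspan_sum lspan_scale subrng_Mless cf)
    fix v :: "'n \<Rightarrow> nat" assume v: "v \<in> {v. wt v < wt w}"
    then have gv: "gram v \<in> lspan (Mless ((wt v)\<^sup>2)) {xmon \<alpha> |\<alpha>. wt \<alpha> \<le> wt v}" using less by blast
    have "Mless ((wt v)\<^sup>2) \<subseteq> Mless ?k" using v less_imp_le[OF sq[of v]] Mless_mono by blast
    moreover have "{xmon \<alpha> |\<alpha>. wt \<alpha> \<le> wt v} \<subseteq> {xmon \<alpha> |\<alpha> :: 'n \<Rightarrow> nat. wt \<alpha> \<le> wt w}" using v by force
    ultimately show "gram v \<in> ?L" using lspan_mono[OF gv] by blast
  qed auto
  have "glead w * xmon w + (- 1) * (\<Sum>v\<in>{v. wt v < wt w}. gcf w v * gram v) \<in> ?L"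
    by (intro lspan_plus[OF A] lspan_scale[OF S] subrng_Mless subrngD(3)[OF subrng_Mless] subrngD(1)[OF subrng_Mless])
  then have g: "gram w \<in> ?L" unfolding gram_eq[of w] by simp
  have "gnorm w \<in> Mless (Suc ?k)"
    unfolding gnorm_def power2_eq_square[of "gram w"] by (rule mlin_mult_Mless[OF g g]) (auto simp: power2_eq_square)
  then show ?case using g lead xg cf by blast
qed

lemma gram_M: "gnorm w \<in> AV (range MV)" "glead w \<in> AV (range MV)" "wt v < wt w \<Longrightarrow> gcf w v \<in> AV (range MV)"
  using gram_bounds[of w] Mless_M by blast+

lemma mlin_gram_mult: "mlin (gram w * p) = glead w * mlin (xmon w * p) - (\<Sum>v\<in>{v. wt v < wt w}. gcf w v * mlin (gram v * p))"
proof -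
  have "gram w * p = glead w * (xmon w * p) - (\<Sum>v\<in>{v. wt v < wt w}. gcf w v * (gram v * p))"
    by (subst gram_eq) (simp add: left_diff_distrib sum_distrib_right mult.assoc)
  then show ?thesis by (simp add: mlin_diff mlin_sum mlin_M_mult gram_M)
qed

text \<open>By induction only the summand u = v survives in the expansion of G_w. It equals
  \<open>gcf w v * gnorm v\<close>, and the factor N_v omitted from \<open>gcf\<close> completes the
  product to \<open>glead w\<close>, so it cancels the first term.\<close>

lemma gram_orthogonal: "wt v < wt w \<Longrightarrow> mlin (gram w * gram v) = 0"
proof (induction "wt w" arbitrary: w v rule: less_induct)
  case less
  let ?S = "{u. wt u < wt w}"
  have "(\<Sum>u\<in>?S. gcf w u * mlin (gram u * gram v)) = (\<Sum>u\<in>?S. if u = v then gcf w v * gnorm v else 0)"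
  proof (rule sum.cong)
    fix u :: "'a \<Rightarrow> nat" assume u: "u \<in> ?S"
    have "mlin (gram u * gram v) = 0" if "u \<noteq> v"
    proof -
      have "wt u \<noteq> wt v" using that injD[OF inj_wt] by blast
      then consider "wt u < wt v" | "wt v < wt u" by linarith
      then show ?thesis
      proof cases
        case 1
        then show ?thesis using less.hyps[OF less.prems, of u] by (simp add: mult.commute)
      next
        case 2
        then show ?thesis using less.hyps[of u v] u by simp
      qed
    qed
    then show "gcf w u * mlin (gram u * gram v) = (if u = v then gcf w v * gnorm v else 0)"
      by (simp add: gnorm_def power2_eq_square)
  qed simp
  also have "\<dots> = gcf w v * gnorm v" using less.prems by (simp add: sum.delta[OF finite_wt_less])
  also have "\<dots> = glead w * mlin (xmon w * gram v)"
    unfolding gcf_def glead_def using less.prems by (subst prod.remove[OF finite_wt_less, of v]) (auto simp: ac_simps)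
  finally show ?case unfolding mlin_gram_mult[of w] by simp
qed

text \<open>Expand one factor G_w; orthogonality leaves glead w * m(x^w G_w), and a second expansion
  isolates m_{2w}. By \<open>gram_bounds\<close> the rest does not contain it.\<close>

lemma gnorm_eq:
  "gnorm w = (glead w)\<^sup>2 * mgen (madd w w) - glead w * (\<Sum>v\<in>{v. wt v < wt w}. gcf w v * mlin (xmon w * gram v))"
proof -
  have "gnorm w = glead w * mlin (xmon w * gram w) - (\<Sum>v\<in>{v. wt v < wt w}. gcf w v * mlin (gram v * gram w))"
    unfolding gnorm_def power2_eq_square mlin_gram_mult[of w "gram w"] ..
  also have "(\<Sum>v\<in>{v. wt v < wt w}. gcf w v * mlin (gram v * gram w)) = 0"
    by (rule sum.neutral) (use gram_orthogonal in \<open>auto simp: mult.commute\<close>)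
  also have "mlin (xmon w * gram w) = mlin (gram w * xmon w)" by (simp add: mult.commute)
  also have "\<dots> = glead w * mgen (madd w w) - (\<Sum>v\<in>{v. wt v < wt w}. gcf w v * mlin (gram v * xmon w))"
    unfolding mlin_gram_mult[of w "xmon w"] by (simp add: mlin_xmon flip: xmon_madd)
  finally show ?thesis by (simp add: algebra_simps power2_eq_square)
qed

section \<open>Positive definite evaluations\<close>

text \<open>There is one strict condition per multi-index, and each involves only finitely many
  moments; this makes truncation and small perturbations possible.\<close>

definition posdef :: "('n::finite mvar \<Rightarrow> real) \<Rightarrow> bool" where
  "posdef b \<longleftrightarrow> (\<forall>w. 0 < ev b (gnorm w))"

lemmas ev_simps = rhom_simps[OF rhom_ev] rhom_sum[OF rhom_ev] rhom_prod[OF rhom_ev]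

lemma mlin_gram_sum_square:
  fixes S :: "('n::finite \<Rightarrow> nat) set"
  assumes "finite S" "\<And>w. a w \<in> AV (range MV)"
  shows "mlin ((\<Sum>w\<in>S. a w * gram w)\<^sup>2) = (\<Sum>w\<in>S. (a w)\<^sup>2 * gnorm w)"
proof -
  have "(\<Sum>w\<in>S. a w * gram w)\<^sup>2 = (\<Sum>w\<in>S. \<Sum>v\<in>S. (a w * a v) * (gram w * gram v))"
    by (simp add: power2_eq_square sum_product ac_simps)
  then have "mlin ((\<Sum>w\<in>S. a w * gram w)\<^sup>2) = (\<Sum>w\<in>S. \<Sum>v\<in>S. (a w * a v) * mlin (gram w * gram v))"
    by (simp add: mlin_sum mlin_M_mult AV_mult assms(2))
  also have "\<dots> = (\<Sum>w\<in>S. \<Sum>v\<in>S. if v = w then (a w)\<^sup>2 * gnorm w else 0)"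
  proof (intro sum.cong refl)
    fix w v :: "'n \<Rightarrow> nat"
    have "mlin (gram w * gram v) = 0" if "v \<noteq> w"
    proof -
      have "wt v \<noteq> wt w" using that injD[OF inj_wt] by blast
      then show ?thesis using gram_orthogonal[of v w] gram_orthogonal[of w v] by (metis mult.commute nat_neq_iff)
    qed
    then show "(a w * a v) * mlin (gram w * gram v) = (if v = w then (a w)\<^sup>2 * gnorm w else 0)"
      by (simp add: gnorm_def power2_eq_square)
  qed
  finally show ?thesis using assms(1) by simp
qed

text \<open>A multiple C p, with C a moment polynomial positive at b, is a combination of the G_w.
  Orthogonality then gives C^2 m(p^2) = sum of a_w^2 N_w.\<close>

lemma posdef_nonneg:
  fixes p :: "'n::finite Mpoly"
  assumes b: "posdef b"
  shows "0 \<le> ev b (mlin (p\<^sup>2))"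
proof -
  let ?M = "AV (range MV) :: 'n Mpoly set"
  let ?L = "lspan ?M (range gram)"
  note sM = subrng_AV[of "range MV"]
  have n: "0 < ev b (gnorm w)" for w using b by (simp add: posdef_def)
  have c: "0 < ev b (glead w)" for w by (auto simp: glead_def ev_simps intro!: prod_pos n)
  have "\<exists>C\<in>?M. 0 < ev b C \<and> C * p \<in> ?L"
    using in_lspan_xmon[of p]
  proof induction
    case lspan_0
    show ?case using lspan.lspan_0 AV_closed(1) by (intro bexI[of _ 1]) (auto simp: ev_simps)
  next
    case (lspan_add s d g)
    then obtain C w where C: "C \<in> ?M" "0 < ev b C" "C * s \<in> ?L" and g: "g = xmon w" by blast
    have gl: "glead w * xmon w = gram w + (\<Sum>v\<in>{v. wt v < wt w}. gcf w v * gram v)"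
      using gram_eq[of w] by simp
    have gx: "glead w * xmon w \<in> ?L" unfolding gl
      by (intro lspan_plus lspan_sum lspan_scale lspan_gen sM) (auto simp: gram_M)
    have "(C * d) * (glead w * xmon w) \<in> ?L" by (rule lspan_scale[OF gx sM AV_mult[OF C(1) lspan_add.hyps(2)]])
    moreover have "glead w * (C * s) \<in> ?L" by (rule lspan_scale[OF C(3) sM gram_M(2)])
    ultimately have "glead w * (C * s) + (C * d) * (glead w * xmon w) \<in> ?L" by (rule lspan_plus[rotated])
    then have "(C * glead w) * (s + d * g) \<in> ?L" by (simp add: g algebra_simps)
    then show ?case using C(1,2) c[of w] gram_M(2)[of w]
      by (intro bexI[of _ "C * glead w"]) (auto simp: ev_simps intro: AV_mult)
  qed
  then obtain C where C: "C \<in> ?M" "0 < ev b C" "C * p \<in> ?L" by blast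
  obtain S a where S: "finite S" "\<And>w. a w \<in> ?M" "C * p = (\<Sum>w\<in>S. a w * gram w)"
    using lspan_finite_sum[OF C(3) sM] by blast
  have "C\<^sup>2 * mlin (p\<^sup>2) = mlin ((C * p)\<^sup>2)"
    using mlin_M_mult[OF AV_mult[OF C(1) C(1)], of "p\<^sup>2"] by (simp add: power2_eq_square ac_simps)
  also have "\<dots> = (\<Sum>w\<in>S. (a w)\<^sup>2 * gnorm w)" unfolding S(3) by (rule mlin_gram_sum_square[OF S(1,2)])
  finally have eq: "C\<^sup>2 * mlin (p\<^sup>2) = (\<Sum>w\<in>S. (a w)\<^sup>2 * gnorm w)" .
  have "(ev b C)\<^sup>2 * ev b (mlin (p\<^sup>2)) = ev b (\<Sum>w\<in>S. (a w)\<^sup>2 * gnorm w)"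
    unfolding eq[symmetric] by (simp only: ev_simps)
  also have "\<dots> \<ge> 0" by (auto simp: ev_simps intro!: sum_nonneg mult_nonneg_nonneg less_imp_le[OF n])
  finally have "0 \<le> (ev b C)\<^sup>2 * ev b (mlin (p\<^sup>2))" .
  moreover have "0 < (ev b C)\<^sup>2" using C(2) by simp
  ultimately show ?thesis by (auto simp only: zero_le_mult_iff)
qed

lemma pme_ev: "posdef b \<Longrightarrow> pme (ev b)"
  using posdef_nonneg by (auto simp: pme_def ev_simps)

text \<open>The norm \<open>m(G\<^sub>w\<^sup>2)\<close> is affine in the indeterminate \<open>m\<^bsub>2w\<^esub>\<close>, with positive leading coefficient, and the
  norms of the predecessors of \<open>w\<close> do not involve \<open>m\<^bsub>2w\<^esub>\<close>.\<close>

lemma gnorm_positive_step: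
  fixes w :: "'n::finite \<Rightarrow> nat"
  assumes w: "wt w > 1" and b: "\<And>v :: 'n \<Rightarrow> nat. wt v < wt w \<Longrightarrow> 0 < ev b (gnorm v)"
  obtains t where "0 < ev (b(MV (Abs_nzidx (madd w w)) := t)) (gnorm w)"
proof -
  let ?m = "MV (Abs_nzidx (madd w w))"
  let ?k = "(wt w)\<^sup>2"
  \<comment> \<open>For w = 0 the moment m_{2w} would be the constant 1 and could not be
    adjusted.\<close>
  have nz: "madd w w \<noteq> (\<lambda>_. 0)" using w wt_eq_1[of "madd w w"] by (auto simp: wt_madd)
  have wm: "wt (Rep_nzidx (Abs_nzidx (madd w w))) = ?k"
    using nz by (simp add: Abs_nzidx_inverse wt_madd power2_eq_square)
  have ind: "ev (b(?m := t)) p = ev b p" if "p \<in> Mless ?k" for p t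
    by (rule ev_AV_cong[OF that[unfolded Mless_def]]) (use wm in auto)
  define r where "r = glead w * (\<Sum>v\<in>{v. wt v < wt w}. gcf w v * mlin (xmon w * gram v))"
  have "(\<Sum>v\<in>{v. wt v < wt w}. gcf w v * mlin (xmon w * gram v)) \<in> Mless ?k"
    by (rule subrng_sum[OF subrng_Mless]) (use gram_bounds[of w] subrngD(6)[OF subrng_Mless] in auto)
  then have r: "r \<in> Mless ?k" using gram_bounds[of w] subrngD(6)[OF subrng_Mless] unfolding r_def by blast
  have c: "0 < ev b (glead w)" unfolding glead_def by (auto simp: ev_simps intro!: prod_pos b)
  have mg: "mgen (madd w w) = pvar ?m" using nz by (simp add: mgen_def)
  have eq: "ev (b(?m := t)) (gnorm w) = (ev b (glead w))\<^sup>2 * t - ev b r" for t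
    unfolding gnorm_eq[of w] mg r_def[symmetric]
    using ind[OF r] ind[of "glead w"] gram_bounds[of w] by (simp add: ev_simps)
  \<comment> \<open>This t solves the affine equation that makes the norm equal to 1.\<close>
  show ?thesis
    by (rule that[of "(ev b r + 1) / (ev b (glead w))\<^sup>2"]) (use c in \<open>simp add: eq\<close>)
qed

definition agree :: "nat \<Rightarrow> ('n::finite mvar \<Rightarrow> real) \<Rightarrow> ('n mvar \<Rightarrow> real) \<Rightarrow> bool" where
  "agree k b c \<longleftrightarrow> (\<forall>i. b (XV i) = c (XV i)) \<and> (\<forall>g. wt (Rep_nzidx g) < k \<longrightarrow> b (MV g) = c (MV g))"

lemma agree_Mless: "agree k b c \<Longrightarrow> p \<in> Mless k \<Longrightarrow> ev b p = ev c p"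
  unfolding Mless_def by (erule ev_AV_cong) (auto simp: agree_def)

text \<open>At most one multi-index has weight k+1, as \<open>wt\<close> is injective, and possibly
  none has. Adjusting m_{2w} changes a single moment, of weight (k+1)^2, which the norms of smaller
  index do not contain.\<close>

lemma posdef_step:
  fixes b :: "'n::finite mvar \<Rightarrow> real"
  assumes k: "k \<ge> 1" and b: "\<And>w :: 'n \<Rightarrow> nat. wt w \<le> k \<Longrightarrow> 0 < ev b (gnorm w)"
  obtains c where "agree ((Suc k)\<^sup>2) b c" "\<And>w :: 'n \<Rightarrow> nat. wt w \<le> Suc k \<Longrightarrow> 0 < ev c (gnorm w)"
proof (cases "\<exists>w :: 'n \<Rightarrow> nat. wt w = Suc k")
  case False
  then show ?thesis using that[of b] b by (auto simp: agree_def le_Suc_eq)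
next
  case True
  then obtain w :: "'n \<Rightarrow> nat" where w: "wt w = Suc k" by blast
  obtain t where t: "0 < ev (b(MV (Abs_nzidx (madd w w)) := t)) (gnorm w)"
    by (rule gnorm_positive_step[of w b]) (use w k b in auto)
  let ?c = "b(MV (Abs_nzidx (madd w w)) := t)"
  have "madd w w \<noteq> (\<lambda>_. 0)" using w k wt_eq_1[of "madd w w"] by (auto simp: wt_madd)
  then have wm: "wt (Rep_nzidx (Abs_nzidx (madd w w))) = (Suc k)\<^sup>2"
    by (simp add: Abs_nzidx_inverse wt_madd w power2_eq_square)
  have ag: "agree ((Suc k)\<^sup>2) b ?c" using wm by (auto simp: agree_def)
  have "0 < ev ?c (gnorm v)" if v: "wt v \<le> Suc k" for v :: "'n \<Rightarrow> nat"
  proof (cases "v = w")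
    case False
    then have "wt v \<noteq> wt w" using injD[OF inj_wt] by blast
    then have vk: "wt v \<le> k" using v w by simp
    have "gnorm v \<in> Mless ((Suc k)\<^sup>2)"
    proof -
      have "(wt v)\<^sup>2 < (Suc k)\<^sup>2" using vk by (intro power_strict_mono) auto
      then show ?thesis using gram_bounds[of v] Mless_mono[OF _ Suc_leI] by blast
    qed
    then have "ev ?c (gnorm v) = ev b (gnorm v)" using agree_Mless[OF ag] by simp
    then show ?thesis using b[OF vk] by simp
  qed (use t in simp)
  then show ?thesis using that[OF ag] by blast
qed

text \<open>Truncated positive definite moment data extend: the assignments obtained by fixing the values of
  \<open>m\<^bsub>2w\<^esub>\<close> one after the other stabilise on every indeterminate.\<close>

lemma posdef_extend:
  fixes b :: "'n::finite mvar \<Rightarrow> real"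
  assumes K: "K \<ge> 1" and b: "\<And>w :: 'n \<Rightarrow> nat. wt w \<le> K \<Longrightarrow> 0 < ev b (gnorm w)"
  obtains c where "posdef c" "agree (Suc K) b c"
proof -
  \<comment> \<open>The clause for n = 0 forces the chosen sequence to start at b.\<close>
  define P where "P n x \<longleftrightarrow> (\<forall>w :: 'n \<Rightarrow> nat. wt w \<le> K + n \<longrightarrow> 0 < ev x (gnorm w)) \<and> (n = 0 \<longrightarrow> x = b)"
    for n and x :: "'n mvar \<Rightarrow> real"
  define R where "R n x y \<longleftrightarrow> agree ((Suc (K + n))\<^sup>2) x y" for n and x y :: "'n mvar \<Rightarrow> real"
  have "\<exists>f. \<forall>n. P n (f n) \<and> R n (f n) (f (Suc n))"
  proof (rule dependent_nat_choice)
    show "\<exists>x. P 0 x" using b by (auto simp: P_def)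
    show "\<exists>y. P (Suc n) y \<and> R n x y" if "P n x" for x n
    proof -
      have *: "K + n \<ge> 1" "\<And>w :: 'n \<Rightarrow> nat. wt w \<le> K + n \<Longrightarrow> 0 < ev x (gnorm w)"
        using K that by (auto simp: P_def)
      obtain y where "agree ((Suc (K + n))\<^sup>2) x y" "\<And>w :: 'n \<Rightarrow> nat. wt w \<le> Suc (K + n) \<Longrightarrow> 0 < ev y (gnorm w)"
        using posdef_step[OF *] by blast
      then show ?thesis by (auto simp: P_def R_def)
    qed
  qed
  then obtain f where f: "\<And>n. P n (f n)" "\<And>n. R n (f n) (f (Suc n))" by blast
  have f0: "f 0 = b" using f(1)[of 0] by (simp add: P_def)
  have step: "agree (Suc (K + n)) (f n) (f (Suc n))" for n
  proof -
    have "Suc (K + n) \<le> (Suc (K + n))\<^sup>2" by (simp add: power2_eq_square)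
    then show ?thesis using f(2)[of n] unfolding R_def agree_def by (meson order_less_le_trans)
  qed
  have stable: "agree (Suc (K + n)) (f n) (f (n + m))" for n m
  proof (induction m)
    case (Suc m)
    have "agree (Suc (K + n)) (f (n + m)) (f (Suc (n + m)))"
      using step[of "n + m"] by (auto simp: agree_def)
    then show ?case using Suc by (auto simp: agree_def)
  qed (simp add: agree_def)
  \<comment> \<open>From stage n on, all moments of weight at most K + n are fixed, so stage
    \<open>wt (Rep_nzidx g)\<close> already shows the final value of m_g.\<close>
  define c where "c v = (case v of XV i \<Rightarrow> b (XV i) | MV g \<Rightarrow> f (wt (Rep_nzidx g)) (MV g))" for v
  have fc: "agree (Suc (K + n)) (f n) c" for n
    unfolding agree_def
  proof (intro conjI allI impI)
    fix i show "f n (XV i) = c (XV i)" using stable[of 0 n] by (simp add: agree_def c_def f0)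
  next
    fix g :: "'n nzidx" assume g: "wt (Rep_nzidx g) < Suc (K + n)"
    let ?m = "wt (Rep_nzidx g)"
    have "f n (MV g) = f (n + ?m) (MV g)" using stable[of n ?m] g by (simp add: agree_def)
    moreover have "f ?m (MV g) = f (?m + n) (MV g)" using stable[of ?m n] by (simp add: agree_def)
    ultimately show "f n (MV g) = c (MV g)" by (simp add: c_def add.commute)
  qed
  have "0 < ev c (gnorm w)" for w
  proof -
    let ?n = "(wt w)\<^sup>2"
    have "gnorm w \<in> Mless (Suc (K + ?n))" using gram_bounds[of w] Mless_mono by (metis Suc_le_mono le_add2)
    then have "ev c (gnorm w) = ev (f ?n) (gnorm w)" using agree_Mless[OF fc[of ?n]] by simp
    moreover have "wt w \<le> K + ?n" by (simp add: power2_eq_square trans_le_add2)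
    ultimately show ?thesis using f(1)[of ?n] by (simp add: P_def)
  qed
  then have "posdef c" by (simp add: posdef_def)
  moreover have "agree (Suc K) b c" using fc[of 0] f0 by simp
  ultimately show ?thesis by (rule that)
qed

lemma bounded_vars:
  fixes p :: "'n::finite Mpoly"
  obtains K where "K \<ge> 1" "\<And>b c. agree (Suc K) b c \<Longrightarrow> ev b p = ev c p"
proof -
  obtain V where V: "finite V" "p \<in> AV V" using in_some_AV by blast
  define W where "W = (\<lambda>v. case v of XV i \<Rightarrow> 0 | MV g \<Rightarrow> wt (Rep_nzidx g)) ` V"
  have "finite W" using V by (simp add: W_def)
  then obtain K where K: "\<And>x. x \<in> W \<Longrightarrow> x \<le> K" by (meson finite_nat_set_iff_bounded_le)
  show ?thesis
  proof (rule that[of "Suc K"])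
    fix b c :: "'n mvar \<Rightarrow> real" assume a: "agree (Suc (Suc K)) b c"
    show "ev b p = ev c p"
    proof (rule ev_AV_cong[OF V(2)])
      fix v assume "v \<in> V"
      then have "(case v of XV i \<Rightarrow> 0 | MV g \<Rightarrow> wt (Rep_nzidx g)) \<le> K" by (intro K) (simp add: W_def)
      then show "b v = c v" using a by (cases v) (auto simp: agree_def)
    qed
  qed simp
qed

section \<open>Segments between real points and density of positive definite points\<close>

definition path :: "('v \<Rightarrow> real) \<Rightarrow> ('v \<Rightarrow> real) \<Rightarrow> real \<Rightarrow> 'v \<Rightarrow> real" where
  "path b c t = (\<lambda>v. (1 - t) * b v + t * c v)"

lemma path_0 [simp]: "path b c 0 = b" and path_1 [simp]: "path b c 1 = c"
  by (auto simp: path_def)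

lemma path_poly: "\<exists>H. \<forall>t. ev (path b c t) p = poly H t"
  using in_AV_UNIV[of p]
proof induction
  case (AV_const d)
  show ?case by (intro exI[of _ "[:d:]"]) simp
next
  case (AV_var v)
  show ?case by (intro exI[of _ "[:b v, c v - b v:]"]) (simp add: path_def algebra_simps)
next
  case (AV_add p q)
  then obtain H G where "\<forall>t. ev (path b c t) p = poly H t" "\<forall>t. ev (path b c t) q = poly G t" by blast
  then show ?case by (intro exI[of _ "H + G"]) (simp add: ev_simps)
next
  case (AV_mult p q)
  then obtain H G where "\<forall>t. ev (path b c t) p = poly H t" "\<forall>t. ev (path b c t) q = poly G t" by blast
  then show ?case by (intro exI[of _ "H * G"]) (simp add: ev_simps)
qed

text \<open>Strict inequalities at b persist for small t > 0, while h restricted to the line is a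
  nonzero polynomial in t, since it does not vanish at t = 1, and has finitely many roots.\<close>

lemma path_perturb:
  assumes "finite Q" "\<And>q. q \<in> Q \<Longrightarrow> 0 < ev b q" "ev c h \<noteq> 0"
  obtains t where "0 < t" "t < 1" "\<And>q. q \<in> Q \<Longrightarrow> 0 < ev (path b c t) q" "ev (path b c t) h \<noteq> 0"
proof -
  obtain H where H: "\<And>t. ev (path b c t) h = poly H t" using path_poly by blast
  have "H \<noteq> 0" using assms(3) H[of 1] by auto
  then have fin: "finite {t. poly H t = 0}" by (rule poly_roots_finite)
  have "eventually (\<lambda>t. 0 < ev (path b c t) q) (at_right 0)" if "q \<in> Q" for q
  proof -
    obtain G where G: "\<And>t. ev (path b c t) q = poly G t" using path_poly by blast
    have "(poly G \<longlongrightarrow> poly G 0) (at_right 0)" by (intro tendsto_intros)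
    moreover have "0 < poly G 0" using G[of 0] assms(2)[OF that] by simp
    ultimately show ?thesis unfolding G by (rule order_tendstoD)
  qed
  then have "eventually (\<lambda>t. \<forall>q\<in>Q. 0 < ev (path b c t) q) (at_right 0)"
    using assms(1) by (simp add: eventually_ball_finite)
  then obtain d where d: "d > 0" "\<And>t. 0 < t \<Longrightarrow> t < d \<Longrightarrow> \<forall>q\<in>Q. 0 < ev (path b c t) q"
    unfolding eventually_at_right_field by blast
  have "infinite {0<..<min d 1}" using d(1) by simp
  then obtain t where "t \<in> {0<..<min d 1}" "t \<notin> {t. poly H t = 0}" using fin by (meson finite_subset subsetI)
  then show ?thesis using that[of t] d(2)[of t] H by auto
qed

text \<open>Move a positive definite point slightly towards a point where h is nonzero, keeping the
  finitely many norms that matter positive. Extending from there changes only moments absent from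
  h.\<close>

lemma posdef_nonzero:
  fixes h :: "'n::finite Mpoly"
  assumes "h \<noteq> 0"
  obtains c where "posdef c" "ev c h \<noteq> 0"
proof -
  \<comment> \<open>The index 0 has G = 1 and m_0 = 1, so the extension may start at K = 1 from the
    zero assignment.\<close>
  have one: "ev b (gnorm w) = 1" if "wt w \<le> 1" for w :: "'n \<Rightarrow> nat" and b
  proof -
    have w1: "wt w = 1" using wt_pos[of w] that by simp
    then have "w = (\<lambda>_. 0)" unfolding wt_eq_1 .
    moreover have "{v :: 'n \<Rightarrow> nat. wt v < wt w} = {}" using w1 wt_pos by (auto simp: Suc_le_eq)
    ultimately have "gram w = 1" using gram_eq[of w] by (simp add: glead_def xmon_zero)
    then show ?thesis using mlin_xmon[of "\<lambda>_::'n. 0"] by (simp add: gnorm_def xmon_zero mgen_def ev_simps)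
  qed
  obtain b :: "'n mvar \<Rightarrow> real" where b: "posdef b"
    by (rule posdef_extend[of 1 "\<lambda>_. 0"]) (use one in auto)
  obtain a where a: "ev a h \<noteq> 0" using ev_nonzero[OF assms] by blast
  obtain K where K: "K \<ge> 1" "\<And>b c. agree (Suc K) b c \<Longrightarrow> ev b h = ev c h" by (rule bounded_vars[of h]) blast
  have fin: "finite (gnorm ` {w :: 'n \<Rightarrow> nat. wt w < Suc K})" using finite_wt_less by blast
  obtain t where t: "\<And>q. q \<in> gnorm ` {w :: 'n \<Rightarrow> nat. wt w < Suc K} \<Longrightarrow> 0 < ev (path b a t) q"
    "ev (path b a t) h \<noteq> 0"
    by (rule path_perturb[OF fin _ a, of b]) (use b in \<open>auto simp: posdef_def\<close>)
  obtain c where "posdef c" "agree (Suc K) (path b a t) c"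
    by (rule posdef_extend[OF K(1), of "path b a t"]) (use t(1) in auto)
  then show ?thesis using that[of c] K(2) t(2) by metis
qed


section \<open>Pseudo-moment evaluations\<close>

lemma in_Rx_pconst: "in_Rx (pconst c)"
  by (auto simp: in_Rx_def pconst_def)

lemma in_Rx_XV: "in_Rx (pvar (XV i))"
  by (auto simp: in_Rx_def pvar_def is_M_var_def)

lemma in_Rx_add:
  assumes "in_Rx p" "in_Rx q"
  shows "in_Rx (p + q)"
  using assms subsetD[OF keys_add[of p q]] unfolding in_Rx_def by auto

lemma in_Rx_mult:
  assumes "in_Rx p" "in_Rx q"
  shows "in_Rx (p * q)"
  unfolding in_Rx_def
proof (intro ballI)
  fix m v assume m: "m \<in> Poly_Mapping.keys (p * q)" and v: "v \<in> Poly_Mapping.keys m"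
  obtain a b where ab: "m = a + b" "a \<in> Poly_Mapping.keys p" "b \<in> Poly_Mapping.keys q"
    using subsetD[OF keys_mult m] by auto
  have "v \<in> Poly_Mapping.keys a \<union> Poly_Mapping.keys b" using v unfolding ab(1) by (rule subsetD[OF keys_add])
  then show "\<not> is_M_var v" using assms ab(2,3) unfolding in_Rx_def by auto
qed

lemma AV_XV_in_Rx: "p \<in> AV (range XV) \<Longrightarrow> in_Rx p"
  by (induction rule: AV.induct) (auto intro: in_Rx_pconst in_Rx_XV in_Rx_add in_Rx_mult)

lemma ev_mlin_in_Rx:
  assumes "in_Rx p"
  shows "ev b (mlin p) = (\<Sum>m\<in>Poly_Mapping.keys p. Poly_Mapping.lookup p m * ev b (mgen (xpart m)))"
proof -
  have "mpart m = 1" if "m \<in> Poly_Mapping.keys p" for m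
  proof -
    have "{v \<in> Poly_Mapping.keys m. is_M_var v} = {}" using assms that unfolding in_Rx_def by blast
    then show ?thesis unfolding mpart_def by (metis prod.empty)
  qed
  then show ?thesis unfolding mlin_alt by (simp add: ev_simps)
qed

text \<open>For real coefficients m(p) is linear in the m_\<alpha> and free of the x_i; m_0 = 1 fits
  because the weights 1 - t and t add up to 1. With moments among the coefficients this would
  fail.\<close>

lemma ev_path_mlin:
  assumes "in_Rx p"
  shows "ev (path b c t) (mlin p) = (1 - t) * ev b (mlin p) + t * ev c (mlin p)"
proof -
  have "ev (path b c t) (mgen \<alpha>) = (1 - t) * ev b (mgen \<alpha>) + t * ev c (mgen \<alpha>)" for \<alpha>
    by (simp add: mgen_def ev_simps path_def)
  then show ?thesis
    unfolding ev_mlin_in_Rx[OF assms]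
    by (simp add: distrib_left sum.distrib sum_distrib_left mult.left_commute)
qed

lemma pme_path:
  assumes "pme (ev b)" "pme (ev c)" "0 \<le> t" "t \<le> 1"
  shows "pme (ev (path b c t))"
proof -
  have "0 \<le> ev (path b c t) (mlin (p\<^sup>2))" if "in_Rx p" for p
  proof -
    have "in_Rx (p\<^sup>2)" using in_Rx_mult[OF that that] by (simp add: power2_eq_square)
    moreover have "0 \<le> ev b (mlin (p\<^sup>2))" "0 \<le> ev c (mlin (p\<^sup>2))" using assms(1,2) that unfolding pme_def by blast+
    ultimately show ?thesis using assms(3,4) by (simp add: ev_path_mlin)
  qed
  then show ?thesis by (auto simp: pme_def ev_simps)
qed

lemma pme_eq_ev:
  assumes "pme \<phi>"
  shows "\<phi> = ev (\<lambda>v. \<phi> (pvar v))"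
proof
  have h: "\<phi> (p + q) = \<phi> p + \<phi> q" "\<phi> (p * q) = \<phi> p * \<phi> q" "\<phi> (pconst c) = c" for p q c
    using assms unfolding pme_def by blast+
  fix p show "\<phi> p = ev (\<lambda>v. \<phi> (pvar v)) p"
    using in_AV_UNIV[of p] by induction (simp_all only: h ev_add ev_mult ev_pconst ev_pvar)
qed

text \<open>Under a pseudo-moment evaluation every polynomial may be replaced by the one with specialised
  moment coefficients.\<close>

lemma pme_mlin_square:
  assumes "pme (ev b)"
  shows "0 \<le> ev b (mlin (p\<^sup>2))"
proof -
  \<comment> \<open>The arbitrary cofactor q lets the induction pass through products and later
    allows replacing both factors of p^2 in turn.\<close>
  have "\<exists>r\<in>AV (range XV). \<forall>q. ev b (mlin (p * q)) = ev b (mlin (r * q))"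
    using in_AV_UNIV[of p]
  proof induction
    case (AV_const c)
    show ?case using AV.AV_const by blast
  next
    case (AV_var v)
    show ?case
    proof (cases v)
      case (XV i)
      then show ?thesis using AV.AV_var[of v "range XV"] by auto
    next
      case (MV a)
      have "ev b (mlin (pvar v * q)) = ev b (mlin (pconst (b v) * q))" for q
        by (simp add: MV mlin_MV_mult mlin_pconst_mult ev_simps)
      then show ?thesis using AV.AV_const by blast
    qed
  next
    case (AV_add p q)
    then obtain r s where "r \<in> AV (range XV)" "s \<in> AV (range XV)"
      "\<And>q. ev b (mlin (p * q)) = ev b (mlin (r * q))" "\<And>p. ev b (mlin (q * p)) = ev b (mlin (s * p))" by blast
    then show ?case
      by (intro bexI[of _ "r + s"]) (auto simp: distrib_right mlin_add ev_simps intro: AV.AV_add)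
  next
    case (AV_mult p q)
    then obtain r s where rs: "r \<in> AV (range XV)" "s \<in> AV (range XV)"
      "\<And>q. ev b (mlin (p * q)) = ev b (mlin (r * q))" "\<And>p. ev b (mlin (q * p)) = ev b (mlin (s * p))" by blast
    have "ev b (mlin ((p * q) * u)) = ev b (mlin ((r * s) * u))" for u
    proof -
      have "ev b (mlin ((p * q) * u)) = ev b (mlin (r * (q * u)))" using rs(3)[of "q * u"] by (simp add: mult.assoc)
      also have "\<dots> = ev b (mlin (s * (r * u)))" using rs(4)[of "r * u"] by (simp add: ac_simps)
      finally show ?thesis by (simp add: ac_simps)
    qed
    then show ?case using rs(1,2) AV.AV_mult by blast
  qed
  then obtain r where r: "r \<in> AV (range XV)" "\<And>q. ev b (mlin (p * q)) = ev b (mlin (r * q))" by blast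
  have "ev b (mlin (p\<^sup>2)) = ev b (mlin (r * p))" using r(2)[of p] by (simp add: power2_eq_square)
  also have "\<dots> = ev b (mlin (r\<^sup>2))" using r(2)[of r] by (simp add: power2_eq_square mult.commute)
  finally show ?thesis using assms AV_XV_in_Rx[OF r(1)] by (simp add: pme_def)
qed

section \<open>The preordering\<close>

definition Omega_term :: "'n::finite Mpoly set" where
  "Omega_term = {(g 0)\<^sup>2 * (\<Prod>j\<in>{1..k}. mlin ((g j)\<^sup>2)) |g (k :: nat). True}"

lemma Omega_term_mult_norm:
  assumes "t \<in> Omega_term"
  shows "t * mlin (p\<^sup>2) \<in> Omega_term"
proof -
  obtain g and k :: nat where t: "t = (g 0)\<^sup>2 * (\<Prod>j\<in>{1..k}. mlin ((g j)\<^sup>2))" using assms 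
    unfolding Omega_term_def by blast
  define g' where "g' = g(Suc k := p)"
  have "(\<Prod>j\<in>{1..k}. mlin ((g' j)\<^sup>2)) = (\<Prod>j\<in>{1..k}. mlin ((g j)\<^sup>2))" by (rule prod.cong) (auto simp: g'_def)
  then have "t * mlin (p\<^sup>2) = (g' 0)\<^sup>2 * (\<Prod>j\<in>{1..Suc k}. mlin ((g' j)\<^sup>2))"
    by (simp add: t prod.atLeast1_atMost_eq prod.nat_ivl_Suc' g'_def ac_simps)
  then show ?thesis unfolding Omega_term_def by blast
qed

lemma Omega_term_mult_square:
  assumes "t \<in> Omega_term"
  shows "t * p\<^sup>2 \<in> Omega_term"
proof -
  obtain g and k :: nat where t: "t = (g 0)\<^sup>2 * (\<Prod>j\<in>{1..k}. mlin ((g j)\<^sup>2))" using assms 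
    unfolding Omega_term_def by blast
  define g' where "g' = g(0 := g 0 * p)"
  have "(\<Prod>j\<in>{1..k}. mlin ((g' j)\<^sup>2)) = (\<Prod>j\<in>{1..k}. mlin ((g j)\<^sup>2))" by (rule prod.cong) (auto simp: g'_def)
  then have "t * p\<^sup>2 = (g' 0)\<^sup>2 * (\<Prod>j\<in>{1..k}. mlin ((g' j)\<^sup>2))"
    by (simp add: t g'_def power_mult_distrib ac_simps)
  then show ?thesis unfolding Omega_term_def by blast
qed

lemma Omega_term_1: "1 \<in> Omega_term"
  unfolding Omega_term_def by (intro CollectI exI[of _ "\<lambda>_. 1"] exI[of _ 0]) simp

lemma Omega_term_mult:
  assumes "s \<in> Omega_term" "t \<in> Omega_term"
  shows "s * t \<in> Omega_term"
proof -
  obtain g and k :: nat where t: "t = (g 0)\<^sup>2 * (\<Prod>j\<in>{1..k}. mlin ((g j)\<^sup>2))" using assms(2) 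
    unfolding Omega_term_def by blast
  have "s * (g 0)\<^sup>2 * (\<Prod>j\<in>J. mlin ((g j)\<^sup>2)) \<in> Omega_term" for J
  proof (induction J rule: infinite_finite_induct)
    case (insert j J)
    then show ?case using Omega_term_mult_norm[OF insert.IH, of "g j"] by (simp add: ac_simps)
  qed (simp_all add: Omega_term_mult_square assms(1))
  then show ?thesis by (simp add: t mult.assoc)
qed

lemma Omega_hat_alt: "Omega_hat = {\<Sum>i<N. t i |t (N :: nat). \<forall>i. t i \<in> Omega_term}"
proof (rule equalityI; rule subsetI)
  fix p :: "'n::finite Mpoly" assume "p \<in> Omega_hat"
  then obtain N :: nat and k :: "nat \<Rightarrow> nat" and f where "p = (\<Sum>i<N. (f i 0)\<^sup>2 * (\<Prod>j\<in>{1..k i}. mlin ((f i j)\<^sup>2)))"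
    unfolding Omega_hat_def by blast
  moreover have "(f i 0)\<^sup>2 * (\<Prod>j\<in>{1..k i}. mlin ((f i j)\<^sup>2)) \<in> Omega_term" for i
    unfolding Omega_term_def by blast
  ultimately show "p \<in> {\<Sum>i<N. t i |t (N :: nat). \<forall>i. t i \<in> Omega_term}" by blast
next
  fix p :: "'n::finite Mpoly" assume "p \<in> {\<Sum>i<N. t i |t (N :: nat). \<forall>i. t i \<in> Omega_term}"
  then obtain t N where p: "p = (\<Sum>i<(N :: nat). t i)" and t: "\<forall>i. t i \<in> Omega_term" by blast
  from t have "\<forall>i. \<exists>g k. t i = (g 0)\<^sup>2 * (\<Prod>j\<in>{1..k :: nat}. mlin ((g j)\<^sup>2))" unfolding Omega_term_def by blast
  then obtain g k where "\<And>i. t i = (g i 0)\<^sup>2 * (\<Prod>j\<in>{1..k i :: nat}. mlin ((g i j)\<^sup>2))" by metis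
  then show "p \<in> Omega_hat" unfolding Omega_hat_def p by auto
qed

lemma Omega_hat_0: "0 \<in> Omega_hat"
proof -
  have "(\<Sum>i<0::nat. (\<lambda>_. 1 :: 'n::finite Mpoly) i) \<in> Omega_hat"
    unfolding Omega_hat_alt using Omega_term_1 by blast
  then show ?thesis by simp
qed

lemma Omega_hat_add_term:
  assumes "x \<in> Omega_hat" "s \<in> Omega_term"
  shows "x + s \<in> Omega_hat"
proof -
  obtain t N where x: "x = (\<Sum>i<(N :: nat). t i)" "\<And>i. t i \<in> Omega_term" using assms(1) by (auto simp: Omega_hat_alt)
  have "(\<Sum>i<N. (t(N := s)) i) = (\<Sum>i<N. t i)" by (rule sum.cong) auto
  then have "x + s = (\<Sum>i<Suc N. (t(N := s)) i)" by (simp add: x)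
  moreover have "\<forall>i. (t(N := s)) i \<in> Omega_term" using x assms(2) by auto
  ultimately show ?thesis unfolding Omega_hat_alt by blast
qed

lemma Omega_hat_induct [consumes 1, case_names zero add_term]:
  assumes "x \<in> Omega_hat" "P 0" "\<And>x t. x \<in> Omega_hat \<Longrightarrow> P x \<Longrightarrow> t \<in> Omega_term \<Longrightarrow> P (x + t)"
  shows "P x"
proof -
  obtain t N where x: "x = (\<Sum>i<(N :: nat). t i)" "\<And>i. t i \<in> Omega_term" using assms(1) by (auto simp: Omega_hat_alt)
  have "(\<Sum>i<n. t i) \<in> Omega_hat \<and> P (\<Sum>i<n. t i)" for n :: nat
    by (induction n) (auto simp: Omega_hat_0 assms(2) intro: Omega_hat_add_term assms(3) x(2))
  then show ?thesis by (simp add: x)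
qed

lemma Omega_hat_add:
  assumes "x \<in> Omega_hat" "y \<in> Omega_hat"
  shows "x + y \<in> Omega_hat"
  using assms(2)
proof (induction y rule: Omega_hat_induct)
  case (add_term y t)
  then show ?case using Omega_hat_add_term[of "x + y" t] by (simp add: add.assoc)
qed (simp add: assms(1))

lemma Omega_hat_term: "t \<in> Omega_term \<Longrightarrow> t \<in> Omega_hat"
  using Omega_hat_add_term[OF Omega_hat_0] by simp

lemma Omega_hat_mult_term:
  assumes "x \<in> Omega_hat" "s \<in> Omega_term"
  shows "s * x \<in> Omega_hat"
  using assms(1)
proof (induction x rule: Omega_hat_induct)
  case (add_term x t)
  then show ?case using assms(2) by (simp add: distrib_left Omega_hat_add_term Omega_term_mult)
qed (simp add: Omega_hat_0)

lemma Omega_hat_mult: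
  assumes "x \<in> Omega_hat" "y \<in> Omega_hat"
  shows "x * y \<in> Omega_hat"
  using assms(1)
proof (induction x rule: Omega_hat_induct)
  case (add_term x t)
  have "t * y \<in> Omega_hat" by (rule Omega_hat_mult_term[OF assms(2) add_term.hyps(2)])
  then show ?case using add_term.IH by (simp add: distrib_right Omega_hat_add)
qed (simp add: Omega_hat_0)

lemma Omega_hat_square: "p\<^sup>2 \<in> Omega_hat"
  using Omega_hat_term[OF Omega_term_mult_square[OF Omega_term_1, of p]] by simp

lemma Omega_hat_1: "1 \<in> Omega_hat"
  by (rule Omega_hat_term[OF Omega_term_1])

lemma Omega_hat_norm: "mlin (p\<^sup>2) \<in> Omega_hat"
  using Omega_hat_term[OF Omega_term_mult_norm[OF Omega_term_1, of p]] by simp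

lemma Omega_hat_nonneg:
  assumes "x \<in> Omega_hat" "pme (ev b)"
  shows "0 \<le> ev b x"
  using assms(1)
proof (induction rule: Omega_hat_induct)
  case (add_term x t)
  obtain g and k :: nat where "t = (g 0)\<^sup>2 * (\<Prod>j\<in>{1..k :: nat}. mlin ((g j)\<^sup>2))" using add_term.hyps(2) 
    unfolding Omega_term_def by blast
  then have "0 \<le> ev b t"
    by (auto simp: ev_simps intro!: mult_nonneg_nonneg prod_nonneg pme_mlin_square[OF assms(2), unfolded ev_simps])
  then show ?case using add_term.IH by (simp add: ev_simps)
qed simp

text \<open>Such an x vanishes under every pseudo-moment evaluation, which
  \<open>posdef_nonzero\<close> excludes for x \<noteq> 0.\<close>

lemma Omega_hat_pointed:
  assumes "x \<in> Omega_hat" "- x \<in> Omega_hat"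
  shows "x = 0"
proof (rule ccontr)
  assume "x \<noteq> 0"
  then obtain c where c: "posdef c" "ev c x \<noteq> 0" by (rule posdef_nonzero)
  have "0 \<le> ev c x" "0 \<le> ev c (- x)" using assms Omega_hat_nonneg[OF _ pme_ev[OF c(1)]] by blast+
  then show False using c(2) by (simp add: ev_simps)
qed

lemma Omega_hat_quotient_nonneg:
  assumes "g \<in> Omega_hat" "h \<in> Omega_hat" "h \<noteq> 0" "h * f = g" "pme \<phi>"
  shows "0 \<le> \<phi> f"
proof (rule ccontr)
  assume neg: "\<not> 0 \<le> \<phi> f"
  define b where "b v = \<phi> (pvar v)" for v
  have \<phi>: "\<phi> = ev b" unfolding b_def by (rule pme_eq_ev[OF assms(5)])
  obtain c where c: "posdef c" "ev c h \<noteq> 0" using posdef_nonzero[OF assms(3)] by blast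
  \<comment> \<open>For small t > 0 the value of f stays negative while h becomes nonzero, hence
    positive as h lies in \<open>Omega_hat\<close>; convexity keeps the point admissible.\<close>
  obtain t where t: "0 < t" "t < 1" "0 < ev (path b c t) (- f)" "ev (path b c t) h \<noteq> 0"
    by (rule path_perturb[of "{- f}" b c h]) (use neg \<phi> c(2) in \<open>auto simp: ev_simps\<close>)
  have p: "pme (ev (path b c t))" using pme_path[of b c t] assms(5) pme_ev[OF c(1)] t(1,2) \<phi> by simp
  have "0 < ev (path b c t) h" using Omega_hat_nonneg[OF assms(2) p] t(4) by simp
  moreover have "ev (path b c t) f < 0" using t(3) by (simp add: ev_simps)
  ultimately have "ev (path b c t) g < 0" unfolding assms(4)[symmetric] by (simp add: ev_simps mult_pos_neg)
  then show False using Omega_hat_nonneg[OF assms(1) p] by simp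
qed

lemma nonneg_Omega_hat_quotient:
  fixes f :: "'n::finite Mpoly"
  assumes f: "\<And>\<phi>. pme \<phi> \<Longrightarrow> 0 \<le> \<phi> f"
  shows "\<exists>g h. g \<in> Omega_hat \<and> h \<in> Omega_hat \<and> h \<noteq> 0 \<and> h * f = g"
proof (rule ccontr)
  assume no: "\<not> ?thesis"
  \<comment> \<open>The zero polynomial is the quotient 0/1. Nonzero f is needed because 0 must not
    lie in Q.\<close>
  have f0: "f \<noteq> 0" using no Omega_hat_0 Omega_hat_1 by (metis mult_zero_right zero_neq_one)
  define T where "T = {g - h * f |g h. g \<in> Omega_hat \<and> h \<in> Omega_hat}"
  have I: "g - h * f \<in> T" if "g \<in> Omega_hat" "h \<in> Omega_hat" for g h using that by (auto simp: T_def)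
  have OT: "g \<in> T" if "g \<in> Omega_hat" for g using I[OF that Omega_hat_0] by simp
  have "pcone T"
  proof (rule pconeI)
    show "0 \<in> T" "1 \<in> T" using OT Omega_hat_0 Omega_hat_1 by auto
    show "(x - y)\<^sup>2 \<in> T" for x y by (rule OT[OF Omega_hat_square])
  next
    fix x y assume "x \<in> T" "y \<in> T"
    then obtain a b c d where x: "x = a - b * f" "a \<in> Omega_hat" "b \<in> Omega_hat"
      and y: "y = c - d * f" "c \<in> Omega_hat" "d \<in> Omega_hat" unfolding T_def by blast
    have "x + y = (a + c) - (b + d) * f" by (simp add: x y algebra_simps)
    then show "x + y \<in> T" by (simp only:) (intro I Omega_hat_add x y)
    have "x * y = (a * c + b * d * f\<^sup>2) - (a * d + b * c) * f"
      by (simp add: x y algebra_simps power2_eq_square)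
    then show "x * y \<in> T" by (simp only:) (intro I Omega_hat_add Omega_hat_mult Omega_hat_square x y)
  next
    fix x assume "x \<in> T" "- x \<in> T"
    then obtain a b c d where x: "x = a - b * f" "a \<in> Omega_hat" "b \<in> Omega_hat"
      and y: "- x = c - d * f" "c \<in> Omega_hat" "d \<in> Omega_hat" unfolding T_def by blast
    have e: "(b + d) * f = a + c" using x(1) y(1) by (simp add: algebra_simps)
    \<comment> \<open>The assumption that f is no quotient enters here: b + d is a denominator for f
      and so has to vanish.\<close>
    have bd: "b + d = 0" using no e Omega_hat_add x y by blast
    then have "d = - b" by (simp add: add_eq_0_iff)
    then have "b = 0" using Omega_hat_pointed[OF x(3)] y(3) by blast
    moreover have "c = - a" using e bd by (simp add: add_eq_0_iff)
    then have "a = 0" using Omega_hat_pointed[OF x(2)] y(2) by blast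
    ultimately show "x = 0" by (simp add: x)
  qed
  obtain K where K: "K \<ge> 1" "\<And>b c. agree (Suc K) b c \<Longrightarrow> ev b f = ev c f" by (rule bounded_vars[of f]) blast
  \<comment> \<open>The norms of weight at most K are exactly what \<open>posdef_extend\<close>
    needs in order to leave the value of f unchanged.\<close>
  define Q where "Q = insert (- f) (gnorm ` {w :: 'n \<Rightarrow> nat. wt w < Suc K})"
  obtain e :: "'n mvar \<Rightarrow> real" where e: "posdef e" by (rule posdef_nonzero[of 1]) auto
  have g0: "gnorm w \<noteq> 0" for w :: "'n \<Rightarrow> nat" using e unfolding posdef_def by (metis ev_zero less_irrefl)
  have "\<exists>b. \<forall>q\<in>Q. 0 < ev b q"
  proof (rule preordering_real_point[OF \<open>pcone T\<close>])
    show "x\<^sup>2 \<in> T" for x by (rule OT[OF Omega_hat_square])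
    show "finite Q" unfolding Q_def using finite_wt_less by blast
    have "- f \<in> T" using I[OF Omega_hat_0 Omega_hat_1] by simp
    then show "Q \<subseteq> T" unfolding Q_def gnorm_def using OT[OF Omega_hat_norm] by auto
    show "0 \<notin> Q" using f0 g0 unfolding Q_def by (metis (no_types, lifting) imageE insertE neg_equal_0_iff_equal)
  qed
  then obtain b where b: "\<And>q. q \<in> Q \<Longrightarrow> 0 < ev b q" by blast
  obtain c where c: "posdef c" "agree (Suc K) b c"
    by (rule posdef_extend[OF K(1), of b]) (use b in \<open>auto simp: Q_def\<close>)
  have "ev b f < 0" using b[of "- f"] by (simp add: Q_def ev_simps)
  then have "ev c f < 0" using K(2)[OF c(2)] by simp
  then show False using f[OF pme_ev[OF c(1)]] by simp
qed

theorem theorem3p7: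
  fixes f :: "'n::finite Mpoly"
  shows "(\<forall>\<phi>. pme \<phi> \<longrightarrow> \<phi> f \<ge> 0) \<longleftrightarrow>
         (\<exists>g h. g \<in> Omega_hat \<and> h \<in> Omega_hat \<and> h \<noteq> 0 \<and> h * f = g)"
  using nonneg_Omega_hat_quotient Omega_hat_quotient_nonneg by blast

end
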